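(* Let $f:\mathbb{R}^n\to\mathbb{R}^n$, $n\ge3$, be a diffeomorphism. Consider two sets $U,\widetilde U\subset\mathbb{R}^n$ with two hyperbolic invariant sets for $f$, $$\Lambda=\mathrm{Inv}(f,U)\qquad\text{and}\qquad\widetilde\Lambda=\mathrm{Inv}(f,\widetilde U).$$ Let $\{M_l\}_{l\in L}$ and $\{\widetilde M_i\}_{i\in I}$ be two finite families of h-sets with $M_l\subset U$ and $\widetilde M_i\subset\widetilde U$. Consider the condition: (B3) The families $\{M_l\}$ and $\{\widetilde M_i\}$ are interconnected by sequences of covering relations. If (B3) is satisfied and the indices of the sets $\Lambda$ and $\widetilde\Lambda$ are different, then $f$ has a heterodimensional cycle (associated with $\Lambda$ and $\widetilde\Lambda$).
   Context: Invariant sets. $\mathrm{Inv}(f,U)=\{z: f^k(z)\in U \text{ for all } k\in\mathbb{Z}\}$. A set $\Lambda$ is hyperbolic for $f$ if for every $p\in\Lambda$ the tangent space at $p$ splits as $E^u_p\oplus E^s_p$, this splitting is invariant under $Df$, and there are $c>0$, $\lambda\in(0,1)$ independent of $p$ with $\|Df^{-j}(p)v_u\|<c\lambda^j\|v_u\|$ and $\|Df^{j}(p)v_s\|<c\lambda^j\|v_s\|$ for all $j\ge1$ and nonzero $v_u\in E^u_p$, $v_s\in E^s_p$. The index of $\Lambda$ is the dimension of its unstable bundle. Stable and unstable manifolds. $W^u_{\mathrm{loc}}(\Lambda)=\bigcup_{p\in\Lambda}W^u_{p,\mathrm{loc}}$, $W^s_{\mathrm{loc}}(\Lambda)=\bigcup_{p\in\Lambda}W^s_{p,\mathrm{loc}}$,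 where (for the set $U$) $W^u_{p,\mathrm{loc}}=\{q:\|f^{-j}(p)-f^{-j}(q)\|\to0 \text{ as } j\to\infty,\ f^{-j}(q)\in U\ \forall j\ge0\}$ and $W^s_{p,\mathrm{loc}}=\{q:\|f^{j}(p)-f^{j}(q)\|\to0 \text{ as } j\to\infty,\ f^{j}(q)\in U\ \forall j\ge0\}$. Globally, $W^u(\Lambda)=\bigcup_{k\ge0}f^k(W^u_{\mathrm{loc}}(\Lambda))$ and $W^s(\Lambda)=\bigcup_{k\le0}f^k(W^s_{\mathrm{loc}}(\Lambda))$. The same definitions apply to $\widetilde\Lambda$ with $\widetilde U$. Heterodimensional cycle. For hyperbolic sets $\Lambda,\widetilde\Lambda$ of $f$, $f$ has a heterodimensional cycle if the indices of $\Lambda$ and $\widetilde\Lambda$ are different, and $W^s(\Lambda)\cap W^u(\widetilde\Lambda)\neq\emptyset$ and $W^s(\widetilde\Lambda)\cap W^u(\Lambda)\neq\emptyset$. h-sets. A compact set $N\subset\mathbb{R}^n$ is an h-set if it comes with a homeomorphism $\gamma:\mathbb{R}^n\to\mathbb{R}^n=\mathbb{R}^{d_x}\times\mathbb{R}^{d_y}$ such that $N_\gamma:=\gamma(N)=\overline B_{d_x}\times\overline B_{d_y}$, a product of closed unit balls (with respect to some chosen norms). $d_x$ is the topological exit dimension, $d_y$ the topological entry dimension; $N^-=\gamma^{-1}(\partial\overline B_{d_x}\times\overline B_{d_y})$, $N^+=\gamma^{-1}(\overline B_{d_x}\times\partial\overline B_{d_y})$. All h-sets considered have the same $d_x$ and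 the same $d_y$. The homeomorphism associated with $N_i$ is denoted $\gamma_i$ (similarly for every other h-set). Covering. For h-sets $N_i,N_j$ put $f_{ji}=\gamma_j\circ f\circ\gamma_i^{-1}$. Write $N_i\stackrel{f}{\Longrightarrow}N_j$ ($N_i$ $f$-covers $N_j$) if there exist: (1) a homotopy $\varsigma:[0,1]\times N_{\gamma_i}\to\mathbb{R}^{d_x}\times\mathbb{R}^{d_y}$ with $\varsigma(0,(x,y))=f_{ji}(x,y)$ for all $(x,y)\in N_{\gamma_i}$, and $\varsigma(t,\gamma_i(N_i^-))\cap N_{\gamma_j}=\emptyset$ and $\varsigma(t,N_{\gamma_i})\cap\gamma_j(N_j^+)=\emptyset$ for all $t\in[0,1]$; and (2) a linear map $A:\mathbb{R}^{d_x}\to\mathbb{R}^{d_x}$ with $\varsigma(1,(x,y))=(Ax,0)$ for all $(x,y)\in N_{\gamma_i}$ and $A(\partial\overline B_{d_x})\subset\mathbb{R}^{d_x}\setminus\overline B_{d_x}$. Cones. With chosen norms $\|\cdot\|_{d_x}$, $\|\cdot\|_{d_y}$ on $\mathbb{R}^{d_x}$, $\mathbb{R}^{d_y}$ (possibly different from those defining the balls) and coordinate projections $\pi_x,\pi_y$, $\mathcal{C}_{\gamma_i}(w)=\{(q_x,q_y): \|q_x-\pi_x(w)\|_{d_x}>\|q_y-\pi_y(w)\|_{d_y}\}$, and for $z\in N_i$, $\mathcal{C}_i(z)=\gamma_i^{-1}(\mathcal{C}_{\gamma_i}(\gamma_i(z)))$. $f$ satisfies cone conditions from $N_i$ to $N_j$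 if for every $z\in N_i$ with $f(z)\in N_j$ one has $f(\mathcal{C}_i(z))\subset\mathcal{C}_j(f(z))$. Horizontal disks. $[h]\subset\mathbb{R}^n$ is a horizontal disk in $N_i$ if there is a continuous $h:\overline B_{d_x}\to\overline B_{d_y}$ with $\gamma_i([h])=\{(x,h(x)):x\in\overline B_{d_x}\}$ and, for all $x_1\neq x_2$ in $\overline B_{d_x}$, $(x_1,h(x_1))\in\mathcal{C}_{\gamma_i}(x_2,h(x_2))$. Connected families. Let $\{K_j\}_{j\in J}$ be a further finite family of h-sets. The family $\{M_l\}$ is connected to the family $\{\widetilde M_i\}$ by sequences of covering relations if for every $l\in L$ and every horizontal disk $[h]$ in $M_l$ there exist h-sets $K_{j_0},K_{j_1},\dots,K_{j_r}$ (from $\{K_j\}_{j\in J}$) and a set $\widetilde M_i$ (which may depend on $[h]$ and $l$) such that: (1) $[h]\cap K_{j_0}$ is a horizontal disk in $K_{j_0}$; (2) $K_{j_0}\stackrel{f}{\Longrightarrow}K_{j_1}\stackrel{f}{\Longrightarrow}\cdots\stackrel{f}{\Longrightarrow}K_{j_r}\stackrel{f}{\Longrightarrow}\widetilde M_i$; (3) $f$ satisfies cone conditions from $K_{j_{m-1}}$ to $K_{j_m}$ for $m=1,\dots,r$, and from $K_{j_r}$ to $\widetilde M_i$; (4) the length $r$ is bounded above by a constant independent of the choice of $[h]$ and $l$. A family $\{M_l\}$ of h-sets contained in $U$ is connected to itself in $U$ if $\{M_l\}$ is connected to $\{M_l\}$ by sequences of covering relations and all the h-sets $K_{j_m}$ involved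 in those sequences are subsets of $U$. Interconnected. $\{M_l\}$ (in $U$) and $\{\widetilde M_i\}$ (in $\widetilde U$) are interconnected by sequences of covering relations if: (1) $\{M_l\}$ is connected to $\{\widetilde M_i\}$; (2) $\{\widetilde M_i\}$ is connected to $\{M_l\}$; (3) $\{M_l\}$ is connected to itself in $U$; (4) $\{\widetilde M_i\}$ is connected to itself in $\widetilde U$. *)

theory Defs
  imports "HOL-Analysis.Analysis"
begin

section \<open>Diffeomorphisms, invariant sets, hyperbolicity\<close>

definition C1_map :: "(real^'n \<Rightarrow> real^'n) \<Rightarrow> bool" where
  "C1_map f \<longleftrightarrow>
     (\<exists>f' :: real^'n \<Rightarrow> ((real^'n) \<Rightarrow>\<^sub>L (real^'n)).
        (\<forall>x. (f has_derivative blinfun_apply (f' x)) (at x)) \<and> continuous_on UNIV f')"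

definition diffeomorphism :: "(real^'n \<Rightarrow> real^'n) \<Rightarrow> bool" where
  "diffeomorphism f \<longleftrightarrow> bij f \<and> C1_map f \<and> C1_map (inv f)"

definition iter :: "('a \<Rightarrow> 'a) \<Rightarrow> int \<Rightarrow> 'a \<Rightarrow> 'a" where
  "iter f k = (if k \<ge> 0 then f ^^ nat k else inv f ^^ nat (- k))"

definition Inv :: "('a \<Rightarrow> 'a) \<Rightarrow> 'a set \<Rightarrow> 'a set" where
  "Inv f U = {z. \<forall>k::int. iter f k z \<in> U}"

definition hyperbolic_splitting ::
  "(real^'n \<Rightarrow> real^'n) \<Rightarrow> (real^'n) set \<Rightarrow> (real^'n \<Rightarrow> (real^'n) set) \<Rightarrow>
   (real^'n \<Rightarrow> (real^'n) set) \<Rightarrow> bool" where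
  "hyperbolic_splitting f \<Lambda> Eu Es \<longleftrightarrow>
     (\<forall>p\<in>\<Lambda>. subspace (Eu p) \<and> subspace (Es p) \<and>
        Eu p \<inter> Es p = {0} \<and> {u + s | u s. u \<in> Eu p \<and> s \<in> Es p} = UNIV \<and>
        frechet_derivative f (at p) ` Eu p = Eu (f p) \<and>
        frechet_derivative f (at p) ` Es p = Es (f p)) \<and>
     (\<exists>c>0. \<exists>\<mu>. 0 < \<mu> \<and> \<mu> < 1 \<and>
        (\<forall>p\<in>\<Lambda>. \<forall>j\<ge>(1::nat).
           (\<forall>v\<in>Eu p - {0}.
              norm (frechet_derivative (iter f (- int j)) (at p) v) < c * \<mu> ^ j * norm v) \<and>
           (\<forall>v\<in>Es p - {0}.
              norm (frechet_derivative (iter f (int j)) (at p) v) < c * \<mu> ^ j * norm v)))"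

definition hyperbolic :: "(real^'n \<Rightarrow> real^'n) \<Rightarrow> (real^'n) set \<Rightarrow> bool" where
  "hyperbolic f \<Lambda> \<longleftrightarrow> (\<exists>Eu Es. hyperbolic_splitting f \<Lambda> Eu Es)"

text \<open>
  The unstable spaces of a hyperbolic splitting over an invariant set are uniquely determined, so
  the index is well defined on non-empty sets; it exists only if their dimension is constant.
\<close>

definition has_index :: "(real^'n \<Rightarrow> real^'n) \<Rightarrow> (real^'n) set \<Rightarrow> nat \<Rightarrow> bool" where
  "has_index f \<Lambda> k \<longleftrightarrow>
     (\<exists>Eu Es. hyperbolic_splitting f \<Lambda> Eu Es \<and> (\<forall>p\<in>\<Lambda>. dim (Eu p) = k))"

definition indices_differ ::
  "(real^'n \<Rightarrow> real^'n) \<Rightarrow> (real^'n) set \<Rightarrow> (real^'n) set \<Rightarrow> bool" where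
  "indices_differ f \<Lambda> \<Lambda>' \<longleftrightarrow> (\<exists>k k'. has_index f \<Lambda> k \<and> has_index f \<Lambda>' k' \<and> k \<noteq> k')"


section \<open>Stable and unstable sets, heterodimensional cycles\<close>

definition Wu_loc_pt ::
  "(real^'n \<Rightarrow> real^'n) \<Rightarrow> (real^'n) set \<Rightarrow> real^'n \<Rightarrow> (real^'n) set" where
  "Wu_loc_pt f U p =
     {q. (\<lambda>j::nat. norm (iter f (- int j) p - iter f (- int j) q)) \<longlonglongrightarrow> 0 \<and>
         (\<forall>j::nat. iter f (- int j) q \<in> U)}"

definition Ws_loc_pt ::
  "(real^'n \<Rightarrow> real^'n) \<Rightarrow> (real^'n) set \<Rightarrow> real^'n \<Rightarrow> (real^'n) set" where
  "Ws_loc_pt f U p =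
     {q. (\<lambda>j::nat. norm (iter f (int j) p - iter f (int j) q)) \<longlonglongrightarrow> 0 \<and>
         (\<forall>j::nat. iter f (int j) q \<in> U)}"

definition Wu_loc ::
  "(real^'n \<Rightarrow> real^'n) \<Rightarrow> (real^'n) set \<Rightarrow> (real^'n) set \<Rightarrow> (real^'n) set" where
  "Wu_loc f U \<Lambda> = (\<Union>p\<in>\<Lambda>. Wu_loc_pt f U p)"

definition Ws_loc ::
  "(real^'n \<Rightarrow> real^'n) \<Rightarrow> (real^'n) set \<Rightarrow> (real^'n) set \<Rightarrow> (real^'n) set" where
  "Ws_loc f U \<Lambda> = (\<Union>p\<in>\<Lambda>. Ws_loc_pt f U p)"

definition Wu ::
  "(real^'n \<Rightarrow> real^'n) \<Rightarrow> (real^'n) set \<Rightarrow> (real^'n) set \<Rightarrow> (real^'n) set" where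
  "Wu f U \<Lambda> = (\<Union>k\<in>{0::int..}. iter f k ` Wu_loc f U \<Lambda>)"

definition Ws ::
  "(real^'n \<Rightarrow> real^'n) \<Rightarrow> (real^'n) set \<Rightarrow> (real^'n) set \<Rightarrow> (real^'n) set" where
  "Ws f U \<Lambda> = (\<Union>k\<in>{..0::int}. iter f k ` Ws_loc f U \<Lambda>)"

definition heterodimensional_cycle ::
  "(real^'n \<Rightarrow> real^'n) \<Rightarrow> (real^'n) set \<Rightarrow> (real^'n) set \<Rightarrow>
   (real^'n) set \<Rightarrow> (real^'n) set \<Rightarrow> bool" where
  "heterodimensional_cycle f U \<Lambda> U' \<Lambda>' \<longleftrightarrow>
     hyperbolic f \<Lambda> \<and> hyperbolic f \<Lambda>' \<and> indices_differ f \<Lambda> \<Lambda>' \<and>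
     Ws f U \<Lambda> \<inter> Wu f U' \<Lambda>' \<noteq> {} \<and> Ws f U' \<Lambda>' \<inter> Wu f U \<Lambda> \<noteq> {}"


section \<open>h-sets\<close>

text \<open>
  The decomposition of R^n into R^{d_x} x R^{d_y} is encoded inside real^'n by a set S of
  coordinate indices with card S = d_x. The factors are the coordinate subspaces belonging to S
  and to -S, and a pair (x, y) is the sum x + y. In this way d_x + d_y = n holds automatically, and
  all values 0 <= d_x <= n occur. The norms on the factors are arbitrary functions whose values
  matter on the respective coordinate subspace only.
\<close>

definition coord_space :: "'n set \<Rightarrow> (real^'n) set" where
  "coord_space S = {v. \<forall>i. i \<notin> S \<longrightarrow> v $ i = 0}"

definition coord_proj :: "'n set \<Rightarrow> real^'n \<Rightarrow> real^'n" where
  "coord_proj S v = (\<chi> i. if i \<in> S then v $ i else 0)"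

definition norm_on :: "'a::real_vector set \<Rightarrow> ('a \<Rightarrow> real) \<Rightarrow> bool" where
  "norm_on V \<nu> \<longleftrightarrow>
     (\<forall>x\<in>V. 0 \<le> \<nu> x \<and> (\<nu> x = 0 \<longleftrightarrow> x = 0)) \<and>
     (\<forall>c. \<forall>x\<in>V. \<nu> (c *\<^sub>R x) = \<bar>c\<bar> * \<nu> x) \<and>
     (\<forall>x\<in>V. \<forall>y\<in>V. \<nu> (x + y) \<le> \<nu> x + \<nu> y)"

record 'n frame =
  exit_coords :: "'n set"
  ball_norm_x :: "real^'n \<Rightarrow> real"
  ball_norm_y :: "real^'n \<Rightarrow> real"
  cone_norm_x :: "real^'n \<Rightarrow> real"
  cone_norm_y :: "real^'n \<Rightarrow> real"

definition xspace :: "'n frame \<Rightarrow> (real^'n) set" where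
  "xspace G = coord_space (exit_coords G)"

definition yspace :: "'n frame \<Rightarrow> (real^'n) set" where
  "yspace G = coord_space (- exit_coords G)"

definition proj_x :: "'n frame \<Rightarrow> real^'n \<Rightarrow> real^'n" where
  "proj_x G = coord_proj (exit_coords G)"

definition proj_y :: "'n frame \<Rightarrow> real^'n \<Rightarrow> real^'n" where
  "proj_y G = coord_proj (- exit_coords G)"

definition is_frame :: "'n::finite frame \<Rightarrow> bool" where
  "is_frame G \<longleftrightarrow>
     norm_on (xspace G) (ball_norm_x G) \<and> norm_on (yspace G) (ball_norm_y G) \<and>
     norm_on (xspace G) (cone_norm_x G) \<and> norm_on (yspace G) (cone_norm_y G)"

definition Bx :: "'n frame \<Rightarrow> (real^'n) set" where
  "Bx G = {x \<in> xspace G. ball_norm_x G x \<le> 1}"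

definition By :: "'n frame \<Rightarrow> (real^'n) set" where
  "By G = {y \<in> yspace G. ball_norm_y G y \<le> 1}"

definition bdBx :: "'n frame \<Rightarrow> (real^'n) set" where
  "bdBx G = {x \<in> xspace G. ball_norm_x G x = 1}"

definition bdBy :: "'n frame \<Rightarrow> (real^'n) set" where
  "bdBy G = {y \<in> yspace G. ball_norm_y G y = 1}"

definition xy_prod :: "(real^'n) set \<Rightarrow> (real^'n) set \<Rightarrow> (real^'n) set" where
  "xy_prod X Y = {x + y | x y. x \<in> X \<and> y \<in> Y}"

record 'n hset =
  carr :: "(real^'n) set"
  chart :: "real^'n \<Rightarrow> real^'n"

definition unit_box :: "'n frame \<Rightarrow> (real^'n) set" where
  "unit_box G = xy_prod (Bx G) (By G)"

definition is_hset :: "'n::finite frame \<Rightarrow> 'n hset \<Rightarrow> bool" where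
  "is_hset G N \<longleftrightarrow>
     compact (carr N) \<and> (\<exists>g. homeomorphism UNIV UNIV (chart N) g) \<and> chart N ` carr N = unit_box G"

definition exit_set :: "'n frame \<Rightarrow> 'n hset \<Rightarrow> (real^'n) set" where
  "exit_set G N = inv (chart N) ` xy_prod (bdBx G) (By G)"

definition entry_set :: "'n frame \<Rightarrow> 'n hset \<Rightarrow> (real^'n) set" where
  "entry_set G N = inv (chart N) ` xy_prod (Bx G) (bdBy G)"


section \<open>Covering relations, cone conditions, horizontal disks\<close>

text \<open>
  A linear map of R^{d_x} is represented by a linear map A of R^n that preserves the first factor;
  the second component 0 of (A x, 0) is then implicit.
\<close>

definition f_covers ::
  "'n::finite frame \<Rightarrow> (real^'n \<Rightarrow> real^'n) \<Rightarrow> 'n hset \<Rightarrow> 'n hset \<Rightarrow> bool" where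
  "f_covers G f N N' \<longleftrightarrow>
     (\<exists>\<sigma> A. continuous_on ({0..1::real} \<times> unit_box G) (\<lambda>(t, v). \<sigma> t v) \<and>
        (\<forall>v\<in>unit_box G. \<sigma> 0 v = (chart N' \<circ> f \<circ> inv (chart N)) v) \<and>
        (\<forall>t\<in>{0..1}. \<sigma> t ` (chart N ` exit_set G N) \<inter> unit_box G = {}) \<and>
        (\<forall>t\<in>{0..1}. \<sigma> t ` unit_box G \<inter> chart N' ` entry_set G N' = {}) \<and>
        linear A \<and> A ` xspace G \<subseteq> xspace G \<and>
        (\<forall>v\<in>unit_box G. \<sigma> 1 v = A (proj_x G v)) \<and>
        A ` bdBx G \<subseteq> xspace G - Bx G)"

definition chart_cone :: "'n frame \<Rightarrow> real^'n \<Rightarrow> (real^'n) set" where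
  "chart_cone G w =
     {q. cone_norm_x G (proj_x G q - proj_x G w) > cone_norm_y G (proj_y G q - proj_y G w)}"

definition cone_at :: "'n frame \<Rightarrow> 'n hset \<Rightarrow> real^'n \<Rightarrow> (real^'n) set" where
  "cone_at G N z = inv (chart N) ` chart_cone G (chart N z)"

definition cone_conditions ::
  "'n frame \<Rightarrow> (real^'n \<Rightarrow> real^'n) \<Rightarrow> 'n hset \<Rightarrow> 'n hset \<Rightarrow> bool" where
  "cone_conditions G f N N' \<longleftrightarrow>
     (\<forall>z\<in>carr N. f z \<in> carr N' \<longrightarrow> f ` cone_at G N z \<subseteq> cone_at G N' (f z))"

definition horizontal_disk :: "'n::finite frame \<Rightarrow> 'n hset \<Rightarrow> (real^'n) set \<Rightarrow> bool" where
  "horizontal_disk G N D \<longleftrightarrow>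
     (\<exists>h. continuous_on (Bx G) h \<and> h ` Bx G \<subseteq> By G \<and>
        chart N ` D = {x + h x | x. x \<in> Bx G} \<and>
        (\<forall>x\<^sub>1\<in>Bx G. \<forall>x\<^sub>2\<in>Bx G. x\<^sub>1 \<noteq> x\<^sub>2 \<longrightarrow> x\<^sub>1 + h x\<^sub>1 \<in> chart_cone G (x\<^sub>2 + h x\<^sub>2)))"


section \<open>Families connected by sequences of covering relations\<close>

definition connected_by ::
  "'n::finite frame \<Rightarrow> (real^'n \<Rightarrow> real^'n) \<Rightarrow> ('j \<Rightarrow> 'n hset) \<Rightarrow> 'j set \<Rightarrow>
   ('l \<Rightarrow> 'n hset) \<Rightarrow> 'l set \<Rightarrow> ('i \<Rightarrow> 'n hset) \<Rightarrow> 'i set \<Rightarrow> bool" where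
  "connected_by G f K J M L M' I \<longleftrightarrow>
     (\<exists>R::nat. \<forall>l\<in>L. \<forall>D. horizontal_disk G (M l) D \<longrightarrow>
        (\<exists>r\<le>R. \<exists>j::nat \<Rightarrow> 'j. \<exists>i\<in>I.
           (\<forall>m\<le>r. j m \<in> J) \<and>
           horizontal_disk G (K (j 0)) (D \<inter> carr (K (j 0))) \<and>
           (\<forall>m<r. f_covers G f (K (j m)) (K (j (Suc m))) \<and>
                  cone_conditions G f (K (j m)) (K (j (Suc m)))) \<and>
           f_covers G f (K (j r)) (M' i) \<and> cone_conditions G f (K (j r)) (M' i)))"

definition self_connected_in ::
  "(real^'n::finite) set \<Rightarrow> 'n frame \<Rightarrow> (real^'n \<Rightarrow> real^'n) \<Rightarrow> ('j \<Rightarrow> 'n hset) \<Rightarrow> 'j set \<Rightarrow>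
   ('l \<Rightarrow> 'n hset) \<Rightarrow> 'l set \<Rightarrow> bool" where
  "self_connected_in U G f K J M L \<longleftrightarrow>
     connected_by G f K {j \<in> J. carr (K j) \<subseteq> U} M L M L"

definition interconnected ::
  "'n::finite frame \<Rightarrow> (real^'n \<Rightarrow> real^'n) \<Rightarrow> ('j \<Rightarrow> 'n hset) \<Rightarrow> 'j set \<Rightarrow>
   (real^'n) set \<Rightarrow> ('l \<Rightarrow> 'n hset) \<Rightarrow> 'l set \<Rightarrow>
   (real^'n) set \<Rightarrow> ('i \<Rightarrow> 'n hset) \<Rightarrow> 'i set \<Rightarrow> bool" where
  "interconnected G f K J U M L U' M' I \<longleftrightarrow>
     connected_by G f K J M L M' I \<and> connected_by G f K J M' I M L \<and>
     self_connected_in U G f K J M L \<and> self_connected_in U' G f K J M' I"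

end

theory Submission
  imports Defs
begin

text \<open>
  Cone conditions and a Brouwer argument show that the image of a horizontal disk under a covering
  relation contains a horizontal disk of the next h-set. Composing long chains inside U, one
  connecting chain, and long chains inside U', and letting the lengths tend to infinity, one gets by
  compactness a point z whose backward orbit follows chains in U and whose forward orbit eventually
  follows chains in U'.

  Chain orbits stay in a compact subset A of the interior of U: covering relations keep them away
  from the boundaries of the h-sets, and where a disk is cut down from M to K this follows from
  invariance of domain. Hence the limit set of such an orbit is a compact hyperbolic set with a
  neighbourhood contained in U, and shadowing the orbit together with an orbit of the limit set gives
  a full orbit in U which is asymptotic to it. So z lies in the unstable set of Inv f U and in the
  stable set of Inv f U'. Exchanging the two families gives the other intersection.
\<close>

section \<open>Iterates and derivatives\<close>

text \<open>Neither \<open>U\<close> nor \<open>Inv f U\<close> is assumed closed or bounded, and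
  \<open>hyperbolic_splitting\<close> asks for no continuity of the bundles. Both are handled over
  \<open>Inv f A\<close> with \<open>A\<close> compact: stable vectors are those with bounded
  forward orbit, so the bundles are closed, and compactness gives uniformly continuous projections.
  The constant \<open>c\<close> in the rates may exceed 1, so shadowing is done for a power of
  \<open>f\<close>; times in between are controlled by uniform continuity. The shadowing orbit
  belongs to \<open>Inv f U\<close> by maximality, since that set contains every full orbit in
  \<open>U\<close>. The delicate point of a chain is its junction with the next one. There a disk in
  \<open>N\<close> is cut to a set \<open>K\<close> that the previous set does not cover: the entry
  side is controlled in \<open>N\<close>, the exit side only in \<open>K\<close>, and the latter has
  to be transported to \<open>N\<close>. The first disk has no predecessor at all, hence
  \<open>entered_disk\<close>. The bound on chain lengths makes the limit possible: the connecting
  time takes finitely many values, so one value serves for arbitrarily long chains on both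
  sides.\<close>

lemma iter_0 [simp]: "iter f 0 = id" and iter_1 [simp]: "iter f 1 = f"
  by (simp_all add: iter_def)

lemma iter_uminus_of_nat: "iter f (- int n) = inv f ^^ n"
  by (auto simp: iter_def)

lemma iter_plus_1: "bij f \<Longrightarrow> iter f (k + 1) z = f (iter f k z)"
proof -
  assume b: "bij f"
  show ?thesis
  proof (cases "k \<ge> 0")
    case True
    then have "nat (k + 1) = Suc (nat k)" by simp
    with True show ?thesis by (simp add: iter_def)
  next
    case False
    then have "nat (- k) = Suc (nat (- (k + 1)))" by simp
    then have "iter f k z = inv f (iter f (k + 1) z)"
      using False by (cases "k = -1") (auto simp: iter_def)
    then show ?thesis using b by (simp add: bij_is_surj surj_f_inv_f)
  qed
qed

lemma iter_minus_1: "bij f \<Longrightarrow> iter f (k - 1) z = inv f (iter f k z)"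
  using iter_plus_1[of f "k - 1" z] by (simp add: bij_is_inj inv_f_f)

lemma iter_add: "bij f \<Longrightarrow> iter f (a + b) z = iter f a (iter f b z)"
proof (induction a rule: int_induct[where k = 0])
  case (step1 i)
  then show ?case using iter_plus_1[of f "i + b" z] iter_plus_1[of f i] by (simp add: algebra_simps)
next
  case (step2 i)
  then show ?case using iter_minus_1[of f "i + b" z] iter_minus_1[of f i] by (simp add: algebra_simps)
qed simp

lemma iter_minus_cancel [simp]:
  assumes "bij f" shows "iter f (- k) (iter f k z) = z" "iter f k (iter f (- k) z) = z"
  using iter_add[OF assms, of "-k" k z] iter_add[OF assms, of k "-k" z] by simp_all

lemma iter_inv: "bij f \<Longrightarrow> iter (inv f) k = iter f (- k)"
  by (auto simp: iter_def inv_inv_eq)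

lemma Inv_inv: "bij f \<Longrightarrow> Inv (inv f) U = Inv f U"
  unfolding Inv_def iter_inv by (auto, metis minus_minus)

lemma iter_in_Inv: "bij f \<Longrightarrow> iter f k z \<in> Inv f U \<longleftrightarrow> z \<in> Inv f U"
proof -
  assume b: "bij f"
  have "iter f k z \<in> Inv f U" if "z \<in> Inv f U" for k z
    using that b by (auto simp: Inv_def simp flip: iter_add)
  then show ?thesis using b iter_minus_cancel(1)[OF b, of k z] by metis
qed

section \<open>C1 maps and derivatives of iterates\<close>

lemma C1_map_id: "C1_map id"
  unfolding C1_map_def
  by (rule exI[of _ "\<lambda>_. id_blinfun"]) (auto simp: id_def)

lemma C1_map_comp:
  assumes "C1_map f" "C1_map g" shows "C1_map (f \<circ> g)"
proof -
  obtain f' where f': "\<And>x. (f has_derivative blinfun_apply (f' x)) (at x)" "continuous_on UNIV f'"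
    using assms(1) by (auto simp: C1_map_def)
  obtain g' where g': "\<And>x. (g has_derivative blinfun_apply (g' x)) (at x)" "continuous_on UNIV g'"
    using assms(2) by (auto simp: C1_map_def)
  have "continuous_on UNIV g"
    using g'(1) by (meson continuous_at_imp_continuous_on has_derivative_continuous)
  then have "continuous_on UNIV (\<lambda>x. f' (g x) o\<^sub>L g' x)"
    by (intro bounded_bilinear.continuous_on[OF bounded_bilinear_blinfun_compose]
          continuous_on_compose2[OF f'(2)] g'(2)) auto
  moreover have "(f \<circ> g has_derivative blinfun_apply (f' (g x) o\<^sub>L g' x)) (at x)" for x
    using diff_chain_at[OF g'(1) f'(1), of x] by (simp add: o_def blinfun_compose.rep_eq)
  ultimately show ?thesis unfolding C1_map_def by (intro exI[of _ "\<lambda>x. f' (g x) o\<^sub>L g' x"]) auto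
qed

lemma C1_map_iter: assumes "diffeomorphism f" shows "C1_map (iter f k)"
proof -
  have p: "C1_map (h ^^ n)" if "C1_map h" for h :: "real^'a \<Rightarrow> real^'a" and n
    by (induction n) (use that in \<open>simp_all only: funpow.simps C1_map_id C1_map_comp\<close>)
  show ?thesis using assms by (auto simp: iter_def diffeomorphism_def intro: p)
qed

lemma diffeomorphism_inv: "diffeomorphism f \<Longrightarrow> diffeomorphism (inv f)"
  by (simp add: diffeomorphism_def bij_imp_bij_inv inv_inv_eq)

abbreviation fder :: "(real^'n \<Rightarrow> real^'n) \<Rightarrow> real^'n \<Rightarrow> real^'n \<Rightarrow> real^'n" where
  "fder f p \<equiv> frechet_derivative f (at p)"

lemma C1_mapE:
  assumes "C1_map f"
  obtains f' where "\<And>x. fder f x = blinfun_apply (f' x)" "continuous_on UNIV f'"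
    "\<And>x. (f has_derivative blinfun_apply (f' x)) (at x)"
  using assms unfolding C1_map_def by (metis frechet_derivative_at)

lemma C1_map_has_derivative: "C1_map f \<Longrightarrow> (f has_derivative fder f p) (at p)"
  by (metis C1_mapE)

lemma C1_map_linear: "C1_map f \<Longrightarrow> linear (fder f p)"
  by (meson C1_map_has_derivative has_derivative_linear)

lemma C1_map_continuous: "C1_map f \<Longrightarrow> continuous_on S f"
  by (meson C1_map_has_derivative continuous_at_imp_continuous_on has_derivative_continuous)

lemma C1_map_tendsto:
  assumes "C1_map f" "p \<longlonglongrightarrow> q" "v \<longlonglongrightarrow> w"
  shows "(\<lambda>n. fder f (p n) (v n)) \<longlonglongrightarrow> fder f q w"
proof -
  obtain f' where f': "\<And>x. fder f x = blinfun_apply (f' x)" "continuous_on UNIV f'"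
    using C1_mapE[OF assms(1)] by metis
  have "(\<lambda>n. f' (p n)) \<longlonglongrightarrow> f' q"
    using f'(2) assms(2) by (simp add: continuous_on_tendsto_compose)
  then show ?thesis using assms(3) f'(1) by (auto intro!: tendsto_intros)
qed

lemma C1_map_derivative_bound:
  assumes "C1_map f" "compact S"
  obtains B where "B \<ge> 1" "\<And>p v. p \<in> S \<Longrightarrow> norm (fder f p v) \<le> B * norm v"
proof -
  obtain f' where f': "\<And>x. fder f x = blinfun_apply (f' x)" "continuous_on UNIV f'"
    using C1_mapE[OF assms(1)] by metis
  have "compact (f' ` S)"
    by (intro compact_continuous_image continuous_on_subset[OF f'(2)] assms) auto
  then obtain B where B: "\<And>p. p \<in> S \<Longrightarrow> norm (f' p) \<le> B"
    by (meson bounded_iff compact_imp_bounded imageI)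
  have "norm (fder f p v) \<le> max 1 B * norm v" if "p \<in> S" for p v
  proof -
    have "norm (fder f p v) \<le> norm (f' p) * norm v" by (simp add: f'(1) norm_blinfun)
    also have "\<dots> \<le> max 1 B * norm v" using B[OF that] by (intro mult_right_mono) auto
    finally show ?thesis .
  qed
  then show ?thesis by (intro that[of "max 1 B"]) auto
qed

lemma fder_comp:
  assumes "C1_map f" "C1_map g"
  shows "fder (f \<circ> g) p v = fder f (g p) (fder g p v)"
proof -
  have "(f \<circ> g has_derivative fder f (g p) \<circ> fder g p) (at p)"
    using assms by (intro diff_chain_at C1_map_has_derivative)
  then show ?thesis by (metis comp_apply frechet_derivative_at)
qed

lemma fder_iter_add:
  assumes "diffeomorphism f"
  shows "fder (iter f (a + b)) p v = fder (iter f a) (iter f b p) (fder (iter f b) p v)"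
proof -
  have "iter f (a + b) = iter f a \<circ> iter f b"
    using assms by (auto simp: iter_add diffeomorphism_def)
  then show ?thesis by (simp add: fder_comp C1_map_iter[OF assms])
qed

lemma fder_id [simp]: "fder id p v = v"
  by (simp add: id_def)

lemma fder_iter_cancel:
  assumes "diffeomorphism f"
  shows "fder (iter f (- k)) (iter f k p) (fder (iter f k) p v) = v"
  using fder_iter_add[OF assms, of "-k" k p v] by simp

section \<open>Uniform estimates near compact sets\<close>

text \<open>Heine-Cantor on the compact sum of \<open>S\<close> and the closed unit ball. Only
  \<open>y\<close> has to lie in \<open>S\<close>; cutting \<open>d\<close> to at most 1 keeps
  \<open>a\<close> in the sum.\<close>

lemma compact_uniform_nbhd:
  fixes h :: "'a::euclidean_space \<Rightarrow> 'b::metric_space"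
  assumes "continuous_on UNIV h" "compact S" "e > 0"
  obtains d where "d > 0" "\<And>a y. y \<in> S \<Longrightarrow> dist a y < d \<Longrightarrow> dist (h a) (h y) < e"
proof -
  have c: "compact {x + e | x e. x \<in> S \<and> e \<in> cball 0 1}" (is "compact ?S")
    using assms(2) compact_cball by (rule compact_sums)
  have "uniformly_continuous_on ?S h"
    using assms(1) c by (meson compact_uniformly_continuous continuous_on_subset subset_UNIV)
  then obtain d where d: "d > 0" "\<forall>y\<in>?S. \<forall>a\<in>?S. dist a y < d \<longrightarrow> dist (h a) (h y) < e"
    using assms(3) unfolding uniformly_continuous_on_def by blast
  have "dist (h a) (h y) < e" if "y \<in> S" "dist a y < min d 1" for a y
  proof (rule d(2)[rule_format])
    have "a = y + (a - y)" "a - y \<in> cball 0 1" using that(2) by (auto simp: dist_norm norm_minus_commute)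
    then show "a \<in> ?S" using that(1) by blast
    show "y \<in> ?S" using that(1) by (intro CollectI exI[of _ y] exI[of _ 0]) auto
    show "dist a y < d" using that by simp
  qed
  then show ?thesis using d(1) that[of "min d 1"] by simp
qed

text \<open>Mean value inequality for \<open>F\<close> minus its linear part at \<open>y\<close>,
  whose derivative has norm at most \<open>\<eta>\<close> on a ball around \<open>y\<close>. The
  estimate compares two nearby points \<open>a\<close> and \<open>b\<close>, as a contraction
  argument requires.\<close>

lemma C1_map_uniform_linearization:
  assumes "C1_map F" "compact S" "\<eta> > 0"
  obtains \<rho> where "\<rho> > 0"
    "\<And>y a b. y \<in> S \<Longrightarrow> dist a y < \<rho> \<Longrightarrow> dist b y < \<rho> \<Longrightarrow>
       norm (F a - F b - fder F y (a - b)) \<le> \<eta> * norm (a - b)"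
proof -
  obtain f' where f': "\<And>x. fder F x = blinfun_apply (f' x)" "continuous_on UNIV f'"
    "\<And>x. (F has_derivative blinfun_apply (f' x)) (at x)"
    using C1_mapE[OF assms(1)] by metis
  obtain \<rho> where \<rho>: "\<rho> > 0" "\<And>a y. y \<in> S \<Longrightarrow> dist a y < \<rho> \<Longrightarrow> dist (f' a) (f' y) < \<eta>"
    using compact_uniform_nbhd[OF f'(2) assms(2,3)] by blast
  have "norm (F a - F b - fder F y (a - b)) \<le> \<eta> * norm (a - b)"
    if y: "y \<in> S" and a: "dist a y < \<rho>" and b: "dist b y < \<rho>" for y a b
  proof -
    let ?g = "\<lambda>x. F x - f' y x"
    have "norm (?g a - ?g b) \<le> \<eta> * norm (a - b)"
    proof (rule differentiable_bound[of "ball y \<rho>" ?g "\<lambda>x v. f' x v - f' y v"])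
      fix x assume x: "x \<in> ball y \<rho>"
      show "(?g has_derivative (\<lambda>v. f' x v - f' y v)) (at x within ball y \<rho>)"
        by (intro has_derivative_diff has_derivative_at_withinI[OF f'(3)] bounded_linear_imp_has_derivative
             blinfun.bounded_linear_right)
      have "norm (f' x v - f' y v) \<le> \<eta> * norm v" for v
      proof -
        have "norm (f' x v - f' y v) \<le> norm (f' x - f' y) * norm v"
          by (metis blinfun.diff_left norm_blinfun)
        also have "\<dots> \<le> \<eta> * norm v"
          using \<rho>(2)[OF y, of x] x by (intro mult_right_mono) (auto simp: dist_norm norm_minus_commute)
        finally show ?thesis .
      qed
      then show "onorm (\<lambda>v. f' x v - f' y v) \<le> \<eta>" using assms(3) by (intro onorm_le)
    qed (use a b in \<open>auto simp: dist_commute\<close>)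
    then show ?thesis by (simp add: f'(1) blinfun.diff_right algebra_simps)
  qed
  then show ?thesis using \<rho>(1) that by blast
qed

section \<open>Hyperbolic splittings over compact invariant sets\<close>

lemma hyperbolic_splitting_subset:
  "hyperbolic_splitting f \<Lambda> Eu Es \<Longrightarrow> S \<subseteq> \<Lambda> \<Longrightarrow> hyperbolic_splitting f S Eu Es"
  unfolding hyperbolic_splitting_def subset_iff by (elim conjE exE, intro conjI exI) (assumption | simp)+

text \<open>Time reversal exchanges the two bundles, so a fact about unstable vectors follows from
  its stable counterpart for \<open>inv f\<close>.\<close>

lemma hyperbolic_splitting_inv:
  assumes f: "diffeomorphism f" and H: "hyperbolic_splitting f S Eu Es"
    and inv: "\<And>p k. p \<in> S \<Longrightarrow> iter f k p \<in> S"
  shows "hyperbolic_splitting (inv f) S Es Eu"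
proof -
  have b: "bij f" using f by (simp add: diffeomorphism_def)
  have invp: "inv f p \<in> S" "f (inv f p) = p" if "p \<in> S" for p
    using inv[OF that, of "-1"] b by (auto simp: iter_def surj_f_inv_f bij_is_surj)
  have img: "fder (inv f) p ` E p = E (inv f p)"
    if "p \<in> S" and E: "\<And>p. p \<in> S \<Longrightarrow> fder f p ` E p = E (f p)" for p and E :: "real^'a \<Rightarrow> (real^'a) set"
  proof -
    have "fder (inv f) (f (inv f p)) (fder f (inv f p) v) = v" for v
      using fder_iter_cancel[OF f, of 1 "inv f p" v] by (simp add: iter_def)
    then have "fder (inv f) p ` fder f (inv f p) ` E (inv f p) = E (inv f p)"
      using invp(2)[OF \<open>p \<in> S\<close>] by (simp add: image_image)
    then show ?thesis using E[OF invp(1)[OF \<open>p \<in> S\<close>]] invp(2)[OF \<open>p \<in> S\<close>] by simp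
  qed
  have sum: "{u + s |u s. u \<in> A \<and> s \<in> B} = {u + s |u s. u \<in> B \<and> s \<in> A}" for A B :: "(real^'a) set"
    by (auto; metis add.commute)
  have 1: "\<forall>p\<in>S. subspace (Es p) \<and> subspace (Eu p) \<and>
        Es p \<inter> Eu p = {0} \<and> {u + s | u s. u \<in> Es p \<and> s \<in> Eu p} = UNIV \<and>
        fder (inv f) p ` Es p = Es (inv f p) \<and> fder (inv f) p ` Eu p = Eu (inv f p)"
  proof
    fix p assume p: "p \<in> S"
    have "\<forall>p\<in>S. fder f p ` Es p = Es (f p) \<and> fder f p ` Eu p = Eu (f p)"
      using H by (simp add: hyperbolic_splitting_def)
    then have "fder (inv f) p ` Es p = Es (inv f p)" "fder (inv f) p ` Eu p = Eu (inv f p)"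
      using p by (intro img; blast)+
    then show "subspace (Es p) \<and> subspace (Eu p) \<and>
        Es p \<inter> Eu p = {0} \<and> {u + s | u s. u \<in> Es p \<and> s \<in> Eu p} = UNIV \<and>
        fder (inv f) p ` Es p = Es (inv f p) \<and> fder (inv f) p ` Eu p = Eu (inv f p)"
      using H p unfolding sum[of "Es p"] hyperbolic_splitting_def by (simp add: Int_commute)
  qed
  show ?thesis
    unfolding hyperbolic_splitting_def iter_inv[OF b] minus_minus
    by (intro conjI 1) (use H in \<open>unfold hyperbolic_splitting_def, meson\<close>)
qed

lemma hyperbolic_splitting_sum:
  assumes "hyperbolic_splitting f S Eu Es" "p \<in> S"
  obtains u s where "v = u + s" "u \<in> Eu p" "s \<in> Es p"
proof -
  have "v \<in> {u + s |u s. u \<in> Eu p \<and> s \<in> Es p}"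
    using assms by (simp add: hyperbolic_splitting_def)
  then show ?thesis using that by blast
qed

lemma hyperbolic_splitting_rates:
  assumes "diffeomorphism f" "hyperbolic_splitting f S Eu Es"
  obtains c \<mu> where "c > 0" "0 < \<mu>" "\<mu> < 1"
    "\<forall>p\<in>S. \<forall>j\<ge>1. \<forall>v\<in>Eu p. norm (fder (iter f (- int j)) p v) \<le> c * \<mu> ^ j * norm v"
    "\<forall>p\<in>S. \<forall>j\<ge>1. \<forall>v\<in>Es p. norm (fder (iter f (int j)) p v) \<le> c * \<mu> ^ j * norm v"
proof -
  obtain c \<mu> where c: "c > 0" "0 < \<mu>" "\<mu> < 1"
    and r: "\<forall>p\<in>S. \<forall>j\<ge>(1::nat).
           (\<forall>v\<in>Eu p - {0}. norm (fder (iter f (- int j)) p v) < c * \<mu> ^ j * norm v) \<and>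
           (\<forall>v\<in>Es p - {0}. norm (fder (iter f (int j)) p v) < c * \<mu> ^ j * norm v)"
    using assms(2)[unfolded hyperbolic_splitting_def, THEN conjunct2] by (elim exE conjE)
  have z: "fder (iter f k) p 0 = 0" for k p
    by (intro linear_0 C1_map_linear C1_map_iter assms(1))
  show ?thesis
  proof (rule that[OF c]; intro ballI allI impI)
    fix p j v assume "p \<in> S" "j \<ge> (1::nat)" "v \<in> Eu p"
    then show "norm (fder (iter f (- int j)) p v) \<le> c * \<mu> ^ j * norm v"
      using r z by (cases "v = 0") (auto intro: less_imp_le)
  next
    fix p j v assume "p \<in> S" "j \<ge> (1::nat)" "v \<in> Es p"
    then show "norm (fder (iter f (int j)) p v) \<le> c * \<mu> ^ j * norm v"
      using r z by (cases "v = 0") (auto intro: less_imp_le)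
  qed
qed

lemma invariant_bundle_iter:
  assumes f: "diffeomorphism f" and E: "\<And>p. p \<in> S \<Longrightarrow> fder f p ` E p = E (f p)"
    and inv: "\<And>p k. p \<in> S \<Longrightarrow> iter f k p \<in> S" and p: "p \<in> S"
  shows "fder (iter f k) p ` E p = E (iter f k p)"
proof -
  have b: "bij f" using f by (simp add: diffeomorphism_def)
  have *: "fder (iter f (int j)) p ` E p = E (iter f (int j) p)" if p: "p \<in> S" for j p
  proof (induction j)
    case (Suc j)
    have "fder (iter f (1 + int j)) p v = fder f (iter f (int j) p) (fder (iter f (int j)) p v)" for v
      using fder_iter_add[OF f, of 1 "int j" p v] by simp
    then have "fder (iter f (1 + int j)) p ` E p = fder f (iter f (int j) p) ` fder (iter f (int j)) p ` E p"
      by (simp add: image_image)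
    moreover have "iter f (1 + int j) p = f (iter f (int j) p)"
      using iter_add[OF b, of 1 "int j" p] by simp
    ultimately show ?case using Suc E[OF inv[OF p, of "int j"]] by simp
  qed simp
  show ?thesis
  proof (cases "k \<ge> 0")
    case True
    then show ?thesis using *[OF p, of "nat k"] by simp
  next
    case False
    \<comment> \<open>A negative iterate undoes the positive iterate that starts at
      \<open>q\<close>.\<close>
    define q where "q = iter f k p"
    have q: "q \<in> S" "iter f (- k) q = p" using inv[OF p] b by (auto simp: q_def)
    have "fder (iter f k) p ` E p = fder (iter f k) p ` fder (iter f (- k)) q ` E q"
      using *[OF q(1), of "nat (- k)"] False q(2) by simp
    also have "\<dots> = E q"
      using fder_iter_cancel[OF f, of "- k" q] q(2) by (simp add: image_image)
    finally show ?thesis by (simp add: q_def)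
  qed
qed

lemma hyperbolic_splitting_iter:
  assumes f: "diffeomorphism f" and H: "hyperbolic_splitting f S Eu Es"
    and inv: "\<And>p k. p \<in> S \<Longrightarrow> iter f k p \<in> S" and p: "p \<in> S"
  shows "v \<in> Eu p \<Longrightarrow> fder (iter f k) p v \<in> Eu (iter f k p)"
    and "v \<in> Es p \<Longrightarrow> fder (iter f k) p v \<in> Es (iter f k p)"
proof -
  have img: "fder f p ` Eu p = Eu (f p)" "fder f p ` Es p = Es (f p)" if "p \<in> S" for p
    using H that by (simp_all add: hyperbolic_splitting_def)
  show "v \<in> Eu p \<Longrightarrow> fder (iter f k) p v \<in> Eu (iter f k p)"
    using invariant_bundle_iter[of f S Eu, OF f img(1) inv p, of k] by blast
  show "v \<in> Es p \<Longrightarrow> fder (iter f k) p v \<in> Es (iter f k p)"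
    using invariant_bundle_iter[of f S Es, OF f img(2) inv p, of k] by blast
qed

text \<open>The unstable component \<open>u\<close> of \<open>v\<close> also has a bounded forward
  orbit; pulling its \<open>j\<close>-th image back contracts by \<open>c * \<mu> ^ j\<close>, so
  \<open>u = 0\<close>. This describes stable vectors by a bound, a condition that survives
  limits.\<close>

lemma bounded_orbit_stable:
  assumes f: "diffeomorphism f" and H: "hyperbolic_splitting f S Eu Es"
    and inv: "\<And>p k. p \<in> S \<Longrightarrow> iter f k p \<in> S" and p: "p \<in> S"
    and B: "\<And>j. norm (fder (iter f (int j)) p v) \<le> B"
  shows "v \<in> Es p"
proof -
  obtain c \<mu> where c: "c > 0" "0 < \<mu>" "\<mu> < 1"
    and ru: "\<forall>p\<in>S. \<forall>j\<ge>1. \<forall>v\<in>Eu p. norm (fder (iter f (- int j)) p v) \<le> c * \<mu> ^ j * norm v"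
    and rs: "\<forall>p\<in>S. \<forall>j\<ge>1. \<forall>v\<in>Es p. norm (fder (iter f (int j)) p v) \<le> c * \<mu> ^ j * norm v"
    by (rule hyperbolic_splitting_rates[OF f H])
  obtain u s where us: "v = u + s" "u \<in> Eu p" "s \<in> Es p"
    using hyperbolic_splitting_sum[OF H p] by blast
  have *: "norm u \<le> c * (B + c * norm s) * \<mu> ^ j" if j: "j \<ge> 1" for j
  proof -
    let ?w = "fder (iter f (int j)) p"
    have lin: "linear ?w" by (intro C1_map_linear C1_map_iter f)
    have "?w u = ?w v - ?w s" using us(1) lin by (simp add: linear_add)
    then have "norm (?w u) \<le> norm (?w v) + norm (?w s)" by (simp add: norm_triangle_ineq4)
    also have "\<dots> \<le> B + c * norm s"
    proof -
      have "c * \<mu> ^ j * norm s \<le> c * 1 * norm s"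
        using c by (intro mult_right_mono mult_left_mono power_le_one) auto
      then show ?thesis using B[of j] rs[rule_format, OF p j us(3)] by simp
    qed
    finally have w: "norm (?w u) \<le> B + c * norm s" .
    have "norm u = norm (fder (iter f (- int j)) (iter f (int j) p) (?w u))"
      by (simp add: fder_iter_cancel[OF f])
    also have "\<dots> \<le> c * \<mu> ^ j * norm (?w u)"
      using inv[OF p] j hyperbolic_splitting_iter(1)[OF f H inv p us(2)] by (intro ru[rule_format]) auto
    also have "\<dots> \<le> c * \<mu> ^ j * (B + c * norm s)"
      using c w by (intro mult_left_mono) auto
    finally show ?thesis by (simp add: mult_ac)
  qed
  have "(\<lambda>j. c * (B + c * norm s) * \<mu> ^ j) \<longlonglongrightarrow> c * (B + c * norm s) * 0"
    using c by (intro tendsto_intros LIMSEQ_realpow_zero) auto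
  then have "norm u \<le> 0"
    using * by (intro LIMSEQ_le_const[of _ 0 "norm u"]) auto
  then show ?thesis using us by simp
qed

text \<open>Recovers the continuity that the definition of a splitting does not ask for. Stable
  vectors have forward orbits bounded uniformly in \<open>j\<close>, the bound passes to the limit,
  and a bounded forward orbit forces stability.\<close>

lemma stable_bundle_closed:
  assumes f: "diffeomorphism f" and H: "hyperbolic_splitting f S Eu Es"
    and inv: "\<And>p k. p \<in> S \<Longrightarrow> iter f k p \<in> S"
    and p: "\<And>n. p n \<in> S" "p \<longlonglongrightarrow> q" "q \<in> S" and v: "\<And>n. v n \<in> Es (p n)" "v \<longlonglongrightarrow> w"
  shows "w \<in> Es q"
proof -
  obtain c \<mu> where c: "c > 0" "0 < \<mu>" "\<mu> < 1"
    and ru: "\<forall>p\<in>S. \<forall>j\<ge>1. \<forall>v\<in>Eu p. norm (fder (iter f (- int j)) p v) \<le> c * \<mu> ^ j * norm v"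
    and rs: "\<forall>p\<in>S. \<forall>j\<ge>1. \<forall>v\<in>Es p. norm (fder (iter f (int j)) p v) \<le> c * \<mu> ^ j * norm v"
    by (rule hyperbolic_splitting_rates[OF f H])
  \<comment> \<open>\<open>c + 1\<close> also covers \<open>j = 0\<close>, where \<open>c\<close>
    alone may be too small.\<close>
  have b: "norm (fder (iter f (int j)) (p n) (v n)) \<le> (c + 1) * norm (v n)" for j n
  proof (cases "j = 0")
    case False
    have "c * \<mu> ^ j \<le> c" using c power_le_one[of \<mu> j] mult_left_le[of "\<mu> ^ j" c] by simp
    then have "c * \<mu> ^ j * norm (v n) \<le> (c + 1) * norm (v n)" by (intro mult_right_mono) auto
    moreover have "norm (fder (iter f (int j)) (p n) (v n)) \<le> c * \<mu> ^ j * norm (v n)"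
      using False by (intro rs[rule_format] p v) simp
    ultimately show ?thesis by linarith
  qed (use c in \<open>simp add: algebra_simps\<close>)
  have lim: "norm (fder (iter f (int j)) q w) \<le> (c + 1) * norm w" for j
  proof (rule LIMSEQ_le)
    show "(\<lambda>n. norm (fder (iter f (int j)) (p n) (v n))) \<longlonglongrightarrow> norm (fder (iter f (int j)) q w)"
      by (intro tendsto_norm C1_map_tendsto C1_map_iter f p v)
    show "(\<lambda>n. (c + 1) * norm (v n)) \<longlonglongrightarrow> (c + 1) * norm w"
      by (intro tendsto_intros v)
  qed (use b in auto)
  show ?thesis by (rule bounded_orbit_stable[OF f H inv p(3) lim])
qed

lemma unstable_bundle_closed:
  assumes f: "diffeomorphism f" and H: "hyperbolic_splitting f S Eu Es"
    and inv: "\<And>p k. p \<in> S \<Longrightarrow> iter f k p \<in> S"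
    and p: "\<And>n. p n \<in> S" "p \<longlonglongrightarrow> q" "q \<in> S" and v: "\<And>n. v n \<in> Eu (p n)" "v \<longlonglongrightarrow> w"
  shows "w \<in> Eu q"
  using stable_bundle_closed[OF diffeomorphism_inv[OF f] hyperbolic_splitting_inv[OF f H inv] _ p v]
    inv f by (auto simp: iter_inv diffeomorphism_def)

text \<open>\<open>P p\<close> is the projection onto \<open>Eu p\<close> along \<open>Es p\<close>.
  The bound and the uniform continuity are both proved by contradiction: counterexamples accumulate,
  closedness of the bundles puts the limits into the right fibres, and uniqueness of the splitting
  fails.\<close>

lemma hyperbolic_projections:
  assumes f: "diffeomorphism f" and H: "hyperbolic_splitting f S Eu Es"
    and inv: "\<And>p k. p \<in> S \<Longrightarrow> iter f k p \<in> S" and S: "compact S"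
  obtains P C where "\<forall>p\<in>S. linear (P p) \<and> (\<forall>v. P p v \<in> Eu p \<and> v - P p v \<in> Es p \<and> norm (P p v) \<le> C * norm v) \<and>
      (\<forall>v\<in>Eu p. P p v = v) \<and> (\<forall>v\<in>Es p. P p v = 0)"
    "C \<ge> 1"
    "\<forall>\<eta>>0. \<exists>\<delta>>0. \<forall>p\<in>S. \<forall>p'\<in>S. dist p p' < \<delta> \<longrightarrow> (\<forall>v. norm (P p v - P p' v) \<le> \<eta> * norm v)"
proof -
  have sub: "subspace (Eu p)" "subspace (Es p)" "Eu p \<inter> Es p = {0}" if "p \<in> S" for p
    using H that unfolding hyperbolic_splitting_def by blast+
  have "\<exists>u. u \<in> Eu p \<and> v - u \<in> Es p" if "p \<in> S" for p v
    using hyperbolic_splitting_sum[OF H that, of v] by (metis add_diff_cancel_left')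
  then obtain P where P: "\<And>p v. p \<in> S \<Longrightarrow> P p v \<in> Eu p" "\<And>p v. p \<in> S \<Longrightarrow> v - P p v \<in> Es p"
    by metis
  have uniq: "u = P p v" if "p \<in> S" "u \<in> Eu p" "v - u \<in> Es p" for p u v
  proof -
    have "u - P p v \<in> Eu p" using that P sub by (auto intro: subspace_diff)
    moreover have "(v - P p v) - (v - u) \<in> Es p" by (rule subspace_diff) (use that P sub in blast)+
    then have "u - P p v \<in> Es p" by simp
    ultimately have "u - P p v \<in> Eu p \<inter> Es p" by simp
    then show ?thesis using sub(3)[OF that(1)] by simp
  qed
  have lin: "linear (P p)" if p: "p \<in> S" for p
  proof (rule linearI)
    fix x y :: "real^'a" and r :: real
    have "(x - P p x) + (y - P p y) \<in> Es p" using p P sub by (intro subspace_add) auto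
    moreover have "(x - P p x) + (y - P p y) = x + y - (P p x + P p y)" by simp
    ultimately have "x + y - (P p x + P p y) \<in> Es p" by metis
    then show "P p (x + y) = P p x + P p y"
      using p P sub by (intro uniq[symmetric]) (auto intro: subspace_add)
    have "r *\<^sub>R (x - P p x) \<in> Es p" using p P sub by (intro subspace_scale) auto
    then show "P p (r *\<^sub>R x) = r *\<^sub>R P p x"
      using p P sub by (intro uniq[symmetric]) (auto intro: subspace_scale simp: scaleR_diff_right)
  qed
  have id: "P p v = v" if "p \<in> S" "v \<in> Eu p" for p v
    using uniq[OF that(1), of v v] that sub(2)[OF that(1)] by (simp add: subspace_0)
  have zero: "P p v = 0" if "p \<in> S" "v \<in> Es p" for p v
    using uniq[OF that(1), of 0 v] that sub(1)[OF that(1)] by (simp add: subspace_0)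
  have "\<exists>C. \<forall>p\<in>S. \<forall>v. norm (P p v) \<le> C * norm v"
  proof (rule ccontr)
    assume "\<not> ?thesis"
    then have "\<forall>n::nat. \<exists>p v. p \<in> S \<and> norm (P p v) > real (Suc n) * norm v" by (meson not_le)
    then obtain p v where pv: "\<And>n::nat. p n \<in> S" "\<And>n. norm (P (p n) (v n)) > real (Suc n) * norm (v n)"
      by metis
    \<comment> \<open>Normalized so that the unstable part has norm 1 while \<open>u + s\<close>
      tends to 0. Then \<open>s\<close> converges along with \<open>u\<close>, and the limit is a
      unit vector in both bundles.\<close>
    define u where "u n = P (p n) (v n) /\<^sub>R norm (P (p n) (v n))" for n
    define s where "s n = (v n - P (p n) (v n)) /\<^sub>R norm (P (p n) (v n))" for n
    have pos: "norm (P (p n) (v n)) > 0" for n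
      using pv(2)[of n] by (meson le_less_trans mult_nonneg_nonneg norm_ge_zero of_nat_0_le_iff)
    have u: "u n \<in> Eu (p n)" "norm (u n) = 1" for n
      using pos[of n] sub[OF pv(1)] P(1)[OF pv(1)] by (auto simp: u_def intro: subspace_scale)
    have s: "s n \<in> Es (p n)" for n
      using sub[OF pv(1)] P(2)[OF pv(1)] by (auto simp: s_def intro: subspace_scale)
    have us: "norm (u n + s n) \<le> inverse (real (Suc n))" for n
    proof -
      have "u n + s n = v n /\<^sub>R norm (P (p n) (v n))"
        by (simp add: u_def s_def flip: scaleR_add_right)
      then have "norm (u n + s n) = norm (v n) / norm (P (p n) (v n))" by (simp add: divide_inverse)
      also have "\<dots> \<le> inverse (real (Suc n))"
        using pv(2)[of n] pos[of n] by (simp add: field_simps)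
      finally show ?thesis .
    qed
    have "compact (S \<times> sphere (0::real^'a) 1)" using S by (intro compact_Times) auto
    then have sc: "seq_compact (S \<times> sphere (0::real^'a) 1)" by (rule compact_imp_seq_compact)
    have "\<forall>n. (p n, u n) \<in> S \<times> sphere 0 1" using pv(1) u(2) by simp
    from seq_compactE[OF sc this] obtain l r where l: "l \<in> S \<times> sphere 0 1" "strict_mono (r::nat\<Rightarrow>nat)"
      "((\<lambda>n. (p n, u n)) \<circ> r) \<longlonglongrightarrow> l" .
    have lp: "(\<lambda>n. p (r n)) \<longlonglongrightarrow> fst l" "(\<lambda>n. u (r n)) \<longlonglongrightarrow> snd l"
      using tendsto_fst[OF l(3)] tendsto_snd[OF l(3)] by (auto simp: o_def)
    have "(\<lambda>n. u n + s n) \<longlonglongrightarrow> 0"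
      using us by (intro Lim_null_comparison[OF _ LIMSEQ_inverse_real_of_nat] always_eventually allI)
    then have "(\<lambda>n. u (r n) + s (r n)) \<longlonglongrightarrow> 0"
      by (rule LIMSEQ_subseq_LIMSEQ[OF _ l(2), unfolded o_def])
    from tendsto_diff[OF this lp(2)] have ls: "(\<lambda>n. s (r n)) \<longlonglongrightarrow> - snd l" by simp
    have "snd l \<in> Eu (fst l)"
      using unstable_bundle_closed[OF f H inv, of "\<lambda>n. p (r n)" "fst l" "\<lambda>n. u (r n)" "snd l"]
        pv(1) lp l(1) u(1) by auto
    moreover have "- snd l \<in> Es (fst l)"
      using stable_bundle_closed[OF f H inv, of "\<lambda>n. p (r n)" "fst l" "\<lambda>n. s (r n)" "- snd l"]
        pv(1) lp l(1) s ls by auto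
    then have "snd l \<in> Es (fst l)"
      using sub(2)[of "fst l"] l(1) subspace_neg by fastforce
    ultimately have "snd l = 0" using sub(3)[of "fst l"] l(1) by auto
    then show False using l(1) by auto
  qed
  then obtain C0 where C0: "\<And>p v. p \<in> S \<Longrightarrow> norm (P p v) \<le> C0 * norm v" by blast
  define C where "C = max 1 C0"
  have C: "norm (P p v) \<le> C * norm v" if "p \<in> S" for p v
  proof -
    have "C0 * norm v \<le> C * norm v" by (intro mult_right_mono) (auto simp: C_def)
    then show ?thesis using C0[OF that, of v] by simp
  qed
  have "\<exists>\<delta>>0. \<forall>p\<in>S. \<forall>p'\<in>S. dist p p' < \<delta> \<longrightarrow> (\<forall>v. norm (P p v - P p' v) \<le> \<eta> * norm v)"
    if \<eta>: "\<eta> > 0" for \<eta>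
  proof (rule ccontr)
    assume "\<not> ?thesis"
    then have "\<exists>p p' v. p \<in> S \<and> p' \<in> S \<and> dist p p' < d \<and> norm (P p v - P p' v) > \<eta> * norm v" if "d > 0" for d
      using that by (meson not_le)
    then have "\<exists>p p' v. p \<in> S \<and> p' \<in> S \<and> dist p p' < inverse (real (Suc n)) \<and> norm (P p v - P p' v) > \<eta> * norm v" for n
      by simp
    then obtain p p' v0 where p: "\<And>n. p n \<in> S" "\<And>n. p' n \<in> S" "\<And>n. dist (p n) (p' n) < inverse (real (Suc n))"
      and v0: "\<And>n. norm (P (p n) (v0 n) - P (p' n) (v0 n)) > \<eta> * norm (v0 n)"
      by metis
    define v where "v n = v0 n /\<^sub>R norm (v0 n)" for n
    have nz: "v0 n \<noteq> 0" for n
      using v0[of n] linear_0[OF lin[OF p(1)[of n]]] linear_0[OF lin[OF p(2)[of n]]] by auto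
    then have v1: "norm (v n) = 1" for n by (simp add: v_def)
    have v: "norm (P (p n) (v n) - P (p' n) (v n)) \<ge> \<eta>" for n
    proof -
      have "P (p n) (v n) - P (p' n) (v n) = (P (p n) (v0 n) - P (p' n) (v0 n)) /\<^sub>R norm (v0 n)"
        using lin[OF p(1)] lin[OF p(2)] by (simp add: v_def linear_scale scaleR_diff_right)
      then have "norm (P (p n) (v n) - P (p' n) (v n)) = norm (P (p n) (v0 n) - P (p' n) (v0 n)) / norm (v0 n)"
        by (simp add: divide_inverse)
      then show ?thesis using v0[of n] nz[of n] by (simp add: pos_le_divide_eq less_imp_le)
    qed
    \<comment> \<open>The bound \<open>C\<close> keeps both projected vectors in a ball, so they
      have limits too; at the common base point \<open>q\<close> each limit must be
      \<open>P q w\<close>.\<close>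
    have "compact (S \<times> sphere (0::real^'a) 1 \<times> cball (0::real^'a) C \<times> cball (0::real^'a) C)" (is "compact ?X")
      using S by (intro compact_Times) auto
    then have sc: "seq_compact ?X" by (rule compact_imp_seq_compact)
    have "norm (P (p n) (v n)) \<le> C" "norm (P (p' n) (v n)) \<le> C" for n
      using C[OF p(1)[of n], of "v n"] C[OF p(2)[of n], of "v n"] v1[of n] by simp_all
    then have "\<forall>n. (p n, v n, P (p n) (v n), P (p' n) (v n)) \<in> ?X"
      using p v1 by simp
    from seq_compactE[OF sc this] obtain l0 r where l0: "l0 \<in> ?X" and r: "strict_mono (r::nat\<Rightarrow>nat)"
      and l0': "((\<lambda>n. (p n, v n, P (p n) (v n), P (p' n) (v n))) \<circ> r) \<longlonglongrightarrow> l0" .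
    obtain q w a a' where l: "((\<lambda>n. (p n, v n, P (p n) (v n), P (p' n) (v n))) \<circ> r) \<longlonglongrightarrow> (q, w, a, a')"
      and q: "q \<in> S" "norm w = 1"
      using l0 l0' by (cases l0) auto
    have l1: "(\<lambda>n. p (r n)) \<longlonglongrightarrow> q" and l2: "(\<lambda>n. v (r n)) \<longlonglongrightarrow> w"
      and l3: "(\<lambda>n. P (p (r n)) (v (r n))) \<longlonglongrightarrow> a" and l4: "(\<lambda>n. P (p' (r n)) (v (r n))) \<longlonglongrightarrow> a'"
      using tendsto_fst[OF l] tendsto_fst[OF tendsto_snd[OF l]]
        tendsto_fst[OF tendsto_snd[OF tendsto_snd[OF l]]] tendsto_snd[OF tendsto_snd[OF tendsto_snd[OF l]]]
      by (auto simp: o_def)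
    have "(\<lambda>n. p n - p' n) \<longlonglongrightarrow> 0"
      using p(3) by (intro Lim_null_comparison[OF _ LIMSEQ_inverse_real_of_nat] always_eventually allI)
        (simp add: less_imp_le flip: dist_norm)
    then have "(\<lambda>n. p (r n) - p' (r n)) \<longlonglongrightarrow> 0"
      by (rule LIMSEQ_subseq_LIMSEQ[OF _ r, unfolded o_def])
    from tendsto_diff[OF l1 this] have l1': "(\<lambda>n. p' (r n)) \<longlonglongrightarrow> q" by simp
    have "a \<in> Eu q" "w - a \<in> Es q"
      using unstable_bundle_closed[OF f H inv _ l1 q(1) _ l3]
        stable_bundle_closed[OF f H inv _ l1 q(1) _ tendsto_diff[OF l2 l3]] p(1) P by auto
    then have "a = P q w" using uniq[OF q(1)] by blast
    have "a' \<in> Eu q" "w - a' \<in> Es q"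
      using unstable_bundle_closed[OF f H inv _ l1' q(1) _ l4]
        stable_bundle_closed[OF f H inv _ l1' q(1) _ tendsto_diff[OF l2 l4]] p(2) P by auto
    then have "a' = P q w" using uniq[OF q(1)] by blast
    have "norm (a - a') \<ge> \<eta>"
      using v by (intro LIMSEQ_le_const[OF tendsto_norm[OF tendsto_diff[OF l3 l4]]]) auto
    then show False using \<open>a = P q w\<close> \<open>a' = P q w\<close> \<eta> by simp
  qed
  moreover have "C \<ge> 1" by (simp add: C_def)
  ultimately show ?thesis using that[of P C] lin P id zero C by blast
qed

section \<open>Shadowing\<close>

text \<open>
  The contraction sends z to the sequence with unstable part pulled back from the next point and
  stable part pushed forward from the previous one. A fixed point need not be an orbit a priori; the
  last assumption (transversality of stable and unstable directions) rules this out at each index separately.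
\<close>

lemma pseudo_orbit_fixed_point:
  fixes F G :: "'a::euclidean_space \<Rightarrow> 'a" and P :: "int \<Rightarrow> 'a \<Rightarrow> 'a" and x :: "int \<Rightarrow> 'a"
  assumes \<epsilon>: "\<epsilon> > 0" and lin: "\<And>k. linear (P k)" and idem: "\<And>k v. P k (P k v) = P k v"
    and Fc: "\<And>k a b. dist a (x k) \<le> \<epsilon> \<Longrightarrow> dist b (x k) \<le> \<epsilon> \<Longrightarrow>
      norm ((F a - F b) - P (k + 1) (F a - F b)) \<le> norm (a - b) / 4"
    and Gc: "\<And>k a b. dist a (x k) \<le> \<epsilon> \<Longrightarrow> dist b (x k) \<le> \<epsilon> \<Longrightarrow>
      norm (P (k - 1) (G a - G b)) \<le> norm (a - b) / 4"
    and ps: "\<And>k. norm (F (x (k - 1)) - P k (F (x (k - 1))) + P k (G (x (k + 1))) - x k) \<le> \<epsilon> / 2"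
    and tr: "\<And>k a b. dist a (x k) \<le> \<epsilon> \<Longrightarrow> dist b (x (k + 1)) \<le> \<epsilon> \<Longrightarrow> P k (G b) = P k a \<Longrightarrow>
      F a - P (k + 1) (F a) = b - P (k + 1) b \<Longrightarrow> b = F a"
  obtains z where "\<And>k. dist (z k) (x k) \<le> \<epsilon>" "\<And>k. z (k + 1) = F (z k)"
    "\<And>k0. \<forall>k\<ge>k0. F (x k) = x (k + 1) \<and> G (x (k + 1)) = x k \<Longrightarrow>
       (\<lambda>n. z (k0 + int n) - x (k0 + int n)) \<longlonglongrightarrow> 0"
proof -
  define T where "T z k = F (z (k - 1)) - P k (F (z (k - 1))) + P k (G (z (k + 1)))" for z k
  \<comment> \<open>A quarter from each neighbour: \<open>T\<close> contracts by 1/2 in the supremum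
    norm over \<open>k\<close>.\<close>
  have T: "norm (T z k - T w k) \<le> (norm (z (k - 1) - w (k - 1)) + norm (z (k + 1) - w (k + 1))) / 4"
    if "\<And>k. dist (z k) (x k) \<le> \<epsilon>" "\<And>k. dist (w k) (x k) \<le> \<epsilon>" for z w k
  proof -
    have "T z k - T w k = ((F (z (k - 1)) - F (w (k - 1))) - P k (F (z (k - 1)) - F (w (k - 1))))
        + P k (G (z (k + 1)) - G (w (k + 1)))"
      using lin by (simp add: T_def linear_diff)
    also have "norm \<dots> \<le> norm ((F (z (k - 1)) - F (w (k - 1))) - P k (F (z (k - 1)) - F (w (k - 1))))
        + norm (P k (G (z (k + 1)) - G (w (k + 1))))" by (rule norm_triangle_ineq)
    also have "\<dots> \<le> norm (z (k - 1) - w (k - 1)) / 4 + norm (z (k + 1) - w (k + 1)) / 4"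
      using Fc[of "z (k - 1)" "k - 1" "w (k - 1)"] Gc[of "z (k + 1)" "k + 1" "w (k + 1)"] that
      by (intro add_mono) simp_all
    finally show ?thesis by (simp add: add_divide_distrib)
  qed
  have Tx: "norm (T x k - x k) \<le> \<epsilon> / 2" for k using ps[of k] by (simp add: T_def)
  \<comment> \<open>Picard iteration from the pseudo-orbit. Contraction by 1/2 and an initial defect
    of at most \<open>\<epsilon> / 2\<close> keep the iterates where the estimate for
    \<open>T\<close> is valid. Limits are taken at each \<open>k\<close>, with a geometric rate
    independent of \<open>k\<close>.\<close>
  define W where "W n = (T ^^ n) x" for n
  have W_Suc: "W (Suc n) k = T (W n) k" for n k by (simp add: W_def)
  have Wx: "dist (W n k) (x k) \<le> \<epsilon>" for n k
  proof (induction n arbitrary: k)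
    case (Suc n)
    have "norm (T (W n) k - T x k) \<le> (norm (W n (k - 1) - x (k - 1)) + norm (W n (k + 1) - x (k + 1))) / 4"
      using Suc \<epsilon> by (intro T) auto
    then have "norm (T (W n) k - T x k) + norm (T x k - x k) \<le> \<epsilon>"
      using Tx[of k] Suc[of "k - 1"] Suc[of "k + 1"] unfolding dist_norm by simp
    moreover have "norm (T (W n) k - x k) \<le> norm (T (W n) k - T x k) + norm (T x k - x k)"
      using norm_triangle_ineq[of "T (W n) k - T x k" "T x k - x k"] by simp
    ultimately show ?case by (simp add: W_Suc dist_norm)
  qed (use \<epsilon> in \<open>simp add: W_def\<close>)
  have Wd: "norm (W (Suc n) k - W n k) \<le> \<epsilon> * (1 / 2) ^ n" for n k
  proof (induction n arbitrary: k)
    case 0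
    then show ?case using Tx[of k] \<epsilon> by (simp add: W_def)
  next
    case (Suc n)
    have "norm (T (W (Suc n)) k - T (W n) k) \<le>
        (norm (W (Suc n) (k - 1) - W n (k - 1)) + norm (W (Suc n) (k + 1) - W n (k + 1))) / 4"
      by (intro T Wx)
    also have "\<dots> \<le> (\<epsilon> * (1 / 2) ^ n + \<epsilon> * (1 / 2) ^ n) / 4"
      using Suc by (intro divide_right_mono add_mono) auto
    finally show ?case by (simp add: W_Suc)
  qed
  have "convergent (\<lambda>n. W n k)" for k
  proof -
    have "summable (\<lambda>n. W (Suc n) k - W n k)"
    proof (rule summable_comparison_test')
      show "summable (\<lambda>n. \<epsilon> * (1 / 2) ^ n)" by (intro summable_mult summable_geometric) simp
      show "norm (W (Suc n) k - W n k) \<le> \<epsilon> * (1 / 2) ^ n" if "n \<ge> 0" for n by (rule Wd)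
    qed
    then have "convergent (\<lambda>n. \<Sum>i<n. W (Suc i) k - W i k)" by (simp add: summable_iff_convergent)
    then obtain l where "(\<lambda>n. \<Sum>i<n. W (Suc i) k - W i k) \<longlonglongrightarrow> l" by (auto simp: convergent_def)
    then have "(\<lambda>n. W n k - W 0 k) \<longlonglongrightarrow> l" by (simp add: sum_lessThan_telescope[of "\<lambda>i. W i k"])
    then have "(\<lambda>n. W n k - W 0 k + W 0 k) \<longlonglongrightarrow> l + W 0 k" by (intro tendsto_intros)
    then show ?thesis by (auto simp: convergent_def)
  qed
  then have z: "(\<lambda>n. W n k) \<longlonglongrightarrow> lim (\<lambda>n. W n k)" for k
    by (simp only: convergent_LIMSEQ_iff)
  define z where "z k = lim (\<lambda>n. W n k)" for k
  note z = z[folded z_def]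
  have zx: "dist (z k) (x k) \<le> \<epsilon>" for k
    using Lim_dist_ubound[OF _ z[of k], of "x k" \<epsilon>] Wx by (simp add: dist_commute)
  have Tz: "T z k = z k" for k
  proof -
    have "(\<lambda>n. (norm (W n (k - 1) - z (k - 1)) + norm (W n (k + 1) - z (k + 1))) / 4) \<longlonglongrightarrow>
        (norm (z (k - 1) - z (k - 1)) + norm (z (k + 1) - z (k + 1))) / 4"
      by (intro tendsto_intros z) auto
    then have "(\<lambda>n. (norm (W n (k - 1) - z (k - 1)) + norm (W n (k + 1) - z (k + 1))) / 4) \<longlonglongrightarrow> 0" by simp
    then have "(\<lambda>n. W (Suc n) k - T z k) \<longlonglongrightarrow> 0"
      unfolding W_Suc
      by (rule Lim_null_comparison[OF always_eventually[OF allI[OF T[OF Wx zx]]]])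
    then have "(\<lambda>n. W (Suc n) k) \<longlonglongrightarrow> T z k" by (rule LIM_zero_cancel)
    then show ?thesis by (rule LIMSEQ_unique) (rule LIMSEQ_Suc[OF z])
  qed
  \<comment> \<open>The two components of the fixed point equation are the premises of
    \<open>tr\<close>, one at \<open>k\<close> and the other at \<open>k + 1\<close>.\<close>
  have Pz: "P k (z k) = P k (G (z (k + 1)))" for k
    using arg_cong[OF Tz[of k], of "P k"] lin[of k] by (simp add: T_def linear_add linear_diff idem)
  then have Qz: "z k - P k (z k) = F (z (k - 1)) - P k (F (z (k - 1)))" for k
    using Tz[of k] by (simp add: T_def algebra_simps)
  have orbit: "z (k + 1) = F (z k)" for k
    using tr[OF zx[of k] zx[of "k + 1"]] Pz[of k] Qz[of "k + 1"] by simp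
  have lim: "(\<lambda>n. z (k0 + int n) - x (k0 + int n)) \<longlonglongrightarrow> 0"
    if k0: "\<forall>k\<ge>k0. F (x k) = x (k + 1) \<and> G (x (k + 1)) = x k" for k0
  proof -
    \<comment> \<open>Where \<open>x\<close> is a true orbit it is fixed by \<open>T\<close>, so the
      error at \<open>k\<close> is at most half the larger error at its neighbours. Each step
      further from \<open>k0\<close> gains a factor 1/2.\<close>
    have e: "norm (z k - x k) \<le> \<epsilon> * (1 / 2) ^ n" if "k \<ge> k0 + int n" for n k
      using that
    proof (induction n arbitrary: k)
      case 0
      then show ?case using zx[of k] by (simp add: dist_norm)
    next
      case (Suc n)
      have "T x k = x k"
        using k0[rule_format, of "k - 1"] k0[rule_format, of k] Suc.prems by (simp add: T_def)
      then have "norm (z k - x k) = norm (T z k - T x k)" by (simp add: Tz)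
      also have "\<dots> \<le> (norm (z (k - 1) - x (k - 1)) + norm (z (k + 1) - x (k + 1))) / 4"
        using zx \<epsilon> by (intro T) auto
      also have "\<dots> \<le> (\<epsilon> * (1 / 2) ^ n + \<epsilon> * (1 / 2) ^ n) / 4"
        using Suc by (intro divide_right_mono add_mono) auto
      finally show ?case by simp
    qed
    show ?thesis
    proof (rule Lim_null_comparison[OF always_eventually])
      show "\<forall>n. norm (z (k0 + int n) - x (k0 + int n)) \<le> \<epsilon> * (1 / 2) ^ n" using e by simp
      show "(\<lambda>n. \<epsilon> * (1 / 2) ^ n) \<longlonglongrightarrow> 0"
        by (intro tendsto_mult_right_zero LIMSEQ_realpow_zero) auto
    qed
  qed
  show ?thesis by (rule that[OF zx orbit lim])
qed

section \<open>Compact invariant sets and forward limit sets\<close>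

lemma Inv_subset: "Inv f U \<subseteq> U"
  unfolding Inv_def using iter_0 by (auto, metis id_apply)

lemma Inv_mono: "A \<subseteq> U \<Longrightarrow> Inv f A \<subseteq> Inv f U"
  unfolding Inv_def by blast

lemma iter_continuous: "diffeomorphism f \<Longrightarrow> continuous_on S (iter f k)"
  by (intro C1_map_continuous C1_map_iter)

lemma compact_Inv:
  assumes "diffeomorphism f" "compact A" shows "compact (Inv f A)"
proof -
  have "Inv f A = A \<inter> (\<Inter>k. iter f k -` A)" using Inv_subset[of f A] by (auto simp: Inv_def)
  moreover have "closed (iter f k -` A)" for k
    using assms by (intro continuous_closed_vimage compact_imp_closed)
      (auto simp: continuous_on_eq_continuous_at[OF open_UNIV, symmetric] iter_continuous
       intro: continuous_on_interior[of UNIV])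
  ultimately show ?thesis using assms(2) by (auto intro!: compact_Int_closed closed_INT)
qed

text \<open>A limit point of the forward orbit has its full orbit in \<open>A\<close>: for every
  integer \<open>j\<close> the shifted times are eventually nonnegative. Points staying
  \<open>\<delta>\<close> away from \<open>Inv f A\<close> at arbitrarily late times would
  accumulate at such a point.\<close>

lemma forward_orbit_limit:
  assumes f: "diffeomorphism f" and A: "compact A" and q: "\<And>i. iter f (int i) q \<in> A" and "\<delta> > 0"
  shows "\<exists>N. \<forall>k\<ge>N. \<exists>y\<in>Inv f A. dist (iter f (int k) q) y < \<delta>"
proof (rule ccontr)
  have b: "bij f" using f by (simp add: diffeomorphism_def)
  assume "\<not> ?thesis"
  then have "\<forall>N. \<exists>k\<ge>N. \<forall>y\<in>Inv f A. \<delta> \<le> dist (iter f (int k) q) y" by (meson not_less)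
  then obtain k where k: "\<And>N. k N \<ge> N" "\<And>N y. y \<in> Inv f A \<Longrightarrow> \<delta> \<le> dist (iter f (int (k N)) q) y"
    by metis
  have "\<forall>N. iter f (int (k N)) q \<in> A" using q by blast
  from seq_compactE[OF compact_imp_seq_compact[OF A] this] obtain l r where
    l: "l \<in> A" and r: "strict_mono (r::nat\<Rightarrow>nat)" and lim: "((\<lambda>N. iter f (int (k N)) q) \<circ> r) \<longlonglongrightarrow> l" .
  have "iter f j l \<in> A" for j
  proof -
    have "continuous_on UNIV (iter f j)" by (rule iter_continuous[OF f])
    then have l1: "(\<lambda>n. iter f j (((\<lambda>N. iter f (int (k N)) q) \<circ> r) n)) \<longlonglongrightarrow> iter f j l"
      using lim by (rule continuous_on_tendsto_compose) simp_all
    have l2: "\<forall>\<^sub>F n in sequentially. iter f j (((\<lambda>N. iter f (int (k N)) q) \<circ> r) n) \<in> A"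
      using eventually_ge_at_top[of "nat (- j)"]
    proof eventually_elim
      case (elim n)
      have "k (r n) \<ge> n" using k(1)[of "r n"] seq_suble[OF r, of n] by simp
      then have "j + int (k (r n)) = int (nat (j + int (k (r n))))" using elim by linarith
      then have "iter f (j + int (k (r n))) q \<in> A" using q by metis
      then show ?case by (simp add: iter_add[OF b])
    qed
    show ?thesis
      by (rule Lim_in_closed_set[OF compact_imp_closed[OF A] l2 sequentially_bot l1])
  qed
  then have "l \<in> Inv f A" by (simp add: Inv_def)
  then have far: "\<delta> \<le> dist (((\<lambda>N. iter f (int (k N)) q) \<circ> r) n) l" for n using k(2) by simp
  have "\<forall>\<^sub>F n in sequentially. dist (((\<lambda>N. iter f (int (k N)) q) \<circ> r) n) l < \<delta>"
    using lim \<open>\<delta> > 0\<close> by (rule tendstoD)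
  then show False using far eventually_happens'[OF sequentially_bot] by (fastforce simp: not_le[symmetric])
qed

text \<open>Bridges the times between consecutive multiples of \<open>m\<close> when only every
  \<open>m\<close>-th iterate is shadowed.\<close>

lemma compact_uniform_nbhd_iterates:
  assumes "diffeomorphism f" "compact S" "e > 0"
  shows "\<exists>d>0. \<forall>i<m. \<forall>y\<in>S. \<forall>a. dist a y < d \<longrightarrow> dist (iter f (int i) a) (iter f (int i) y) < e"
proof (induction m)
  case (Suc m)
  then obtain d1 where d1: "d1 > 0" "\<forall>i<m. \<forall>y\<in>S. \<forall>a. dist a y < d1 \<longrightarrow> dist (iter f (int i) a) (iter f (int i) y) < e"
    by blast
  obtain d2 where d2: "d2 > 0" "\<And>a y. y \<in> S \<Longrightarrow> dist a y < d2 \<Longrightarrow> dist (iter f (int m) a) (iter f (int m) y) < e"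
    using compact_uniform_nbhd[OF iter_continuous[OF assms(1)] assms(2,3)] by blast
  show ?case using d1 d2 by (intro exI[of _ "min d1 d2"]) (auto simp: less_Suc_eq)
qed (auto intro: zero_less_one)

text \<open>\<open>m\<close> precedes \<open>r\<close> because a suitable radius depends on the
  spreading of orbits within \<open>m\<close> steps. The points \<open>y k\<close> carry the
  projections, as the pseudo-orbit is only near \<open>S\<close>. Jumps are measured forwards and
  backwards since the contraction uses both \<open>F\<close> and its inverse
  \<open>G\<close>.\<close>

lemma hyperbolic_shadowing:
  fixes f :: "real^'n \<Rightarrow> real^'n"
  assumes f: "diffeomorphism f" and H: "hyperbolic_splitting f S Eu Es"
    and inv: "\<And>p k. p \<in> S \<Longrightarrow> iter f k p \<in> S" and S: "compact S"
  shows "\<exists>m::nat\<ge>1. \<forall>r>0. \<exists>\<epsilon>>0. \<exists>\<delta>>0. \<epsilon> \<le> r \<and> \<delta> \<le> r \<and>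
    (\<forall>x y :: int \<Rightarrow> real^'n. (\<forall>k. y k \<in> S \<and> dist (x k) (y k) < \<delta> \<and>
        dist (iter f (int m) (x k)) (x (k + 1)) < \<delta> \<and> dist (iter f (- int m) (x (k + 1))) (x k) < \<delta>) \<longrightarrow>
      (\<exists>z. (\<forall>k. dist (z k) (x k) \<le> \<epsilon>) \<and> (\<forall>k. z (k + 1) = iter f (int m) (z k)) \<and>
        (\<forall>k0. (\<forall>k\<ge>k0. x (k + 1) = iter f (int m) (x k)) \<longrightarrow>
          (\<lambda>n. z (k0 + int n) - x (k0 + int n)) \<longlonglongrightarrow> 0)))"
proof -
  \<comment> \<open>Identities in plain letters, instantiated later by large terms: the error
    splittings of the forward, the backward and the transversality estimate.\<close>
  have alg1: "v - l = s + (p - l') + (v - d) - x" if "d - p = s" "x = l - l'" for v l s p l' d x :: "real^'n"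
    using that by (auto simp: algebra_simps)
  have alg2: "l = p - (p - l') + x" if "x = l - l'" for l p l' x :: "real^'n"
    using that by simp
  have alg3: "d = l + l' - r" if "d + r = l + l'" for d l l' r :: "real^'n"
    using that by (simp add: algebra_simps)
  have tri3: "norm (t - u + v) \<le> norm t + norm u + norm v" for t u v :: "real^'n"
    by (meson norm_triangle_ineq4 norm_triangle_ineq add_right_mono order_trans)
  have tri3': "norm (t + u - v) \<le> norm t + norm u + norm v" for t u v :: "real^'n"
    by (meson norm_triangle_ineq4 norm_triangle_ineq add_right_mono order_trans)
  have tri4: "norm (t + u + v - w) \<le> norm t + norm u + norm v + norm w" for t u v w :: "real^'n"
    by (meson norm_triangle_ineq4 norm_triangle_ineq add_right_mono order_trans)
  have b: "bij f" using f by (simp add: diffeomorphism_def)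
  obtain c \<mu> where c: "c > 0" "0 < \<mu>" "\<mu> < 1"
    and ru: "\<forall>p\<in>S. \<forall>j\<ge>1. \<forall>v\<in>Eu p. norm (fder (iter f (- int j)) p v) \<le> c * \<mu> ^ j * norm v"
    and rs: "\<forall>p\<in>S. \<forall>j\<ge>1. \<forall>v\<in>Es p. norm (fder (iter f (int j)) p v) \<le> c * \<mu> ^ j * norm v"
    by (rule hyperbolic_splitting_rates[OF f H])
  obtain P C where PC: "\<forall>p\<in>S. linear (P p) \<and> (\<forall>v. P p v \<in> Eu p \<and> v - P p v \<in> Es p \<and> norm (P p v) \<le> C * norm v) \<and>
      (\<forall>v\<in>Eu p. P p v = v) \<and> (\<forall>v\<in>Es p. P p v = 0)"
    and C1: "C \<ge> 1"
    and Pcont: "\<forall>\<eta>>0. \<exists>\<delta>>0. \<forall>p\<in>S. \<forall>p'\<in>S. dist p p' < \<delta> \<longrightarrow> (\<forall>v. norm (P p v - P p' v) \<le> \<eta> * norm v)"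
    by (rule hyperbolic_projections[OF f H inv S])
  have P: "\<And>p. p \<in> S \<Longrightarrow> linear (P p)"
    "\<And>p v. p \<in> S \<Longrightarrow> P p v \<in> Eu p" "\<And>p v. p \<in> S \<Longrightarrow> v - P p v \<in> Es p"
    "\<And>p v. p \<in> S \<Longrightarrow> v \<in> Eu p \<Longrightarrow> P p v = v" "\<And>p v. p \<in> S \<Longrightarrow> v \<in> Es p \<Longrightarrow> P p v = 0"
    and C: "C \<ge> 1" "\<And>p v. p \<in> S \<Longrightarrow> norm (P p v) \<le> C * norm v"
    using PC C1 by blast+
  \<comment> \<open>A high power absorbs \<open>c\<close>; \<open>C + 1\<close> bounds the
    projection to the stable space. The 1/8 obtained is half of the required rate 1/4, and the other
    half is left for the errors.\<close>
  have "(\<lambda>m. c * \<mu> ^ m * (C + 1)) \<longlonglongrightarrow> c * 0 * (C + 1)"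
    using c by (intro tendsto_intros LIMSEQ_realpow_zero) auto
  then have "\<forall>\<^sub>F m in sequentially. c * \<mu> ^ m * (C + 1) < 1 / 8"
    by (rule order_tendstoD(2)) simp
  then obtain m where m: "m \<ge> 1" "c * \<mu> ^ m * (C + 1) < 1 / 8"
    using eventually_happens'[OF sequentially_bot eventually_conj[OF _ eventually_ge_at_top[of 1]]] by blast
  define F where "F = iter f (int m)"
  define G where "G = iter f (- int m)"
  have FG: "C1_map F" "C1_map G" "\<And>a. F (G a) = a" "\<And>a. G (F a) = a"
    using b by (auto simp: F_def G_def intro: C1_map_iter f)
  have FS: "F p \<in> S" "G p \<in> S" if "p \<in> S" for p using inv that by (auto simp: F_def G_def)
  have DFE: "fder F p v \<in> Eu (F p)" "fder G p v \<in> Eu (G p)" if "p \<in> S" "v \<in> Eu p" for p v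
    using hyperbolic_splitting_iter(1)[OF f H inv that] by (auto simp: F_def G_def)
  have DFS: "fder F p v \<in> Es (F p)" "fder G p v \<in> Es (G p)" if "p \<in> S" "v \<in> Es p" for p v
    using hyperbolic_splitting_iter(2)[OF f H inv that] by (auto simp: F_def G_def)
  have lin: "linear (fder F p)" "linear (fder G p)" for p using FG by (auto intro: C1_map_linear)
  have GF: "fder G (F p) (fder F p v) = v" for p v
    using fder_iter_cancel[OF f, of "int m" p v] by (simp add: F_def G_def)
  obtain BF where BF: "BF \<ge> 1" "\<And>p v. p \<in> S \<Longrightarrow> norm (fder F p v) \<le> BF * norm v"
    using C1_map_derivative_bound[OF FG(1) S] by metis
  obtain BG where BG: "BG \<ge> 1" "\<And>p v. p \<in> S \<Longrightarrow> norm (fder G p v) \<le> BG * norm v"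
    using C1_map_derivative_bound[OF FG(2) S] by metis
  \<comment> \<open>\<open>B\<close> dominates the sums of constants in the estimates below.
    \<open>\<eta>\<close> carries its square because the transversality estimate loses a factor
    \<open>B\<close> twice, the second time by inverting \<open>fder F\<close>.\<close>
  define B where "B = C + BF + BG + 1"
  have B: "B \<ge> 4" using C BF BG by (simp add: B_def)
  define \<eta> where "\<eta> = 1 / (8 * B\<^sup>2)"
  have \<eta>: "\<eta> > 0" using B by (simp add: \<eta>_def)
  have \<eta>B: "\<eta> * B * B = 1 / 8" using B by (simp add: \<eta>_def power2_eq_square)
  have \<eta>B1: "\<eta> * B \<le> 1 / 8"
  proof -
    have "\<eta> * B * 1 \<le> \<eta> * B * B" using B \<eta> by (intro mult_left_mono) auto
    then show ?thesis using \<eta>B by simp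
  qed
  obtain \<rho>F where \<rho>F: "\<rho>F > 0" "\<And>y a b. y \<in> S \<Longrightarrow> dist a y < \<rho>F \<Longrightarrow> dist b y < \<rho>F \<Longrightarrow>
       norm (F a - F b - fder F y (a - b)) \<le> \<eta> * norm (a - b)"
    using C1_map_uniform_linearization[OF FG(1) S \<eta>] by metis
  obtain \<rho>G where \<rho>G: "\<rho>G > 0" "\<And>y a b. y \<in> S \<Longrightarrow> dist a y < \<rho>G \<Longrightarrow> dist b y < \<rho>G \<Longrightarrow>
       norm (G a - G b - fder G y (a - b)) \<le> \<eta> * norm (a - b)"
    using C1_map_uniform_linearization[OF FG(2) S \<eta>] by metis
  define \<rho> where "\<rho> = min \<rho>F \<rho>G"
  have \<rho>: "\<rho> > 0" using \<rho>F \<rho>G by (simp add: \<rho>_def)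
  obtain \<delta>P where \<delta>P: "\<delta>P > 0" "\<forall>p\<in>S. \<forall>p'\<in>S. dist p p' < \<delta>P \<longrightarrow> (\<forall>v. norm (P p v - P p' v) \<le> \<eta> * norm v)"
    using Pcont \<eta> by blast
  obtain dG where dG: "dG > 0" "\<And>a y. y \<in> S \<Longrightarrow> dist a y < dG \<Longrightarrow> dist (G a) (G y) < \<rho> / 2"
    using compact_uniform_nbhd[OF C1_map_continuous[OF FG(2)] S, of "\<rho> / 2"] \<rho> by auto
  show ?thesis
  proof (intro exI[of _ m] conjI m(1) allI impI)
    fix r :: real assume r: "r > 0"
    \<comment> \<open>Distances to \<open>y k\<close> are below \<open>2 * \<epsilon>\<close>, as
      \<open>\<delta> \<le> \<epsilon>\<close>. \<open>\<delta>2\<close> is the closeness of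
      \<open>F (y k)\<close> to \<open>y (k + 1)\<close> that makes their projections comparable,
      and likewise for \<open>G\<close>. In \<open>e\<close>, the third is for three triangle terms,
      and \<open>\<epsilon> / (4 * B)\<close> bounds the defect \<open>(2 * C + 1) * e\<close> by
      \<open>\<epsilon> / 2\<close>.\<close>
    define \<epsilon> where "\<epsilon> = min r (min \<rho> dG) / 4"
    have \<epsilon>: "\<epsilon> > 0" "\<epsilon> \<le> r" "2 * \<epsilon> < \<rho>" "2 * \<epsilon> < dG" using r \<rho> dG by (auto simp: \<epsilon>_def)
    define \<delta>2 where "\<delta>2 = min \<delta>P (\<rho> / 2)"
    define e where "e = min (\<delta>2 / 3) (\<epsilon> / (4 * B))"
    have e: "e > 0" "e \<le> \<delta>2 / 3" "e \<le> \<epsilon> / (4 * B)" using \<delta>P \<rho> \<epsilon> B by (auto simp: e_def \<delta>2_def)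
    obtain d1 where d1: "d1 > 0" "\<And>a y. y \<in> S \<Longrightarrow> dist a y < d1 \<Longrightarrow> dist (F a) (F y) < e"
      using compact_uniform_nbhd[OF C1_map_continuous[OF FG(1)] S e(1)] by metis
    obtain d2 where d2: "d2 > 0" "\<And>a y. y \<in> S \<Longrightarrow> dist a y < d2 \<Longrightarrow> dist (G a) (G y) < e"
      using compact_uniform_nbhd[OF C1_map_continuous[OF FG(2)] S e(1)] by metis
    define \<delta> where "\<delta> = min (min e \<epsilon>) (min d1 d2)"
    have \<delta>: "\<delta> > 0" "\<delta> \<le> e" "\<delta> \<le> \<epsilon>" "\<delta> \<le> d1" "\<delta> \<le> d2" using e \<epsilon> d1 d2 by (auto simp: \<delta>_def)
    have main: "\<exists>z. (\<forall>k. dist (z k) (x k) \<le> \<epsilon>) \<and> (\<forall>k. z (k + 1) = iter f (int m) (z k)) \<and>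
        (\<forall>k0. (\<forall>k\<ge>k0. x (k + 1) = iter f (int m) (x k)) \<longrightarrow>
          (\<lambda>n. z (k0 + int n) - x (k0 + int n)) \<longlonglongrightarrow> 0)"
      if xy0: "\<forall>k. y k \<in> S \<and> dist (x k) (y k) < \<delta> \<and>
        dist (iter f (int m) (x k)) (x (k + 1)) < \<delta> \<and> dist (iter f (- int m) (x (k + 1))) (x k) < \<delta>"
      for x y :: "int \<Rightarrow> real^'n"
    proof -
      have y: "\<And>k. y k \<in> S" and xy: "\<And>k. dist (x k) (y k) < \<delta>"
        and xF: "\<And>k. dist (F (x k)) (x (k + 1)) < \<delta>" and xG: "\<And>k. dist (G (x (k + 1))) (x k) < \<delta>"
        using xy0 by (auto simp: F_def G_def)
      have yF: "dist (F (y k)) (y (k + 1)) < \<delta>2" for k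
      proof -
        have "dist (F (x k)) (F (y k)) < e" using d1(2)[OF y[of k]] xy[of k] \<delta> by simp
        moreover have "dist (F (y k)) (y (k + 1)) \<le> dist (F (x k)) (F (y k)) + dist (F (x k)) (y (k + 1))"
          by (rule dist_triangle3)
        moreover have "dist (F (x k)) (y (k + 1)) \<le> dist (F (x k)) (x (k + 1)) + dist (x (k + 1)) (y (k + 1))"
          by (rule dist_triangle)
        ultimately show ?thesis using xF[of k] xy[of "k + 1"] \<delta>(2) e(2) by linarith
      qed
      have yG: "dist (G (y (k + 1))) (y k) < \<delta>2" for k
      proof -
        have "dist (G (x (k + 1))) (G (y (k + 1))) < e" using d2(2)[OF y[of "k + 1"]] xy[of "k + 1"] \<delta> by simp
        moreover have "dist (G (y (k + 1))) (y k) \<le> dist (G (x (k + 1))) (G (y (k + 1))) + dist (G (x (k + 1))) (y k)"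
          by (rule dist_triangle3)
        moreover have "dist (G (x (k + 1))) (y k) \<le> dist (G (x (k + 1))) (x k) + dist (x k) (y k)"
          by (rule dist_triangle)
        ultimately show ?thesis using xG[of k] xy[of k] \<delta>(2) e(2) by linarith
      qed
      have near: "dist a (y k) < 2 * \<epsilon>" "dist a (y k) < \<rho>F" "dist a (y k) < \<rho>G" "dist a (y k) < dG"
        if "dist a (x k) \<le> \<epsilon>" for a k
      proof -
        have "dist a (y k) \<le> dist a (x k) + dist (x k) (y k)" by (rule dist_triangle)
        then show "dist a (y k) < 2 * \<epsilon>" using that xy[of k] \<delta>(3) by linarith
        then show "dist a (y k) < \<rho>F" "dist a (y k) < \<rho>G" "dist a (y k) < dG"
          using \<epsilon> by (auto simp: \<rho>_def)
      qed
      have PF: "norm (P (F (y k)) v - P (y (k + 1)) v) \<le> \<eta> * norm v" for k v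
        using \<delta>P(2) FS(1)[OF y[of k]] y[of "k + 1"] yF[of k] by (simp add: \<delta>2_def)
      have PG: "norm (P (G (y (k + 1))) v - P (y k) v) \<le> \<eta> * norm v" for k v
        using \<delta>P(2) FS(2)[OF y[of "k + 1"]] y[of k] yG[of k] by (simp add: \<delta>2_def)
      \<comment> \<open>The linear part preserves the bundles from \<open>y k\<close> to
        \<open>F (y k)\<close> and contracts the stable one. The errors come from changing the
        projection to the one at \<open>y (k + 1)\<close> and from the linearization.\<close>
      have Fc: "norm ((F a - F b) - P (y (k + 1)) (F a - F b)) \<le> norm (a - b) / 4"
        if ab: "dist a (x k) \<le> \<epsilon>" "dist b (x k) \<le> \<epsilon>" for k a b
      proof -
        let ?w = "a - b" and ?D = "fder F (y k)" and ?P' = "P (y (k + 1))"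
        let ?s = "?w - P (y k) ?w" and ?r = "F a - F b - fder F (y k) (a - b)"
        have lP: "linear ?P'" by (rule P(1)[OF y])
        have r: "norm ?r \<le> \<eta> * norm ?w"
          using ab by (intro \<rho>F(2) y near)
        have "?D ?w = ?D (P (y k) ?w) + ?D ?s"
          using lin(1)[of "y k"] by (simp flip: linear_add)
        moreover have "P (F (y k)) (?D (P (y k) ?w)) = ?D (P (y k) ?w)"
          by (intro P FS y DFE)
        moreover have "P (F (y k)) (?D ?s) = 0" by (intro P FS y DFS)
        ultimately have "?D ?w - P (F (y k)) (?D ?w) = ?D ?s"
          using linear_add[OF P(1)[OF FS(1)[OF y[of k]]]] by simp
        then have eq: "(F a - F b) - ?P' (F a - F b) =
            ?D ?s + (P (F (y k)) (?D ?w) - ?P' (?D ?w)) + ?r - ?P' ?r"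
          using linear_diff[OF lP, of "F a - F b" "?D ?w"] by (metis (no_types) alg1)
        have "norm ((F a - F b) - ?P' (F a - F b)) \<le>
            norm (?D ?s) + norm (P (F (y k)) (?D ?w) - ?P' (?D ?w)) + norm ?r + norm (?P' ?r)"
          unfolding eq by (rule tri4)
        also have "\<dots> \<le> c * \<mu> ^ m * ((C + 1) * norm ?w) + \<eta> * (BF * norm ?w) + \<eta> * norm ?w + C * (\<eta> * norm ?w)"
        proof (intro add_mono)
          have "norm ?s \<le> norm ?w + norm (P (y k) ?w)" by (rule norm_triangle_ineq4)
          also have "\<dots> \<le> (C + 1) * norm ?w" using C(2)[OF y[of k], of ?w] by (simp add: algebra_simps)
          finally have s: "norm ?s \<le> (C + 1) * norm ?w" .
          have "norm (?D ?s) \<le> c * \<mu> ^ m * norm ?s"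
            unfolding F_def using m(1) by (intro rs[rule_format] y P)
          also have "\<dots> \<le> c * \<mu> ^ m * ((C + 1) * norm ?w)" using s c by (intro mult_left_mono) auto
          finally show "norm (?D ?s) \<le> c * \<mu> ^ m * ((C + 1) * norm ?w)" .
          have "norm (P (F (y k)) (?D ?w) - ?P' (?D ?w)) \<le> \<eta> * norm (?D ?w)" by (rule PF)
          also have "\<dots> \<le> \<eta> * (BF * norm ?w)" using BF(2)[OF y] \<eta> by (intro mult_left_mono) auto
          finally show "norm (P (F (y k)) (?D ?w) - ?P' (?D ?w)) \<le> \<eta> * (BF * norm ?w)" .
          have "norm (?P' ?r) \<le> C * norm ?r" by (rule C(2)[OF y])
          also have "\<dots> \<le> C * (\<eta> * norm ?w)" using r C by (intro mult_left_mono) auto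
          finally show "norm (?P' ?r) \<le> C * (\<eta> * norm ?w)" .
        qed (rule r)
        also have "\<dots> = (c * \<mu> ^ m * (C + 1) + \<eta> * (BF + 1 + C)) * norm ?w" by (simp add: algebra_simps)
        also have "\<dots> \<le> (1 / 8 + 1 / 8) * norm ?w"
        proof (intro mult_right_mono add_mono)
          have "\<eta> * (BF + 1 + C) \<le> \<eta> * B" using \<eta> BG by (intro mult_left_mono) (auto simp: B_def)
          then show "\<eta> * (BF + 1 + C) \<le> 1 / 8" using \<eta>B1 by simp
        qed (use m in auto)
        finally show ?thesis by simp
      qed
      \<comment> \<open>The mirror estimate: \<open>G\<close> contracts the unstable part.\<close>
      have Gc: "norm (P (y (k - 1)) (G a - G b)) \<le> norm (a - b) / 4"
        if ab: "dist a (x k) \<le> \<epsilon>" "dist b (x k) \<le> \<epsilon>" for k a b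
      proof -
        let ?w = "a - b" and ?D = "fder G (y k)" and ?P' = "P (y (k - 1))"
        let ?u = "P (y k) ?w" and ?r = "G a - G b - fder G (y k) (a - b)"
        have lP: "linear ?P'" by (rule P(1)[OF y])
        have r: "norm ?r \<le> \<eta> * norm ?w"
          using ab by (intro \<rho>G(2) y near)
        have "?D ?w = ?D ?u + ?D (?w - ?u)"
          using lin(2)[of "y k"] by (simp flip: linear_add)
        moreover have "P (G (y k)) (?D ?u) = ?D ?u"
          by (intro P FS y DFE)
        moreover have "P (G (y k)) (?D (?w - ?u)) = 0" by (intro P FS y DFS)
        ultimately have "P (G (y k)) (?D ?w) = ?D ?u"
          using linear_add[OF P(1)[OF FS(2)[OF y[of k]]]] by simp
        then have eq: "?P' (G a - G b) = ?D ?u - (P (G (y k)) (?D ?w) - ?P' (?D ?w)) + ?P' ?r"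
          using linear_diff[OF lP, of "G a - G b" "?D ?w"] by (metis (no_types) alg2)
        have "norm (?P' (G a - G b)) \<le> norm (?D ?u) + norm (P (G (y k)) (?D ?w) - ?P' (?D ?w)) + norm (?P' ?r)"
          unfolding eq by (rule tri3)
        also have "\<dots> \<le> c * \<mu> ^ m * (C * norm ?w) + \<eta> * (BG * norm ?w) + C * (\<eta> * norm ?w)"
        proof (intro add_mono)
          have "norm (?D ?u) \<le> c * \<mu> ^ m * norm ?u"
            unfolding G_def using m(1) by (intro ru[rule_format] y P)
          also have "\<dots> \<le> c * \<mu> ^ m * (C * norm ?w)" using C(2)[OF y] c by (intro mult_left_mono) auto
          finally show "norm (?D ?u) \<le> c * \<mu> ^ m * (C * norm ?w)" .
          have "norm (P (G (y k)) (?D ?w) - ?P' (?D ?w)) \<le> \<eta> * norm (?D ?w)" using PG[of "k - 1"] by simp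
          also have "\<dots> \<le> \<eta> * (BG * norm ?w)" using BG(2)[OF y] \<eta> by (intro mult_left_mono) auto
          finally show "norm (P (G (y k)) (?D ?w) - ?P' (?D ?w)) \<le> \<eta> * (BG * norm ?w)" .
          have "norm (?P' ?r) \<le> C * norm ?r" by (rule C(2)[OF y])
          also have "\<dots> \<le> C * (\<eta> * norm ?w)" using r C by (intro mult_left_mono) auto
          finally show "norm (?P' ?r) \<le> C * (\<eta> * norm ?w)" .
        qed
        also have "\<dots> = (c * \<mu> ^ m * C + \<eta> * (BG + C)) * norm ?w" by (simp add: algebra_simps)
        also have "\<dots> \<le> (1 / 8 + 1 / 8) * norm ?w"
        proof (intro mult_right_mono add_mono)
          have "\<eta> * (BG + C) \<le> \<eta> * B" using \<eta> BF by (intro mult_left_mono) (auto simp: B_def)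
          then show "\<eta> * (BG + C) \<le> 1 / 8" using \<eta>B1 by simp
          have "c * \<mu> ^ m * C \<le> c * \<mu> ^ m * (C + 1)" using c by (intro mult_left_mono) auto
          then show "c * \<mu> ^ m * C \<le> 1 / 8" using m by simp
        qed auto
        finally show ?thesis by simp
      qed
      have ps: "norm (F (x (k - 1)) - P (y k) (F (x (k - 1))) + P (y k) (G (x (k + 1))) - x k) \<le> \<epsilon> / 2" for k
      proof -
        let ?P = "P (y k)"
        let ?a = "F (x (k - 1)) - x k" and ?b = "G (x (k + 1)) - x k"
        have a: "norm ?a \<le> e" using xF[of "k - 1"] \<delta>(2) by (simp add: dist_norm)
        have b: "norm ?b \<le> e" using xG[of k] \<delta>(2) by (simp add: dist_norm)
        have "F (x (k - 1)) - ?P (F (x (k - 1))) + ?P (G (x (k + 1))) - x k = ?a - ?P ?a + ?P ?b"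
          using P(1)[OF y[of k]] by (simp add: linear_diff)
        also have "norm \<dots> \<le> norm ?a + norm (?P ?a) + norm (?P ?b)"
          by (meson norm_triangle_ineq4 norm_triangle_ineq add_right_mono order_trans)
        also have "\<dots> \<le> e + C * e + C * e"
        proof (intro add_mono a)
          have "C * norm ?a \<le> C * e" "C * norm ?b \<le> C * e" using a b C by (auto intro: mult_left_mono)
          then show "norm (?P ?a) \<le> C * e" "norm (?P ?b) \<le> C * e"
            using C(2)[OF y[of k], of ?a] C(2)[OF y[of k], of ?b] by simp_all
        qed
        also have "\<dots> = (2 * C + 1) * e" by (simp add: algebra_simps)
        also have "\<dots> \<le> (2 * B) * e" using e BF BG by (intro mult_right_mono) (auto simp: B_def)
        also have "\<dots> \<le> (2 * B) * (\<epsilon> / (4 * B))" using e B by (intro mult_left_mono) auto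
        also have "\<dots> = \<epsilon> / 2" using B by simp
        finally show ?thesis .
      qed
      \<comment> \<open>The first equation makes \<open>G b - a\<close> stable at
        \<open>y k\<close>, so its image under \<open>fder F\<close> is nearly stable at
        \<open>y (k + 1)\<close>; the second makes \<open>b - F a\<close> unstable there. The two
        differ by a linearization error only, so both are small against \<open>G b - a\<close>.
        Inverting \<open>fder F\<close> bounds the norm of \<open>G b - a\<close> by an eighth of
        itself.\<close>
      have tr: "b = F a" if ab: "dist a (x k) \<le> \<epsilon>" "dist b (x (k + 1)) \<le> \<epsilon>"
        "P (y k) (G b) = P (y k) a" "F a - P (y (k + 1)) (F a) = b - P (y (k + 1)) b" for k a b
      proof -
        let ?s = "G b - a" and ?D = "fder F (y k)" and ?P' = "P (y (k + 1))"
        let ?r = "F (G b) - F a - fder F (y k) (G b - a)"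
        have lP: "linear ?P'" by (rule P(1)[OF y])
        have "dist (G b) (y k) \<le> dist (G b) (G (y (k + 1))) + dist (G (y (k + 1))) (y k)"
          by (rule dist_triangle)
        also have "\<dots> < \<rho> / 2 + \<rho> / 2"
          using near(4)[OF ab(2)] yG[of k] by (intro add_strict_mono dG(2)[OF y]) (auto simp: \<delta>2_def)
        finally have Gb: "dist (G b) (y k) < \<rho>F" by (simp add: \<rho>_def)
        have r: "norm ?r \<le> \<eta> * norm ?s"
          by (intro \<rho>F(2) y Gb near(2) ab(1))
        have "P (y k) ?s = 0" using ab(3) P(1)[OF y[of k]] by (simp add: linear_diff)
        then have s: "?s \<in> Es (y k)" using P(3)[OF y[of k], of ?s] by simp
        then have "P (F (y k)) (?D ?s) = 0" by (intro P FS y DFS)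
        then have PD: "norm (?P' (?D ?s)) \<le> \<eta> * norm (?D ?s)" using PF[of k "?D ?s"] by simp
        have "b - F a = ?P' (b - F a)" using ab(4) lP by (simp add: linear_diff algebra_simps)
        also have "b - F a = ?D ?s + ?r" using FG(3)[of b] by simp
        finally have q: "?D ?s + ?r = ?P' (?D ?s + ?r)" .
        have "?D ?s = ?P' (?D ?s) + ?P' ?r - ?r" using q[unfolded linear_add[OF lP]] by (rule alg3)
        then have "norm (?D ?s) = norm (?P' (?D ?s) + ?P' ?r - ?r)" by (rule arg_cong)
        also have "\<dots> \<le> norm (?P' (?D ?s)) + norm (?P' ?r) + norm ?r" by (rule tri3')
        also have "\<dots> \<le> \<eta> * (BF * norm ?s) + C * (\<eta> * norm ?s) + \<eta> * norm ?s"
        proof (intro add_mono r)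
          have "\<eta> * norm (?D ?s) \<le> \<eta> * (BF * norm ?s)" using BF(2)[OF y] \<eta> by (intro mult_left_mono) auto
          then show "norm (?P' (?D ?s)) \<le> \<eta> * (BF * norm ?s)" using PD by simp
          have "C * norm ?r \<le> C * (\<eta> * norm ?s)" using r C by (intro mult_left_mono) auto
          then show "norm (?P' ?r) \<le> C * (\<eta> * norm ?s)" using C(2)[OF y[of "k + 1"], of ?r] by simp
        qed
        also have "\<dots> = \<eta> * (BF + C + 1) * norm ?s" by (simp add: algebra_simps)
        also have "\<dots> \<le> \<eta> * B * norm ?s"
          using \<eta> BG by (intro mult_right_mono mult_left_mono) (auto simp: B_def)
        finally have D: "norm (?D ?s) \<le> \<eta> * B * norm ?s" .
        have "norm ?s = norm (fder G (F (y k)) (?D ?s))" by (simp add: GF)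
        also have "\<dots> \<le> BG * norm (?D ?s)" by (intro BG FS y)
        also have "\<dots> \<le> B * (\<eta> * B * norm ?s)"
          using D BG C BF by (intro mult_mono) (auto simp: B_def)
        also have "\<dots> = 1 / 8 * norm ?s" using \<eta>B by (simp add: mult_ac)
        finally have "norm ?s = 0" using norm_ge_zero[of ?s] by linarith
        then have "G b = a" by simp
        then show ?thesis using FG(3) by metis
      qed
      obtain z where z: "\<And>k. dist (z k) (x k) \<le> \<epsilon>" "\<And>k. z (k + 1) = F (z k)"
        "\<And>k0. \<forall>k\<ge>k0. F (x k) = x (k + 1) \<and> G (x (k + 1)) = x k \<Longrightarrow>
          (\<lambda>n. z (k0 + int n) - x (k0 + int n)) \<longlonglongrightarrow> 0"
      proof (rule pseudo_orbit_fixed_point[of \<epsilon> "\<lambda>k. P (y k)" x F G])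
        show "P (y k) (P (y k) v) = P (y k) v" for k v by (intro P y)
      qed (use \<epsilon> P(1)[OF y] Fc Gc ps tr in blast)+
      show "\<exists>z. (\<forall>k. dist (z k) (x k) \<le> \<epsilon>) \<and> (\<forall>k. z (k + 1) = iter f (int m) (z k)) \<and>
          (\<forall>k0. (\<forall>k\<ge>k0. x (k + 1) = iter f (int m) (x k)) \<longrightarrow>
            (\<lambda>n. z (k0 + int n) - x (k0 + int n)) \<longlonglongrightarrow> 0)"
        using z FG(4) unfolding F_def by (intro exI[of _ z]) simp
    qed
    show "\<exists>\<epsilon>>0. \<exists>\<delta>>0. \<epsilon> \<le> r \<and> \<delta> \<le> r \<and>
      (\<forall>x y :: int \<Rightarrow> real^'n. (\<forall>k. y k \<in> S \<and> dist (x k) (y k) < \<delta> \<and>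
          dist (iter f (int m) (x k)) (x (k + 1)) < \<delta> \<and> dist (iter f (- int m) (x (k + 1))) (x k) < \<delta>) \<longrightarrow>
        (\<exists>z. (\<forall>k. dist (z k) (x k) \<le> \<epsilon>) \<and> (\<forall>k. z (k + 1) = iter f (int m) (z k)) \<and>
          (\<forall>k0. (\<forall>k\<ge>k0. x (k + 1) = iter f (int m) (x k)) \<longrightarrow>
            (\<lambda>n. z (k0 + int n) - x (k0 + int n)) \<longlonglongrightarrow> 0)))"
      using \<epsilon>(1,2) \<delta>(1,3)
      by (intro exI[of _ \<epsilon>] exI[of _ \<delta>] conjI allI impI) (linarith | rule main, assumption)+
  qed
qed

section \<open>Orbits asymptotic to the invariant set\<close>

lemma forward_orbit_shadowed:
  fixes f :: "real^'n \<Rightarrow> real^'n"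
  assumes f: "diffeomorphism f" and hyp: "hyperbolic f (Inv f U)" and A: "compact A" and AU: "A \<subseteq> interior U"
    and q: "\<And>i. iter f (int i) q \<in> A"
  obtains p where "p \<in> Inv f U" "(\<lambda>j. norm (iter f (int j) p - iter f (int j) q)) \<longlonglongrightarrow> 0"
proof -
  have b: "bij f" using f by (simp add: diffeomorphism_def)
  note ia = iter_add[OF b, symmetric]
  let ?S = "Inv f A"
  have S: "compact ?S" by (rule compact_Inv[OF f A])
  have SU: "?S \<subseteq> interior U" using Inv_subset[of f A] AU by blast
  have inv: "iter f k p \<in> ?S" if "p \<in> ?S" for p k using that by (simp add: iter_in_Inv[OF b])
  obtain Eu Es where "hyperbolic_splitting f (Inv f U) Eu Es" using hyp by (auto simp: hyperbolic_def)
  then have H: "hyperbolic_splitting f ?S Eu Es"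
    by (rule hyperbolic_splitting_subset[OF _ Inv_mono[OF order_trans[OF AU interior_subset]]])
  \<comment> \<open>A uniform neighbourhood of the compact set \<open>Inv f A\<close> lies in
    \<open>U\<close>; this is what puts the shadowing orbit into \<open>U\<close>.\<close>
  obtain r0 where r0: "r0 > 0" "(\<Union>y\<in>?S. ball y r0) \<subseteq> interior U"
    using compact_subset_open_imp_ball_epsilon_subset[OF S open_interior SU] by blast
  obtain m :: nat where m: "m \<ge> 1" and m': "\<forall>r>0. \<exists>\<epsilon>>0. \<exists>\<delta>>0. \<epsilon> \<le> r \<and> \<delta> \<le> r \<and>
    (\<forall>x y :: int \<Rightarrow> real^'n. (\<forall>k. y k \<in> ?S \<and> dist (x k) (y k) < \<delta> \<and>
        dist (iter f (int m) (x k)) (x (k + 1)) < \<delta> \<and> dist (iter f (- int m) (x (k + 1))) (x k) < \<delta>) \<longrightarrow>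
      (\<exists>z. (\<forall>k. dist (z k) (x k) \<le> \<epsilon>) \<and> (\<forall>k. z (k + 1) = iter f (int m) (z k)) \<and>
        (\<forall>k0. (\<forall>k\<ge>k0. x (k + 1) = iter f (int m) (x k)) \<longrightarrow>
          (\<lambda>n. z (k0 + int n) - x (k0 + int n)) \<longlonglongrightarrow> 0)))"
    by atomize_elim (rule hyperbolic_shadowing[OF f H inv S])
  obtain d where d: "d > 0" "\<forall>i<m. \<forall>y\<in>?S. \<forall>a. dist a y < d \<longrightarrow> dist (iter f (int i) a) (iter f (int i) y) < r0"
    using compact_uniform_nbhd_iterates[OF f S r0(1)] by blast
  obtain \<epsilon> \<delta> where \<epsilon>: "\<epsilon> > 0" "\<delta> > 0" "\<epsilon> \<le> d / 4" "\<delta> \<le> d / 4"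
    and main: "\<forall>x y :: int \<Rightarrow> real^'n. (\<forall>k. y k \<in> ?S \<and> dist (x k) (y k) < \<delta> \<and>
        dist (iter f (int m) (x k)) (x (k + 1)) < \<delta> \<and> dist (iter f (- int m) (x (k + 1))) (x k) < \<delta>) \<longrightarrow>
      (\<exists>z. (\<forall>k. dist (z k) (x k) \<le> \<epsilon>) \<and> (\<forall>k. z (k + 1) = iter f (int m) (z k)) \<and>
        (\<forall>k0. (\<forall>k\<ge>k0. x (k + 1) = iter f (int m) (x k)) \<longrightarrow>
          (\<lambda>n. z (k0 + int n) - x (k0 + int n)) \<longlonglongrightarrow> 0))"
    using m'[rule_format, of "d / 4"] d(1) by auto
  \<comment> \<open>The single jump of the pseudo-orbit has to be small backwards as well.\<close>
  obtain \<delta>1 where \<delta>1: "\<delta>1 > 0" "\<And>a y. y \<in> ?S \<Longrightarrow> dist a y < \<delta>1 \<Longrightarrow> dist (iter f (- int m) a) (iter f (- int m) y) < \<delta>"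
    using compact_uniform_nbhd[OF iter_continuous[OF f] S \<epsilon>(2)] by blast
  obtain N where N: "\<forall>k\<ge>N. \<exists>y\<in>?S. dist (iter f (int k) q) y < min \<delta> \<delta>1"
    using forward_orbit_limit[OF f A q, of "min \<delta> \<delta>1"] \<epsilon> \<delta>1 by auto
  then obtain Y where Y: "\<And>k. k \<ge> N \<Longrightarrow> Y k \<in> ?S" "\<And>k. k \<ge> N \<Longrightarrow> dist (iter f (int k) q) (Y k) < min \<delta> \<delta>1"
    by metis
  \<comment> \<open>For \<open>k \<ge> 0\<close> the orbit of \<open>q\<close> from time
    \<open>N\<close> on, sampled every \<open>m\<close> steps; for \<open>k < 0\<close> the sampled
    past of the nearby point \<open>Y N\<close> of \<open>Inv f A\<close>. The only jump is from
    index -1 to 0, so \<open>x\<close> is a true orbit from index 0 on.\<close>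
  define x where "x k = (if k \<ge> 0 then iter f (int N + int m * k) q else iter f (int m * k) (Y N))" for k
  define y where "y k = (if k \<ge> 0 then Y (N + m * nat k) else iter f (int m * k) (Y N))" for k
  have xA: "x k \<in> A" if "k \<ge> 0" for k
    using q[of "N + m * nat k"] that by (simp add: x_def)
  have xF: "iter f (int m) (x k) = x (k + 1)" if "k \<noteq> - 1" for k
    using that by (auto simp: x_def ia algebra_simps)
  have xG: "iter f (- int m) (x (k + 1)) = x k" if "k \<noteq> - 1" for k
    using iter_minus_cancel(1)[OF b, of "int m" "x k"] xF[OF that] by simp
  have "\<forall>k. y k \<in> ?S \<and> dist (x k) (y k) < \<delta> \<and>
        dist (iter f (int m) (x k)) (x (k + 1)) < \<delta> \<and> dist (iter f (- int m) (x (k + 1))) (x k) < \<delta>"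
  proof (intro allI conjI)
    fix k
    show "y k \<in> ?S" using Y(1) inv by (auto simp: y_def)
    show "dist (x k) (y k) < \<delta>"
      using Y(2)[of "N + m * nat k"] \<epsilon> by (auto simp: y_def x_def)
    have 1: "iter f (int m) (x (- 1)) = Y N" "x 0 = iter f (int N) q"
      using b by (auto simp: x_def)
    show "dist (iter f (int m) (x k)) (x (k + 1)) < \<delta>"
    proof (cases "k = - 1")
      case True
      then show ?thesis using 1 Y(2)[of N] by (simp add: dist_commute)
    qed (use xF \<epsilon> in simp)
    show "dist (iter f (- int m) (x (k + 1))) (x k) < \<delta>"
    proof (cases "k = - 1")
      case True
      have "dist (iter f (- int m) (x 0)) (iter f (- int m) (Y N)) < \<delta>"
        using 1 Y[of N] by (intro \<delta>1) auto
      then show ?thesis using True by (simp add: x_def)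
    qed (use xG \<epsilon> in simp)
  qed
  then obtain z where z: "\<forall>k. dist (z k) (x k) \<le> \<epsilon>" "\<forall>k. z (k + 1) = iter f (int m) (z k)"
      "\<forall>k0. (\<forall>k\<ge>k0. x (k + 1) = iter f (int m) (x k)) \<longrightarrow> (\<lambda>n. z (k0 + int n) - x (k0 + int n)) \<longlonglongrightarrow> 0"
    and y: "\<And>k. y k \<in> ?S" and xy: "\<And>k. dist (x k) (y k) < \<delta>"
    using main by blast
  have zk: "iter f (int m * k) (z 0) = z k" for k
  proof (induction k rule: int_induct[where k = 0])
    case (step1 i)
    have "iter f (int m * (i + 1)) (z 0) = iter f (int m) (iter f (int m * i) (z 0))"
      by (simp add: ia algebra_simps)
    then show ?case using step1.IH z(2) by simp
  next
    case (step2 i)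
    have "iter f (int m * (i - 1)) (z 0) = iter f (- int m) (iter f (int m * i) (z 0))"
      by (simp add: ia algebra_simps)
    also have "\<dots> = iter f (- int m) (iter f (int m) (z (i - 1)))"
      using step2.IH z(2)[rule_format, of "i - 1"] by simp
    finally show ?case using b by simp
  qed simp
  \<comment> \<open>A time is a multiple of \<open>m\<close>, where shadowing applies, plus a
    remainder below \<open>m\<close>, where \<open>d\<close> applies.\<close>
  have dm: "n = int (nat (n mod int m)) + int m * (n div int m)" "nat (n mod int m) < m" for n
    using m by (auto simp: nat_less_iff)
  have zU: "iter f n (z 0) \<in> U" for n
  proof -
    let ?i = "nat (n mod int m)" and ?k = "n div int m"
    have "dist (z ?k) (y ?k) \<le> dist (z ?k) (x ?k) + dist (x ?k) (y ?k)" by (rule dist_triangle)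
    also have "\<dots> < d" using z(1)[rule_format, of ?k] xy[of ?k] \<epsilon> d by linarith
    finally have "dist (iter f (int ?i) (z ?k)) (iter f (int ?i) (y ?k)) < r0" using d(2) dm(2) y by blast
    then have "iter f (int ?i) (z ?k) \<in> ball (iter f (int ?i) (y ?k)) r0" by (simp add: dist_commute)
    then have "iter f (int ?i) (z ?k) \<in> interior U" using r0(2) inv[OF y] by blast
    moreover have "iter f n (z 0) = iter f (int ?i) (z ?k)"
      using dm(1)[of n] by (metis iter_add[OF b] zk)
    ultimately have "iter f n (z 0) \<in> interior U" by (simp only:)
    then show ?thesis using interior_subset by blast
  qed
  \<comment> \<open>Undoes the delay \<open>N\<close> after which the sampling of \<open>q\<close>
    began.\<close>
  define p where "p = iter f (- int N) (z 0)"
  have "p \<in> Inv f U" using zU by (simp add: Inv_def p_def ia)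
  moreover have "(\<lambda>j. norm (iter f (int j) p - iter f (int j) q)) \<longlonglongrightarrow> 0"
  proof (rule LIMSEQ_I)
    fix e :: real assume "e > 0"
    \<comment> \<open>Convergence along multiples of \<open>m\<close> extends to all times,
      uniformly because the sampled points of \<open>q\<close> stay in the compact set
      \<open>A\<close>.\<close>
    then obtain d' where d': "d' > 0" "\<forall>i<m. \<forall>y\<in>A. \<forall>a. dist a y < d' \<longrightarrow> dist (iter f (int i) a) (iter f (int i) y) < e"
      using compact_uniform_nbhd_iterates[OF f A] by blast
    have "(\<lambda>n. z (0 + int n) - x (0 + int n)) \<longlonglongrightarrow> 0"
      by (rule z(3)[rule_format]) (use xF in force)
    then have "\<exists>n0. \<forall>n\<ge>n0. norm (z (0 + int n) - x (0 + int n) - 0) < d'"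
      using d'(1) by (rule LIMSEQ_D)
    then obtain n0 where n0: "\<And>n. n \<ge> n0 \<Longrightarrow> dist (z (int n)) (x (int n)) < d'"
      by (auto simp: dist_norm)
    show "\<exists>no. \<forall>j\<ge>no. norm (norm (iter f (int j) p - iter f (int j) q) - 0) < e"
    proof (intro exI allI impI)
      fix j assume j: "j \<ge> N + m * n0"
      define i k where "i = (j - N) mod m" and "k = (j - N) div m"
      have jk: "j = N + (m * k + i)" using j by (simp add: i_def k_def)
      have i: "i < m" using m by (simp add: i_def)
      have "m * n0 div m \<le> (j - N) div m" using j by (intro div_le_mono) simp
      then have k: "k \<ge> n0" using m by (simp add: k_def)
      have "int j - int N = int i + int m * int k" using jk by simp
      then have "iter f (int j) p = iter f (int i) (iter f (int m * int k) (z 0))"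
        by (simp add: p_def ia)
      then have jp: "iter f (int j) p = iter f (int i) (z (int k))" by (simp add: zk)
      have "int j = int i + (int N + int m * int k)" using jk by simp
      then have jq: "iter f (int j) q = iter f (int i) (x (int k))" by (simp add: x_def ia)
      have "dist (iter f (int j) p) (iter f (int j) q) < e"
        unfolding jp jq using d'(2) i xA[of "int k"] n0[OF k] by simp
      then show "norm (norm (iter f (int j) p - iter f (int j) q) - 0) < e" by (simp add: dist_norm)
    qed
  qed
  ultimately show ?thesis by (rule that)
qed

lemma Ws_loc_memI:
  fixes f :: "real^'n \<Rightarrow> real^'n"
  assumes "diffeomorphism f" "hyperbolic f (Inv f U)" "compact A" "A \<subseteq> interior U"
    and q: "\<And>i. iter f (int i) q \<in> A"
  shows "q \<in> Ws_loc f U (Inv f U)"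
proof -
  obtain p where "p \<in> Inv f U" "(\<lambda>j. norm (iter f (int j) p - iter f (int j) q)) \<longlonglongrightarrow> 0"
    using forward_orbit_shadowed[OF assms] by blast
  moreover have "iter f (int j) q \<in> U" for j using q[of j] assms(4) interior_subset by blast
  ultimately show ?thesis by (auto simp: Ws_loc_def Ws_loc_pt_def)
qed

lemma hyperbolic_inv:
  assumes "diffeomorphism f" "hyperbolic f (Inv f U)"
  shows "hyperbolic (inv f) (Inv (inv f) U)"
proof -
  have b: "bij f" using assms(1) by (simp add: diffeomorphism_def)
  then show ?thesis
    using assms hyperbolic_splitting_inv[OF assms(1), of "Inv f U"]
    by (auto simp: hyperbolic_def Inv_inv iter_in_Inv)
qed

text \<open>Time reversal of \<open>Ws_loc_memI\<close>.\<close>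

lemma Wu_loc_memI:
  fixes f :: "real^'n \<Rightarrow> real^'n"
  assumes f: "diffeomorphism f" and hyp: "hyperbolic f (Inv f U)" and A: "compact A" "A \<subseteq> interior U"
    and q: "\<And>i. iter f (- int i) q \<in> A"
  shows "q \<in> Wu_loc f U (Inv f U)"
proof -
  have b: "bij f" using f by (simp add: diffeomorphism_def)
  have "q \<in> Ws_loc (inv f) U (Inv (inv f) U)"
    by (rule Ws_loc_memI[OF diffeomorphism_inv[OF f] hyperbolic_inv[OF f hyp] A]) (simp add: iter_inv[OF b] q)
  then show ?thesis
    by (simp add: Ws_loc_def Ws_loc_pt_def Wu_loc_def Wu_loc_pt_def iter_inv[OF b] Inv_inv[OF b])
qed

section \<open>Frames and boxes\<close>

definition seminorm :: "('a::real_vector \<Rightarrow> real) \<Rightarrow> bool" where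
  "seminorm s \<longleftrightarrow> (\<forall>x. 0 \<le> s x) \<and> (\<forall>c x. s (c *\<^sub>R x) = \<bar>c\<bar> * s x) \<and> (\<forall>x y. s (x + y) \<le> s x + s y)"

lemma seminormD:
  assumes "seminorm s"
  shows "0 \<le> s x" "s (c *\<^sub>R x) = \<bar>c\<bar> * s x" "s (x + y) \<le> s x + s y" "s 0 = 0"
    "s (- x) = s x" "s (x - y) = s (y - x)"
proof -
  show *: "0 \<le> s x" "s (c *\<^sub>R x) = \<bar>c\<bar> * s x" "s (x + y) \<le> s x + s y" for c x y
    using assms by (auto simp: seminorm_def)
  show "s 0 = 0" using *(2)[of 0 0] by simp
  show neg: "s (- x) = s x" for x using *(2)[of "-1" x] by simp
  show "s (x - y) = s (y - x)" using neg[of "x - y"] by simp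
qed

lemma seminorm_convex: assumes s: "seminorm s" shows "convex_on UNIV s"
proof (rule convex_onI)
  fix t :: real and x y assume "0 < t" "t < 1"
  then show "s ((1 - t) *\<^sub>R x + t *\<^sub>R y) \<le> (1 - t) * s x + t * s y"
    using seminormD(3)[OF s, of "(1 - t) *\<^sub>R x" "t *\<^sub>R y"] by (simp add: seminormD(2)[OF s])
qed simp

lemma seminorm_continuous:
  fixes s :: "'a::euclidean_space \<Rightarrow> real"
  shows "seminorm s \<Longrightarrow> continuous_on S s"
  by (meson seminorm_convex convex_on_continuous open_UNIV continuous_on_subset subset_UNIV)

lemma seminorm_upper_bound:
  fixes s :: "'a::euclidean_space \<Rightarrow> real"
  assumes s: "seminorm s"
  obtains B where "B > 0" "\<And>v. s v \<le> B * norm v"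
proof -
  have "compact (s ` sphere 0 1)"
    by (intro compact_continuous_image seminorm_continuous s) auto
  then have "bounded (s ` sphere 0 1)" by (rule compact_imp_bounded)
  then obtain B where B0: "\<forall>v\<in>sphere 0 1. norm (s v) \<le> B" by (auto simp: bounded_iff)
  have B: "s v \<le> B" if "norm v = 1" for v
    using bspec[OF B0, of v] that seminormD(1)[OF s, of v] by simp
  have "s v \<le> max 1 B * norm v" for v
  proof (cases "v = 0")
    case False
    have "s v = norm v * s (v /\<^sub>R norm v)" using False seminormD(2)[OF s, of "inverse (norm v)" v] by simp
    also have "\<dots> \<le> norm v * max 1 B"
      using B[of "v /\<^sub>R norm v"] False by (intro mult_left_mono) auto
    finally show ?thesis by (simp add: mult.commute)
  qed (simp add: seminormD[OF s])
  then show ?thesis using that[of "max 1 B"] by simp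
qed

lemma norm_lower_bound:
  fixes s :: "'a::euclidean_space \<Rightarrow> real"
  assumes s: "seminorm s" and pos: "\<And>v. s v = 0 \<Longrightarrow> v = 0"
  obtains B where "B > 0" "\<And>v. norm v \<le> B * s v"
proof -
  obtain w :: 'a where w: "norm w = 1" using vector_choose_size[of 1] by auto
  have "compact (sphere (0::'a) 1)" "sphere (0::'a) 1 \<noteq> {}" using w by auto
  then obtain u where u: "norm u = 1" "\<And>v. norm v = 1 \<Longrightarrow> s u \<le> s v"
    using continuous_attains_inf[OF _ _ seminorm_continuous[OF s]] by (metis mem_sphere_0)
  have su: "s u > 0" using pos[of u] u(1) seminormD(1)[OF s, of u] by fastforce
  have "norm v \<le> inverse (s u) * s v" for v
  proof (cases "v = 0")
    case False
    have "norm v * s u \<le> norm v * s (v /\<^sub>R norm v)"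
      using u(2)[of "v /\<^sub>R norm v"] False by (intro mult_left_mono) auto
    also have "\<dots> = s v" using False seminormD(2)[OF s, of "inverse (norm v)" v] by simp
    finally show ?thesis using su by (simp add: field_simps)
  qed (simp add: seminormD[OF s])
  then show ?thesis using su that[of "inverse (s u)"] by simp
qed

lemma coord_proj_linear: "linear (coord_proj S)"
  by (rule linearI) (auto simp: coord_proj_def vec_eq_iff)

lemma coord_space_subspace: "subspace (coord_space S)"
  by (auto simp: subspace_def coord_space_def)

lemma coord_proj_simps [simp]:
  "coord_proj S v \<in> coord_space S" "v \<in> coord_space S \<Longrightarrow> coord_proj S v = v"
  "v \<in> coord_space S \<Longrightarrow> coord_proj (- S) v = 0" "v \<in> coord_space (- S) \<Longrightarrow> coord_proj S v = 0"
  "coord_proj S v + coord_proj (- S) v = v"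
  by (auto simp: coord_proj_def coord_space_def vec_eq_iff)

lemma xspace_subspace: "subspace (xspace G)" and yspace_subspace: "subspace (yspace G)"
  by (auto simp: xspace_def yspace_def coord_space_subspace)

lemma proj_linear: "linear (proj_x G)" "linear (proj_y G)"
  by (simp_all add: proj_x_def proj_y_def coord_proj_linear)

lemma proj_simps [simp]:
  "proj_x G v \<in> xspace G" "proj_y G v \<in> yspace G"
  "v \<in> xspace G \<Longrightarrow> proj_x G v = v" "v \<in> yspace G \<Longrightarrow> proj_y G v = v"
  "v \<in> xspace G \<Longrightarrow> proj_y G v = 0" "v \<in> yspace G \<Longrightarrow> proj_x G v = 0"
  "proj_x G v + proj_y G v = v"
  by (simp_all add: xspace_def yspace_def proj_x_def proj_y_def)

lemma proj_add: "proj_x G (v + w) = proj_x G v + proj_x G w" "proj_y G (v + w) = proj_y G v + proj_y G w"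
  and proj_diff: "proj_x G (v - w) = proj_x G v - proj_x G w" "proj_y G (v - w) = proj_y G v - proj_y G w"
  and proj_scale: "proj_x G (c *\<^sub>R v) = c *\<^sub>R proj_x G v" "proj_y G (c *\<^sub>R v) = c *\<^sub>R proj_y G v"
  by (simp_all add: linear_add linear_diff linear_scale proj_linear)

lemma proj_continuous: "continuous_on S (proj_x G)" "continuous_on S (proj_y G)"
  by (simp_all add: linear_continuous_on linear_linear proj_linear)

text \<open>The frame norms are meaningful on coordinate subspaces only. Composed with the
  projections they are seminorms on the whole space, where continuity and convexity are available
  globally.\<close>

definition bnx :: "'n frame \<Rightarrow> real^'n \<Rightarrow> real" where "bnx G v = ball_norm_x G (proj_x G v)"
definition bny :: "'n frame \<Rightarrow> real^'n \<Rightarrow> real" where "bny G v = ball_norm_y G (proj_y G v)"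
definition cnx :: "'n frame \<Rightarrow> real^'n \<Rightarrow> real" where "cnx G v = cone_norm_x G (proj_x G v)"
definition cny :: "'n frame \<Rightarrow> real^'n \<Rightarrow> real" where "cny G v = cone_norm_y G (proj_y G v)"

lemma frame_seminorms:
  assumes "is_frame G"
  shows "seminorm (bnx G)" "seminorm (bny G)" "seminorm (cnx G)" "seminorm (cny G)"
  using assms by (auto simp: is_frame_def norm_on_def seminorm_def bnx_def bny_def cnx_def cny_def
      proj_add proj_scale)

lemma frame_zero:
  assumes "is_frame G"
  shows "bnx G v = 0 \<longleftrightarrow> proj_x G v = 0" "bny G v = 0 \<longleftrightarrow> proj_y G v = 0"
    "cnx G v = 0 \<longleftrightarrow> proj_x G v = 0" "cny G v = 0 \<longleftrightarrow> proj_y G v = 0"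
  using assms by (auto simp: is_frame_def norm_on_def bnx_def bny_def cnx_def cny_def)

text \<open>Each summand vanishes on a whole factor; the sum is a genuine norm and hence equivalent
  to the Euclidean one. This bounds the box and makes disks Lipschitz graphs.\<close>

lemma frame_norm_sum:
  assumes G: "is_frame G"
  shows "seminorm (\<lambda>v. bnx G v + bny G v)" "bnx G v + bny G v = 0 \<Longrightarrow> v = 0"
    "seminorm (\<lambda>v. cnx G v + cny G v)" "cnx G v + cny G v = 0 \<Longrightarrow> v = 0"
proof -
  have sum: "seminorm (\<lambda>v. s v + t v)" if "seminorm s" "seminorm t" for s t :: "real^'a \<Rightarrow> real"
    using that
    unfolding seminorm_def
  proof (intro conjI allI)
    fix x y c
    show "0 \<le> s x + t x" using that by (simp add: seminormD)
    show "s (c *\<^sub>R x) + t (c *\<^sub>R x) = \<bar>c\<bar> * (s x + t x)" using that by (simp add: seminormD(2) algebra_simps)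
    show "s (x + y) + t (x + y) \<le> s x + t x + (s y + t y)"
      using seminormD(3)[OF that(1), of x y] seminormD(3)[OF that(2), of x y] by simp
  qed
  show "seminorm (\<lambda>v. bnx G v + bny G v)" "seminorm (\<lambda>v. cnx G v + cny G v)"
    by (intro sum frame_seminorms G)+
  have "v = 0" if "proj_x G v = 0" "proj_y G v = 0"
    using that proj_simps(7)[of G v] by simp
  then show "bnx G v + bny G v = 0 \<Longrightarrow> v = 0" "cnx G v + cny G v = 0 \<Longrightarrow> v = 0"
    using seminormD(1)[OF frame_seminorms(1)[OF G], of v] seminormD(1)[OF frame_seminorms(2)[OF G], of v]
      seminormD(1)[OF frame_seminorms(3)[OF G], of v] seminormD(1)[OF frame_seminorms(4)[OF G], of v]
      frame_zero[OF G, of v] by (auto simp: add_nonneg_eq_0_iff)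
qed

lemma Bx_iff: "x \<in> Bx G \<longleftrightarrow> x \<in> xspace G \<and> bnx G x \<le> 1"
  and bdBx_iff: "x \<in> bdBx G \<longleftrightarrow> x \<in> xspace G \<and> bnx G x = 1"
  by (auto simp: Bx_def bdBx_def bnx_def)

lemma By_iff: "y \<in> By G \<longleftrightarrow> y \<in> yspace G \<and> bny G y \<le> 1"
  and bdBy_iff: "y \<in> bdBy G \<longleftrightarrow> y \<in> yspace G \<and> bny G y = 1"
  by (auto simp: By_def bdBy_def bny_def)

lemma xy_prod_iff:
  assumes "X \<subseteq> xspace G" "Y \<subseteq> yspace G"
  shows "v \<in> xy_prod X Y \<longleftrightarrow> proj_x G v \<in> X \<and> proj_y G v \<in> Y"
proof
  assume "proj_x G v \<in> X \<and> proj_y G v \<in> Y"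
  then show "v \<in> xy_prod X Y"
    unfolding xy_prod_def by (intro CollectI exI[of _ "proj_x G v"] exI[of _ "proj_y G v"]) simp
qed (use assms in \<open>auto simp: xy_prod_def proj_add subset_iff\<close>)

lemma bn_proj [simp]:
  "bnx G (proj_x G v) = bnx G v" "bny G (proj_y G v) = bny G v"
  by (simp_all add: bnx_def bny_def)

lemma proj_Bx_iff [simp]:
  "proj_x G v \<in> Bx G \<longleftrightarrow> bnx G v \<le> 1" "proj_x G v \<in> bdBx G \<longleftrightarrow> bnx G v = 1"
  "proj_y G v \<in> By G \<longleftrightarrow> bny G v \<le> 1" "proj_y G v \<in> bdBy G \<longleftrightarrow> bny G v = 1"
  by (simp_all add: Bx_iff bdBx_iff By_iff bdBy_iff)

lemma unit_box_iff: "v \<in> unit_box G \<longleftrightarrow> bnx G v \<le> 1 \<and> bny G v \<le> 1"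
  unfolding unit_box_def by (subst xy_prod_iff[of _ G]) (auto simp: Bx_iff By_iff)

lemma exit_box_iff: "v \<in> xy_prod (bdBx G) (By G) \<longleftrightarrow> bnx G v = 1 \<and> bny G v \<le> 1"
  by (subst xy_prod_iff[of _ G]) (auto simp: bdBx_iff By_iff)

lemma entry_box_iff: "v \<in> xy_prod (Bx G) (bdBy G) \<longleftrightarrow> bnx G v \<le> 1 \<and> bny G v = 1"
  by (subst xy_prod_iff[of _ G]) (auto simp: bdBy_iff Bx_iff)

lemma bn_continuous:
  assumes "is_frame G" shows "continuous_on S (bnx G)" "continuous_on S (bny G)"
  by (simp_all add: seminorm_continuous frame_seminorms assms)

lemma unit_box_compact: assumes G: "is_frame G" shows "compact (unit_box G)"
proof -
  obtain B where B: "B > 0" "\<And>v. norm v \<le> B * (bnx G v + bny G v)"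
    using norm_lower_bound[OF frame_norm_sum(1,2)[OF G]] by blast
  have "norm v \<le> B * 2" if "v \<in> unit_box G" for v
  proof -
    have "B * (bnx G v + bny G v) \<le> B * 2" using that B(1) by (intro mult_left_mono) (auto simp: unit_box_iff)
    then show ?thesis using B(2)[of v] by simp
  qed
  then have "bounded (unit_box G)" by (auto simp: bounded_iff)
  moreover have "unit_box G = {v. bnx G v \<le> 1} \<inter> {v. bny G v \<le> 1}" by (auto simp: unit_box_iff)
  then have "closed (unit_box G)"
    by (simp add: closed_Int closed_Collect_le bn_continuous[OF G])
  ultimately show ?thesis by (simp add: compact_eq_bounded_closed)
qed

lemma seminorm_convex_sublevel: assumes s: "seminorm s" shows "convex {v. s v \<le> 1}"
proof (rule convexI, clarsimp)
  fix x y :: 'a and u v :: real assume *: "s x \<le> 1" "s y \<le> 1" "0 \<le> u" "0 \<le> v" "u + v = 1"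
  have "s (u *\<^sub>R x + v *\<^sub>R y) \<le> s (u *\<^sub>R x) + s (v *\<^sub>R y)" by (rule seminormD[OF s])
  also have "\<dots> = u * s x + v * s y" using * by (simp add: seminormD(2)[OF s])
  also have "\<dots> \<le> u * 1 + v * 1" using * by (intro add_mono mult_left_mono) auto
  finally show "s (u *\<^sub>R x + v *\<^sub>R y) \<le> 1" using * by simp
qed

lemma unit_box_convex: assumes G: "is_frame G" shows "convex (unit_box G)"
proof -
  have "unit_box G = {v. bnx G v \<le> 1} \<inter> {v. bny G v \<le> 1}" by (auto simp: unit_box_iff)
  then show ?thesis by (simp add: convex_Int seminorm_convex_sublevel frame_seminorms[OF G])
qed

lemma unit_box_interiorI:
  assumes G: "is_frame G" and "bnx G v < 1" "bny G v < 1"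
  shows "v \<in> interior (unit_box G)"
proof (rule interiorI)
  show "open ({v. bnx G v < 1} \<inter> {v. bny G v < 1})"
    by (intro open_Int open_Collect_less bn_continuous[OF G]) auto
qed (use assms in \<open>auto simp: unit_box_iff\<close>)

section \<open>Covering relations propagate horizontal disks\<close>

lemma is_hsetD:
  assumes "is_hset G N"
  shows "bij (chart N)" "continuous_on S (chart N)" "continuous_on S (inv (chart N))"
    "chart N ` carr N = unit_box G" "compact (carr N)"
    "z \<in> carr N \<longleftrightarrow> chart N z \<in> unit_box G" "inv (chart N) (chart N z) = z" "chart N (inv (chart N) w) = w"
proof -
  obtain g where g: "homeomorphism UNIV UNIV (chart N) g" using assms by (auto simp: is_hset_def)
  then have gi: "\<And>z. g (chart N z) = z" "\<And>w. chart N (g w) = w" by (auto simp: homeomorphism_def)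
  then have "inv (chart N) = g" by (rule inv_equality)
  then show inv: "inv (chart N) (chart N z) = z" "chart N (inv (chart N) w) = w" for z w using gi by auto
  show "bij (chart N)" by (rule bijI[OF inj_on_inverseI surjI]) (rule gi)+
  show "continuous_on S (chart N)" "continuous_on S (inv (chart N))"
    using g \<open>inv (chart N) = g\<close> by (auto simp: homeomorphism_def elim: continuous_on_subset)
  show box: "chart N ` carr N = unit_box G" "compact (carr N)" using assms by (auto simp: is_hset_def)
  show "z \<in> carr N \<longleftrightarrow> chart N z \<in> unit_box G"
    using inj_image_mem_iff[of "chart N" z "carr N"] inj_on_inverseI[of UNIV "inv (chart N)" "chart N"] inv(1) box(1)
    by simp
qed

lemma chart_cone_iff: "q \<in> chart_cone G w \<longleftrightarrow> cny G (q - w) < cnx G (q - w)"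
  by (simp add: chart_cone_def cnx_def cny_def proj_diff)

text \<open>Describes a disk as a point set, without its graph function: image disks arise as sets.
  The cone condition alone makes such a set a graph and its function Lipschitz.\<close>

lemma horizontal_disk_iff:
  assumes G: "is_frame G"
  shows "horizontal_disk G N D \<longleftrightarrow> chart N ` D \<subseteq> unit_box G \<and> (\<forall>\<xi>\<in>Bx G. \<exists>w\<in>chart N ` D. proj_x G w = \<xi>) \<and>
    (\<forall>w1\<in>chart N ` D. \<forall>w2\<in>chart N ` D. w1 \<noteq> w2 \<longrightarrow> cny G (w1 - w2) < cnx G (w1 - w2))"
    (is "?L \<longleftrightarrow> ?R")
proof
  assume ?L
  then obtain h where "continuous_on (Bx G) h"
    and h: "h ` Bx G \<subseteq> By G" "chart N ` D = {x + h x | x. x \<in> Bx G}"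
      "\<forall>x1\<in>Bx G. \<forall>x2\<in>Bx G. x1 \<noteq> x2 \<longrightarrow> x1 + h x1 \<in> chart_cone G (x2 + h x2)"
    unfolding horizontal_disk_def by (elim exE conjE)
  have hB: "h x \<in> yspace G" "bny G (h x) \<le> 1" if "x \<in> Bx G" for x using h(1) that by (auto simp: By_iff)
  have 1: "proj_x G (x + h x) = x" "x + h x \<in> unit_box G" if "x \<in> Bx G" for x
    using that hB[OF that] by (auto simp: proj_add Bx_iff unit_box_iff bnx_def bny_def)
  show ?R
  proof (intro conjI ballI impI)
    show "chart N ` D \<subseteq> unit_box G" unfolding h(2) using 1 by auto
    show "\<exists>w\<in>chart N ` D. proj_x G w = \<xi>" if "\<xi> \<in> Bx G" for \<xi>
      unfolding h(2) using 1(1)[OF that] that by blast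
    fix w1 w2 assume "w1 \<in> chart N ` D" "w2 \<in> chart N ` D" "w1 \<noteq> w2"
    then obtain x1 x2 where "x1 \<in> Bx G" "x2 \<in> Bx G" "w1 = x1 + h x1" "w2 = x2 + h x2" "x1 \<noteq> x2"
      unfolding h(2) by blast
    then show "cny G (w1 - w2) < cnx G (w1 - w2)" using h(3) by (simp add: chart_cone_iff)
  qed
next
  assume R: ?R
  then have box: "chart N ` D \<subseteq> unit_box G" and ex: "\<forall>\<xi>\<in>Bx G. \<exists>w\<in>chart N ` D. proj_x G w = \<xi>"
    and cone: "\<forall>w1\<in>chart N ` D. \<forall>w2\<in>chart N ` D. w1 \<noteq> w2 \<longrightarrow> cny G (w1 - w2) < cnx G (w1 - w2)"
    by simp_all
  have "\<forall>\<xi>\<in>Bx G. \<exists>w. w \<in> chart N ` D \<and> proj_x G w = \<xi>" using ex by blast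
  then obtain p where "\<forall>\<xi>\<in>Bx G. p \<xi> \<in> chart N ` D \<and> proj_x G (p \<xi>) = \<xi>" by (rule bchoice[THEN exE])
  then have p: "\<And>\<xi>. \<xi> \<in> Bx G \<Longrightarrow> p \<xi> \<in> chart N ` D" "\<And>\<xi>. \<xi> \<in> Bx G \<Longrightarrow> proj_x G (p \<xi>) = \<xi>"
    by blast+
  define h where "h \<xi> = proj_y G (p \<xi>)" for \<xi>
  have ph: "p \<xi> = \<xi> + h \<xi>" if "\<xi> \<in> Bx G" for \<xi>
    using proj_simps(7)[of G "p \<xi>"] p(2)[OF that] by (simp add: h_def)
  \<comment> \<open>Two distinct points over the same x-coordinate would have \<open>cnx\<close>
    distance 0 and hence negative \<open>cny\<close> distance.\<close>
  have uniq: "w = p (proj_x G w)" if w: "w \<in> chart N ` D" for w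
  proof (rule ccontr)
    have B: "proj_x G w \<in> Bx G" using box w by (auto simp: unit_box_iff)
    assume "w \<noteq> p (proj_x G w)"
    then have "cny G (w - p (proj_x G w)) < cnx G (w - p (proj_x G w))" using cone w p(1)[OF B] by blast
    moreover have "cnx G (w - p (proj_x G w)) = 0" using frame_zero(3)[OF G] p(2)[OF B] by (simp add: proj_diff)
    ultimately show False using seminormD(1)[OF frame_seminorms(4)[OF G]] by (metis leD)
  qed
  have D: "chart N ` D = {x + h x | x. x \<in> Bx G}"
  proof (intro equalityI subsetI)
    fix w assume w: "w \<in> chart N ` D"
    have B: "proj_x G w \<in> Bx G" using box w by (auto simp: unit_box_iff)
    then show "w \<in> {x + h x | x. x \<in> Bx G}" using uniq[OF w] ph[OF B] by auto
  qed (use p(1) ph in force)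
  have cone': "x1 + h x1 \<in> chart_cone G (x2 + h x2)" if "x1 \<in> Bx G" "x2 \<in> Bx G" "x1 \<noteq> x2" for x1 x2
  proof -
    have "p x1 \<noteq> p x2" using p(2) that by metis
    then have "cny G (p x1 - p x2) < cnx G (p x1 - p x2)"
      by (rule cone[rule_format, OF p(1)[OF that(1)] p(1)[OF that(2)]])
    then show ?thesis by (simp only: chart_cone_iff ph that)
  qed
  obtain B where B: "B > 0" "\<And>v. norm v \<le> B * (cnx G v + cny G v)"
    using norm_lower_bound[OF frame_norm_sum(3,4)[OF G]] by blast
  obtain B' where B': "B' > 0" "\<And>v. cnx G v \<le> B' * norm v"
    using seminorm_upper_bound[OF frame_seminorms(3)[OF G]] by blast
  have lip: "norm (h x1 - h x2) \<le> B * B' * norm (x1 - x2)" if x: "x1 \<in> Bx G" "x2 \<in> Bx G" for x1 x2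
  proof (cases "x1 = x2")
    case False
    have xs: "x1 \<in> xspace G" "x2 \<in> xspace G" using x by (auto simp: Bx_iff)
    have hy: "h x1 - h x2 \<in> yspace G" by (simp add: h_def subspace_diff yspace_subspace)
    have "cny G (x1 + h x1 - (x2 + h x2)) < cnx G (x1 + h x1 - (x2 + h x2))"
      using cone'[OF x False] by (simp add: chart_cone_iff)
    then have "cny G (h x1 - h x2) < cnx G (x1 - x2)"
      using xs by (simp add: cnx_def cny_def proj_diff proj_add h_def)
    moreover have "cnx G (h x1 - h x2) = 0" using hy by (simp add: frame_zero[OF G])
    ultimately have "B * (cnx G (h x1 - h x2) + cny G (h x1 - h x2)) \<le> B * (B' * norm (x1 - x2))"
      using B(1) B'(2)[of "x1 - x2"] by (intro mult_left_mono) auto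
    then show ?thesis using B(2)[of "h x1 - h x2"] by simp
  qed simp
  have "(B * B')-lipschitz_on (Bx G) h"
    using lip B(1) B'(1) by (intro lipschitz_onI) (auto simp: dist_norm)
  then have "continuous_on (Bx G) h" by (rule lipschitz_on_continuous_on)
  moreover have "h ` Bx G \<subseteq> By G"
  proof safe
    fix \<xi> assume "\<xi> \<in> Bx G"
    then have "p \<xi> \<in> unit_box G" using p(1) box by blast
    then show "h \<xi> \<in> By G" by (simp add: h_def unit_box_iff)
  qed
  ultimately show ?L unfolding horizontal_disk_def using D cone' by blast
qed

lemma horizontal_disk_subset:
  "is_frame G \<Longrightarrow> is_hset G N \<Longrightarrow> horizontal_disk G N D \<Longrightarrow> D \<subseteq> carr N"
  by (auto simp: horizontal_disk_iff is_hsetD(6))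

lemma horizontal_disk_nonempty:
  assumes "is_frame G" "horizontal_disk G N D" shows "D \<noteq> {}"
proof -
  have "0 \<in> Bx G" using assms(1)
    by (simp add: Bx_iff seminormD(4)[OF frame_seminorms(1)] subspace_0 xspace_subspace)
  then show ?thesis using assms by (auto simp: horizontal_disk_iff)
qed

text \<open>The flat disk \<open>y = 0\<close> in chart coordinates.\<close>

lemma horizontal_disk_exists:
  assumes G: "is_frame G" and N: "is_hset G N"
  shows "\<exists>D. horizontal_disk G N D"
proof
  have "chart N ` inv (chart N) ` Bx G = Bx G" using is_hsetD(8)[OF N] by (simp add: image_image)
  then show "horizontal_disk G N (inv (chart N) ` Bx G)"
    unfolding horizontal_disk_iff[OF G]
  proof (simp only:, intro conjI ballI impI)
    have y0: "bny G x = 0" "cny G x = 0" if "x \<in> xspace G" for x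
      using that by (simp_all add: frame_zero[OF G])
    show "Bx G \<subseteq> unit_box G" using y0 by (auto simp: Bx_iff unit_box_iff)
    show "\<exists>w\<in>Bx G. proj_x G w = \<xi>" if "\<xi> \<in> Bx G" for \<xi> using that by (force simp: Bx_iff)
    fix x y assume xy: "x \<in> Bx G" "y \<in> Bx G" "x \<noteq> y"
    then have d: "x - y \<in> xspace G" by (auto simp: Bx_iff intro: subspace_diff[OF xspace_subspace])
    have "cnx G (x - y) \<noteq> 0" using frame_zero(3)[OF G, of "x - y"] d xy(3) by simp
    then show "cny G (x - y) < cnx G (x - y)"
      using y0(2)[OF d] seminormD(1)[OF frame_seminorms(3)[OF G], of "x - y"] by simp
  qed
qed

text \<open>A substitute for the homotopy invariance of the degree. Without a zero of
  \<open>H 0\<close> one could freeze the homotopy near its zeros, obtain a map that avoids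
  \<open>v0\<close> and is the identity on the frontier, and project it from \<open>v0\<close> to
  retract \<open>X\<close> onto its frontier.\<close>

lemma convex_no_zero_homotopy:
  fixes X :: "'a::euclidean_space set" and H :: "real \<Rightarrow> 'a \<Rightarrow> 'a"
  assumes X: "compact X" "convex X" and Fr: "closed Fr" "Fr \<subseteq> X" "frontier X \<subseteq> Fr"
    and cont: "continuous_on ({0..1} \<times> X) (\<lambda>(t, v). H t v)"
    and nz: "\<And>t v. t \<in> {0..1} \<Longrightarrow> v \<in> Fr \<Longrightarrow> H t v \<noteq> 0"
    and L: "linear L" "inj L" and H1: "\<And>v. v \<in> X \<Longrightarrow> H 1 v = L (v - v0)" and v0: "v0 \<in> interior X"
  shows "\<exists>v\<in>X. H 0 v = 0"
proof (rule ccontr)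
  assume "\<not> ?thesis"
  then have no: "H 0 v \<noteq> 0" if "v \<in> X" for v using that by blast
  define C where "C = snd ` {p \<in> {0..1} \<times> X. (\<lambda>(t, v). H t v) p = 0}"
  have "compact {p \<in> {0..1} \<times> X. (\<lambda>(t, v). H t v) p = 0}"
  proof -
    have c: "compact ({0..1::real} \<times> X)" by (intro compact_Times X) auto
    have "closedin (top_of_set ({0..1} \<times> X)) ({0..1} \<times> X \<inter> (\<lambda>(t, v). H t v) -` {0})"
      by (intro continuous_closedin_preimage cont) auto
    moreover have "{0..1} \<times> X \<inter> (\<lambda>(t, v). H t v) -` {0} = {p \<in> {0..1} \<times> X. (\<lambda>(t, v). H t v) p = 0}" by auto
    ultimately show ?thesis using closedin_compact[OF c] by simp
  qed
  then have "compact C" unfolding C_def by (intro compact_continuous_image continuous_on_snd continuous_on_id)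
  moreover have "C \<inter> Fr = {}" using nz by (auto simp: C_def)
  \<comment> \<open>\<open>C\<close> collects the points that are zeros at some time. With
    \<open>u = 0\<close> on \<open>C\<close> and \<open>u = 1\<close> on \<open>Fr\<close>, the map
    \<open>H (u v) v\<close> could vanish only where \<open>H 0\<close> does, and on
    \<open>Fr\<close> it is the affine map \<open>H 1\<close>.\<close>
  ultimately obtain u :: "'a \<Rightarrow> real" where u: "continuous_on UNIV u" "\<And>x. u x \<in> closed_segment 0 1"
    "\<And>x. x \<in> C \<Longrightarrow> u x = 0" "\<And>x. x \<in> Fr \<Longrightarrow> u x = 1"
    using Urysohn[of C Fr 0 "1::real"] Fr(1) compact_imp_closed by metis
  have u01: "u x \<in> {0..1}" for x using u(2)[of x] by (simp add: closed_segment_eq_real_ivl)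
  define g where "g v = H (u v) v" for v
  have "continuous_on X (\<lambda>v. (\<lambda>(t, v). H t v) (u v, v))"
    using u01 by (intro continuous_on_compose2[OF cont] continuous_on_Pair continuous_on_subset[OF u(1)] continuous_on_id) auto
  then have contg: "continuous_on X g" by (simp add: g_def)
  have g0: "g v \<noteq> 0" if v: "v \<in> X" for v
  proof
    assume "g v = 0"
    then have "(u v, v) \<in> {p \<in> {0..1} \<times> X. (\<lambda>(t, v). H t v) p = 0}" using v u01[of v] by (auto simp: g_def)
    then have "snd (u v, v) \<in> C" unfolding C_def by (rule imageI)
    then have "u v = 0" using u(3) by simp
    then show False using \<open>g v = 0\<close> no[OF v] by (simp add: g_def)
  qed
  obtain L' where L': "linear L'" "\<And>v. L' (L v) = v" "\<And>v. L (L' v) = v"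
    using linear_injective_isomorphism[OF L] by metis
  define \<psi> where "\<psi> v = v0 + L' (g v)" for v
  have "continuous_on X \<psi>" unfolding \<psi>_def
    by (intro continuous_intros linear_continuous_on_compose[OF contg L'(1)])
  have \<psi>0: "\<psi> v \<noteq> v0" if "v \<in> X" for v
    using g0[OF that] L'(3)[of "g v"] linear_0[OF L(1)] by (auto simp: \<psi>_def)
  have \<psi>1: "\<psi> v = v" if "v \<in> Fr" for v
    using that Fr(2) u(4) H1 L'(2) by (auto simp: \<psi>_def g_def)
  have ne: "interior X \<noteq> {}" using v0 by auto
  have "affine hull X = UNIV" by (rule affine_hull_nonempty_interior[OF ne])
  then have ri: "affine hull X = UNIV" "rel_interior X = interior X" "rel_frontier X = frontier X"
    using rel_interior_interior rel_frontier_nonempty_interior[OF ne] by auto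
  have "rel_frontier X retract_of (affine hull X - {v0})"
    using X v0 ri by (intro rel_frontier_retract_of_punctured_affine_hull compact_imp_bounded) auto
  then have "frontier X retract_of (UNIV - {v0})" using ri by simp
  then obtain r where r: "retraction (UNIV - {v0}) (frontier X) r" by (auto simp: retract_of_def)
  have "X \<subseteq> frontier X"
  proof (rule frontier_subset_retraction[of X "frontier X" "r \<circ> \<psi>"])
    show "bounded X" using X by (simp add: compact_imp_bounded)
    have cl: "closure X = X" using X by (simp add: compact_imp_closed)
    have "continuous_on (UNIV - {v0}) r" using r by (simp add: retraction_def)
    then have "continuous_on (\<psi> ` X) r" by (rule continuous_on_subset) (use \<psi>0 in auto)
    then show "continuous_on (closure X) (r \<circ> \<psi>)"
      unfolding cl by (rule continuous_on_compose[OF \<open>continuous_on X \<psi>\<close>])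
    show "r \<circ> \<psi> \<in> X \<rightarrow> frontier X" using r \<psi>0 by (auto simp: retraction_def Pi_iff)
    show "(r \<circ> \<psi>) x = x" if "x \<in> frontier X" for x
      using r \<psi>1[of x] Fr(3) that by (auto simp: retraction_def)
  qed auto
  then show False using v0 interior_subset[of X] by (auto simp: frontier_def)
qed

text \<open>
  Subtracting also the vertical coordinate turns the exit and entry conditions into the single
  condition that the homotopy has no zeros on the boundary of the box.
\<close>

lemma covering_meets_fibre:
  assumes G: "is_frame G" and N: "is_hset G N" and N': "is_hset G N'"
    and cov: "f_covers G f N N'" and D: "horizontal_disk G N D" and x': "x' \<in> Bx G"
  obtains z where "z \<in> D" "f z \<in> carr N'" "proj_x G (chart N' (f z)) = x'"
proof -
  obtain \<sigma> A where cont: "continuous_on ({0..1::real} \<times> unit_box G) (\<lambda>(t, v). \<sigma> t v)"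
    and \<sigma>0: "\<forall>v\<in>unit_box G. \<sigma> 0 v = (chart N' \<circ> f \<circ> inv (chart N)) v"
    and ex: "\<forall>t\<in>{0..1}. \<sigma> t ` (chart N ` exit_set G N) \<inter> unit_box G = {}"
    and en: "\<forall>t\<in>{0..1}. \<sigma> t ` unit_box G \<inter> chart N' ` entry_set G N' = {}"
    and A: "linear A" "A ` xspace G \<subseteq> xspace G"
    and \<sigma>1: "\<forall>v\<in>unit_box G. \<sigma> 1 v = A (proj_x G v)"
    and Abd: "A ` bdBx G \<subseteq> xspace G - Bx G"
    using cov unfolding f_covers_def by (elim exE conjE)
  have exit: "bnx G (\<sigma> t v) > 1 \<or> bny G (\<sigma> t v) > 1"
    if "t \<in> {0..1}" "v \<in> unit_box G" "bnx G v = 1" for t v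
  proof -
    have "v \<in> chart N ` exit_set G N"
      using that is_hsetD(8)[OF N] by (simp add: exit_set_def image_image exit_box_iff unit_box_iff)
    then have "\<sigma> t v \<notin> unit_box G" using ex that(1) by blast
    then show ?thesis by (auto simp: unit_box_iff)
  qed
  have entry: "\<not> (bnx G (\<sigma> t v) \<le> 1 \<and> bny G (\<sigma> t v) = 1)" if "t \<in> {0..1}" "v \<in> unit_box G" for t v
  proof
    assume "bnx G (\<sigma> t v) \<le> 1 \<and> bny G (\<sigma> t v) = 1"
    then have "\<sigma> t v \<in> chart N' ` entry_set G N'"
      using is_hsetD(8)[OF N'] by (simp add: entry_set_def image_image entry_box_iff)
    then show False using en that by blast
  qed
  obtain h where h: "continuous_on (Bx G) h" "h ` Bx G \<subseteq> By G" "chart N ` D = {x + h x | x. x \<in> Bx G}"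
    using D unfolding horizontal_disk_def by (elim exE conjE)
  \<comment> \<open>Moves a point of the box vertically onto the disk. All \<open>n\<close>
    coordinates of \<open>v\<close> are kept, so that the zero problem is one between spaces of
    equal dimension.\<close>
  define e where "e v = proj_x G v + h (proj_x G v)" for v
  have hB: "h x \<in> yspace G" "bny G (h x) \<le> 1" if "x \<in> Bx G" for x using h(2) that by (auto simp: By_iff)
  have e: "e v \<in> unit_box G" "bnx G (e v) = bnx G v" "proj_x G (e v) = proj_x G v" if "v \<in> unit_box G" for v
  proof -
    have x: "proj_x G v \<in> Bx G" using that by (simp add: unit_box_iff)
    show 1: "proj_x G (e v) = proj_x G v" using hB(1)[OF x] by (simp add: e_def proj_add)
    show "bnx G (e v) = bnx G v" by (simp add: bnx_def 1)
    moreover have "bny G (e v) = bny G (h (proj_x G v))" by (simp add: bny_def e_def proj_add)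
    ultimately show "e v \<in> unit_box G" using hB(2)[OF x] that by (simp add: unit_box_iff)
  qed
  define H where "H t v = \<sigma> t (e v) - x' - proj_y G v" for t v
  define L where "L v = A (proj_x G v) - proj_y G v" for v
  have Ax: "A x \<in> xspace G" if "x \<in> xspace G" for x using A(2) that by blast
  \<comment> \<open>By homogeneity, sending the unit sphere outside the closed ball means strict
    expansion. It gives injectivity of \<open>L\<close> and puts the preimage \<open>v0\<close> of
    \<open>x'\<close> into the interior of the box.\<close>
  have expand: "bnx G x < bnx G (A x)" if x: "x \<in> xspace G" "x \<noteq> 0" for x
  proof -
    note s = frame_seminorms(1)[OF G]
    have pos: "bnx G x > 0"
      using frame_zero(1)[OF G, of x] seminormD(1)[OF s, of x] x by fastforce
    then have "x /\<^sub>R bnx G x \<in> bdBx G" using x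
      by (simp add: bdBx_iff subspace_scale xspace_subspace seminormD(2)[OF s])
    then have "A (x /\<^sub>R bnx G x) \<in> xspace G - Bx G" using Abd by blast
    then have "bnx G (A (x /\<^sub>R bnx G x)) > 1" by (auto simp: Bx_iff)
    then show ?thesis using pos by (simp add: linear_scale[OF A(1)] seminormD(2)[OF s] field_simps)
  qed
  have linL: "linear L" unfolding L_def
    by (intro linear_compose_sub linear_compose[OF proj_linear(1) A(1), unfolded o_def] proj_linear)
  have injL: "inj L"
  proof (subst linear_injective_0[OF linL], intro allI impI)
    fix v assume "L v = 0"
    then have eq: "A (proj_x G v) = proj_y G v" by (simp add: L_def)
    then have "proj_y G v \<in> xspace G" using Ax[of "proj_x G v"] by simp
    then have "proj_y G (proj_y G v) = 0" by (rule proj_simps(5))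
    then have y: "proj_y G v = 0" by simp
    then have "proj_x G v = 0"
      using expand[of "proj_x G v"] eq seminormD(1,4)[OF frame_seminorms(1)[OF G]]
      by (metis proj_simps(1) not_less)
    then show "v = 0" using y proj_simps(7)[of G v] by simp
  qed
  obtain v0 where v0: "L v0 = x'" using linear_injective_imp_surjective[OF linL injL] by (metis surjD)
  have xx': "x' \<in> xspace G" "bnx G x' \<le> 1" using x' by (auto simp: Bx_iff)
  have y0: "proj_y G v0 = 0"
    using arg_cong[OF v0, of "proj_y G"] xx' Ax[of "proj_x G v0"] by (simp add: L_def proj_diff)
  then have x0: "A (proj_x G v0) = x'" using v0 by (simp add: L_def)
  have b0: "bnx G v0 < 1"
  proof (cases "proj_x G v0 = 0")
    case True
    then show ?thesis using frame_zero(1)[OF G, of v0] by simp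
  next
    case False
    then have "bnx G (proj_x G v0) < bnx G x'" using expand[of "proj_x G v0"] x0 by simp
    then show ?thesis using xx'(2) by simp
  qed
  have v0i: "v0 \<in> interior (unit_box G)"
    using b0 y0 frame_zero(2)[OF G, of v0] by (intro unit_box_interiorI G) simp_all
  let ?Fr = "unit_box G \<inter> ({v. bnx G v = 1} \<union> {v. bny G v = 1})"
  have "\<exists>v\<in>unit_box G. H 0 v = 0"
  proof (rule convex_no_zero_homotopy[of "unit_box G" ?Fr H L v0])
    show "compact (unit_box G)" "convex (unit_box G)" by (intro unit_box_compact unit_box_convex G)+
    show "closed ?Fr"
      by (intro closed_Int closed_Un closed_Collect_eq bn_continuous[OF G] continuous_on_const
          compact_imp_closed unit_box_compact G)
    show "frontier (unit_box G) \<subseteq> ?Fr"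
    proof
      fix v assume "v \<in> frontier (unit_box G)"
      then have "v \<in> unit_box G" "v \<notin> interior (unit_box G)"
        using compact_imp_closed[OF unit_box_compact[OF G]] by (auto simp: frontier_def)
      then show "v \<in> ?Fr" using unit_box_interiorI[OF G, of v] by (force simp: unit_box_iff)
    qed
    have "continuous_on (unit_box G) e" unfolding e_def
      by (intro continuous_intros proj_continuous continuous_on_compose2[OF h(1)]) (auto simp: unit_box_iff)
    then have "continuous_on ({0..1::real} \<times> unit_box G) (\<lambda>p. (\<lambda>(t, v). \<sigma> t v) (fst p, e (snd p)))"
      by (intro continuous_on_compose2[OF cont] continuous_intros
          continuous_on_compose2[of "unit_box G" e _ snd]) (auto simp: e)
    then have "continuous_on ({0..1::real} \<times> unit_box G) (\<lambda>p. \<sigma> (fst p) (e (snd p)) - x' - proj_y G (snd p))"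
      by (intro continuous_intros continuous_on_compose2[OF proj_continuous(2)]) auto
    then show "continuous_on ({0..1} \<times> unit_box G) (\<lambda>(t, v). H t v)" by (simp add: H_def case_prod_unfold)
    \<comment> \<open>At a zero the image has x-part \<open>x'\<close> and the y-part of
      \<open>v\<close>, so it lies in the box. This contradicts \<open>exit\<close> if
      \<open>bnx G v = 1\<close> and \<open>entry\<close> if \<open>bny G v = 1\<close>.\<close>
    show "H t v \<noteq> 0" if t: "t \<in> {0..1}" and v: "v \<in> ?Fr" for t v
    proof
      assume "H t v = 0"
      then have eq: "\<sigma> t (e v) = x' + proj_y G v" by (simp add: H_def algebra_simps)
      have "bnx G (\<sigma> t (e v)) \<le> 1" "bny G (\<sigma> t (e v)) = bny G v"
        using xx' by (auto simp: eq bnx_def bny_def proj_add)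
      then show False using exit[OF t e(1), of v] entry[OF t e(1), of v] v e(2)[of v] by (auto simp: unit_box_iff)
    qed
    show "H 1 v = L (v - v0)" if "v \<in> unit_box G" for v
      using \<sigma>1 e[OF that] v0 by (simp add: H_def linear_diff[OF linL]) (simp add: L_def)
  qed (use linL injL v0i in auto)
  then obtain v where v: "v \<in> unit_box G" "H 0 v = 0" by blast
  have ev: "e v \<in> chart N ` D" using v(1) unfolding h(3) e_def by (auto simp: unit_box_iff)
  then obtain z where z: "z \<in> D" "e v = chart N z" by blast
  have eq: "chart N' (f z) = x' + proj_y G v"
    using v(2) \<sigma>0 e(1)[OF v(1)] z(2) is_hsetD(7)[OF N] by (simp add: H_def algebra_simps)
  then have "chart N' (f z) \<in> unit_box G"
    using xx' v(1) by (auto simp: unit_box_iff bnx_def bny_def proj_add)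
  then show ?thesis using that[OF z(1)] is_hsetD(6)[OF N'] eq xx' by (simp add: proj_add)
qed

text \<open>The covering supplies a point over every x-coordinate, the cone conditions supply the
  cone relation between points, and by \<open>horizontal_disk_iff\<close> this is already a
  disk.\<close>

lemma covering_image_disk:
  assumes G: "is_frame G" and N: "is_hset G N" and N': "is_hset G N'"
    and cov: "f_covers G f N N'" and cc: "cone_conditions G f N N'" and D: "horizontal_disk G N D"
  shows "horizontal_disk G N' (f ` D \<inter> carr N')"
  unfolding horizontal_disk_iff[OF G]
proof (intro conjI ballI impI)
  show "chart N' ` (f ` D \<inter> carr N') \<subseteq> unit_box G" using is_hsetD(6)[OF N'] by auto
  show "\<exists>w\<in>chart N' ` (f ` D \<inter> carr N'). proj_x G w = \<xi>" if \<xi>: "\<xi> \<in> Bx G" for \<xi>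
  proof -
    obtain z where "z \<in> D" "f z \<in> carr N'" "proj_x G (chart N' (f z)) = \<xi>"
      by (rule covering_meets_fibre[OF G N N' cov D \<xi>])
    then show ?thesis by blast
  qed
  fix w1 w2 assume "w1 \<in> chart N' ` (f ` D \<inter> carr N')" "w2 \<in> chart N' ` (f ` D \<inter> carr N')" "w1 \<noteq> w2"
  then obtain z1 z2 where z: "z1 \<in> D" "z2 \<in> D" "f z1 \<in> carr N'" "f z2 \<in> carr N'"
    "w1 = chart N' (f z1)" "w2 = chart N' (f z2)" "z1 \<noteq> z2" by blast
  have "chart N z1 \<noteq> chart N z2" using z(7) is_hsetD(7)[OF N] by metis
  then have "chart N z1 \<in> chart_cone G (chart N z2)"
    using D z(1,2) unfolding horizontal_disk_iff[OF G] chart_cone_iff by blast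
  then have "z1 \<in> cone_at G N z2" unfolding cone_at_def using is_hsetD(7)[OF N, of z1] by (metis imageI)
  moreover have "z2 \<in> carr N" using horizontal_disk_subset[OF G N D] z(2) by blast
  ultimately have "f z1 \<in> cone_at G N' (f z2)" using cc z(4) unfolding cone_conditions_def by blast
  then have "w1 \<in> chart_cone G w2" unfolding cone_at_def z(5,6) using is_hsetD(8)[OF N'] by auto
  then show "cny G (w1 - w2) < cnx G (w1 - w2)" by (simp add: chart_cone_iff)
qed

section \<open>Chain orbits stay in a compact part of the interior\<close>

text \<open>The homotopy at \<open>t = 0\<close> is \<open>f\<close> in coordinates, so its exit and
  entry conditions speak directly about the transition from \<open>z\<close> to
  \<open>f z\<close>.\<close>

lemma covering_exit:
  assumes G: "is_frame G" and N: "is_hset G N" and N': "is_hset G N'" and cov: "f_covers G f N N'"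
    and z: "z \<in> carr N" "f z \<in> carr N'"
  shows "bnx G (chart N z) < 1" "bny G (chart N' (f z)) < 1"
proof -
  obtain \<sigma> where \<sigma>0: "\<forall>v\<in>unit_box G. \<sigma> (0::real) v = (chart N' \<circ> f \<circ> inv (chart N)) v"
    and ex: "\<forall>t\<in>{0..1}. \<sigma> t ` (chart N ` exit_set G N) \<inter> unit_box G = {}"
    and en: "\<forall>t\<in>{0..1}. \<sigma> t ` unit_box G \<inter> chart N' ` entry_set G N' = {}"
    using cov unfolding f_covers_def by (elim exE conjE)
  have zb: "chart N z \<in> unit_box G" and fb: "chart N' (f z) \<in> unit_box G"
    using z is_hsetD(6)[OF N] is_hsetD(6)[OF N'] by auto
  have s: "\<sigma> 0 (chart N z) = chart N' (f z)" using \<sigma>0 zb is_hsetD(7)[OF N] by simp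
  have "bnx G (chart N z) \<noteq> 1"
  proof
    assume "bnx G (chart N z) = 1"
    then have "chart N z \<in> chart N ` exit_set G N"
      using zb is_hsetD(8)[OF N] by (simp add: exit_set_def image_image exit_box_iff unit_box_iff)
    then have "chart N' (f z) \<in> \<sigma> 0 ` (chart N ` exit_set G N)" using s by (metis imageI)
    moreover have "\<sigma> 0 ` (chart N ` exit_set G N) \<inter> unit_box G = {}" by (rule ex[rule_format]) simp
    ultimately show False using fb by blast
  qed
  then show "bnx G (chart N z) < 1" using zb by (auto simp: unit_box_iff)
  have "bny G (chart N' (f z)) \<noteq> 1"
  proof
    assume "bny G (chart N' (f z)) = 1"
    then have "chart N' (f z) \<in> chart N' ` entry_set G N'"
      using fb is_hsetD(8)[OF N'] by (simp add: entry_set_def image_image entry_box_iff unit_box_iff)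
    moreover have "chart N' (f z) \<in> \<sigma> 0 ` unit_box G" using s zb by (metis imageI)
    moreover have "\<sigma> 0 ` unit_box G \<inter> chart N' ` entry_set G N' = {}" by (rule en[rule_format]) simp
    ultimately show False by blast
  qed
  then show "bny G (chart N' (f z)) < 1" using fb by (auto simp: unit_box_iff)
qed

lemma hset_interiorI:
  assumes G: "is_frame G" and N: "is_hset G N" and "bnx G (chart N z) < 1" "bny G (chart N z) < 1"
  shows "z \<in> interior (carr N)"
proof (rule interiorI)
  show "open (chart N -` interior (unit_box G))"
    using is_hsetD(2)[OF N, of UNIV] by (simp add: open_vimage)
  show "z \<in> chart N -` interior (unit_box G)" using unit_box_interiorI[OF G] assms by simp
  show "chart N -` interior (unit_box G) \<subseteq> carr N"
    using interior_subset is_hsetD(6)[OF N] by fastforce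
qed

text \<open>\<open>B\<close> comes from the cone norms of the frame only, hence serves all h-sets
  and all disks at once.\<close>

lemma horizontal_disk_cone_dist:
  assumes G: "is_frame G"
  obtains B where "B > 0"
    "\<And>N D w1 w2. horizontal_disk G N D \<Longrightarrow> w1 \<in> chart N ` D \<Longrightarrow> w2 \<in> chart N ` D \<Longrightarrow>
       dist w1 w2 \<le> B * dist (proj_x G w1) (proj_x G w2)"
proof -
  obtain B where B: "B > 0" "\<And>v. norm v \<le> B * (cnx G v + cny G v)"
    using norm_lower_bound[OF frame_norm_sum(3,4)[OF G]] by blast
  obtain B' where B': "B' > 0" "\<And>v. cnx G v \<le> B' * norm v"
    using seminorm_upper_bound[OF frame_seminorms(3)[OF G]] by blast
  have "dist w1 w2 \<le> (B * (2 * B')) * dist (proj_x G w1) (proj_x G w2)"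
    if D: "horizontal_disk G N D" and w: "w1 \<in> chart N ` D" "w2 \<in> chart N ` D" for N D w1 w2
  proof (cases "w1 = w2")
    case False
    have "cny G (w1 - w2) < cnx G (w1 - w2)"
      using D w False unfolding horizontal_disk_iff[OF G] by blast
    moreover have "cnx G (w1 - w2) = cnx G (proj_x G w1 - proj_x G w2)"
      by (simp add: cnx_def proj_diff)
    ultimately have "cnx G (w1 - w2) + cny G (w1 - w2) \<le> 2 * B' * norm (proj_x G w1 - proj_x G w2)"
      using B'(2)[of "proj_x G w1 - proj_x G w2"] by simp
    then have "B * (cnx G (w1 - w2) + cny G (w1 - w2)) \<le> B * (2 * B' * norm (proj_x G w1 - proj_x G w2))"
      using B(1) by (intro mult_left_mono) auto
    then show ?thesis using B(2)[of "w1 - w2"] by (simp add: dist_norm mult_ac)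
  qed simp
  then show ?thesis using B(1) B'(1) that[of "B * (2 * B')"] by simp
qed

text \<open>
  A disk in N that cuts a full disk out of K projects onto a relatively open set containing
  the projections of the points of K away from the exit set, with uniform size since disks are graphs
  with uniformly bounded slope. Hence such points also stay away from the exit set of N.
\<close>

lemma subdisk_projection_ball:
  assumes G: "is_frame G" and N: "is_hset G N" and K: "is_hset G K"
    and D: "horizontal_disk G N D" "horizontal_disk G K (D \<inter> carr K)"
    and w: "w \<in> D \<inter> carr K" and wi: "bnx G (chart K w) < 1"
    and far: "\<And>v. v \<in> D \<inter> carr K \<Longrightarrow> bnx G (chart K v) = 1 \<Longrightarrow>
       \<rho> \<le> dist (proj_x G (chart N w)) (proj_x G (chart N v))"
    and x: "x \<in> xspace G" "dist x (proj_x G (chart N w)) < \<rho>"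
  shows "x \<in> Bx G"
proof -
  obtain h where h: "continuous_on (Bx G) h" "h ` Bx G \<subseteq> By G"
    "chart K ` (D \<inter> carr K) = {x + h x | x. x \<in> Bx G}"
    using D(2) unfolding horizontal_disk_def by (elim exE conjE)
  have hB: "h \<xi> \<in> yspace G" if "\<xi> \<in> Bx G" for \<xi> using h(2) that by (auto simp: By_iff)
  have px: "proj_x G (\<xi> + h \<xi>) = \<xi>" if "\<xi> \<in> Bx G" for \<xi>
    using hB[OF that] that by (simp add: proj_add Bx_iff)
  define p where "p \<xi> = inv (chart K) (\<xi> + h \<xi>)" for \<xi>
  have cp: "chart K (p \<xi>) = \<xi> + h \<xi>" for \<xi> using is_hsetD(8)[OF K] by (simp add: p_def)
  have pD: "p \<xi> \<in> D \<inter> carr K" if \<xi>: "\<xi> \<in> Bx G" for \<xi>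
  proof -
    have "\<xi> + h \<xi> \<in> chart K ` (D \<inter> carr K)" using h(3) \<xi> by blast
    then show ?thesis using is_hsetD(7)[OF K] by (auto simp: p_def)
  qed
  have Dp: "v = p (proj_x G (chart K v)) \<and> proj_x G (chart K v) \<in> Bx G" if v: "v \<in> D \<inter> carr K" for v
  proof -
    have "chart K v \<in> {x + h x | x. x \<in> Bx G}" using v h(3) by blast
    then obtain \<xi> where \<xi>: "\<xi> \<in> Bx G" "chart K v = \<xi> + h \<xi>" by blast
    then have "v = p \<xi>" using is_hsetD(7)[OF K, of v] by (simp add: p_def)
    then show ?thesis using px \<xi> by simp
  qed
  \<comment> \<open>Along the disk, \<open>\<phi>\<close> turns the x-coordinate in \<open>K\<close>
    into the x-coordinate in \<open>N\<close>. It is injective because the disk is a graph in both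
    charts.\<close>
  define \<phi> where "\<phi> \<xi> = proj_x G (chart N (p \<xi>))" for \<xi>
  have cont: "continuous_on (Bx G) \<phi>" unfolding \<phi>_def p_def
    by (intro continuous_on_compose2[OF proj_continuous(1)[of UNIV]] continuous_on_compose2[OF is_hsetD(2)[OF N, of UNIV]]
        continuous_on_compose2[OF is_hsetD(3)[OF K, of UNIV]] continuous_intros h) auto
  have inj: "inj_on \<phi> (Bx G)"
  proof (rule inj_onI)
    fix \<xi> \<zeta> assume \<xi>: "\<xi> \<in> Bx G" "\<zeta> \<in> Bx G" "\<phi> \<xi> = \<phi> \<zeta>"
    obtain B where "dist (chart N (p \<xi>)) (chart N (p \<zeta>)) \<le> B * dist (\<phi> \<xi>) (\<phi> \<zeta>)"
      using horizontal_disk_cone_dist[OF G] D(1) pD[OF \<xi>(1)] pD[OF \<xi>(2)] unfolding \<phi>_def by (metis IntE imageI)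
    then have "chart N (p \<xi>) = chart N (p \<zeta>)" using \<xi>(3) by simp
    then have "p \<xi> = p \<zeta>" using is_hsetD(7)[OF N] by metis
    then have "\<xi> + h \<xi> = \<zeta> + h \<zeta>" using cp by metis
    then show "\<xi> = \<zeta>" using px \<xi> by metis
  qed
  define O1 where "O1 = {\<xi> \<in> xspace G. bnx G \<xi> < 1}"
  have O1B: "O1 \<subseteq> Bx G" by (auto simp: O1_def Bx_iff)
  have \<phi>B: "\<phi> \<xi> \<in> Bx G" if "\<xi> \<in> Bx G" for \<xi>
  proof -
    have "p \<xi> \<in> carr N" using horizontal_disk_subset[OF G N D(1)] pD[OF that] by blast
    then show ?thesis using is_hsetD(6)[OF N] by (simp add: \<phi>_def unit_box_iff)
  qed
  have "openin (top_of_set (xspace G)) (\<phi> ` O1)"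
  proof (rule invariance_of_domain_subspaces[OF _ xspace_subspace xspace_subspace])
    have "open {\<xi>. bnx G \<xi> < 1}" by (intro open_Collect_less bn_continuous[OF G] continuous_on_const)
    then show "openin (top_of_set (xspace G)) O1"
      by (auto simp: O1_def openin_open Collect_conj_eq)
    show "\<phi> \<in> O1 \<rightarrow> xspace G" by (simp add: \<phi>_def)
  qed (use cont inj O1B in \<open>auto elim: continuous_on_subset inj_on_subset\<close>)
  then obtain T where T: "open T" "\<phi> ` O1 = xspace G \<inter> T" by (auto simp: openin_open)
  define b where "b = xspace G \<inter> ball (proj_x G (chart N w)) \<rho>"
  have "compact (Bx G)"
  proof -
    have "Bx G = unit_box G \<inter> xspace G"
    proof -
      have "bny G x = 0" if "x \<in> xspace G" for x using frame_zero(2)[OF G, of x] that by simp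
      then show ?thesis by (auto simp: Bx_iff unit_box_iff)
    qed
    then show ?thesis using compact_Int_closed[OF unit_box_compact[OF G] closed_subspace[OF xspace_subspace]] by simp
  qed
  then have "closed (\<phi> ` Bx G)" by (intro compact_imp_closed compact_continuous_image cont)
  \<comment> \<open>By \<open>far\<close>, boundary points of \<open>Bx G\<close> are sent outside
    \<open>b\<close>. Within \<open>b\<close> the closed image of \<open>Bx G\<close> therefore
    agrees with the relatively open image of \<open>O1\<close>, a clopen subset of a connected
    set.\<close>
  moreover have same: "b \<inter> \<phi> ` Bx G = b \<inter> \<phi> ` O1"
  proof -
    have "\<phi> \<xi> \<notin> b" if "\<xi> \<in> Bx G" "\<xi> \<notin> O1" for \<xi>
    proof -
      have "bnx G \<xi> = 1" using that by (auto simp: O1_def Bx_iff)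
      then have "bnx G (chart K (p \<xi>)) = 1" using px[OF that(1)] that(1) by (simp add: cp bnx_def Bx_iff)
      then have "\<rho> \<le> dist (proj_x G (chart N w)) (\<phi> \<xi>)" unfolding \<phi>_def by (rule far[OF pD[OF that(1)]])
      then show ?thesis by (simp add: b_def)
    qed
    then show ?thesis using O1B by blast
  qed
  ultimately have "closedin (top_of_set b) (b \<inter> \<phi> ` O1)" by (metis closedin_closed_Int)
  moreover have "b \<inter> \<phi> ` O1 = b \<inter> T" using T(2) by (auto simp: b_def)
  then have "openin (top_of_set b) (b \<inter> \<phi> ` O1)" using T(1) by (simp add: openin_open_Int)
  moreover have "connected b" unfolding b_def
    by (intro convex_connected convex_Int subspace_imp_convex xspace_subspace convex_ball)
  ultimately have "b \<inter> \<phi> ` O1 = {} \<or> b \<inter> \<phi> ` O1 = b" unfolding connected_clopen by blast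
  moreover have "proj_x G (chart N w) \<in> b \<inter> \<phi> ` O1"
  proof -
    have "proj_x G (chart K w) \<in> O1" using wi by (simp add: O1_def)
    then have "\<phi> (proj_x G (chart K w)) \<in> \<phi> ` O1" by (rule imageI)
    moreover have "\<phi> (proj_x G (chart K w)) = proj_x G (chart N w)" using Dp[OF w] by (simp add: \<phi>_def)
    moreover have "\<rho> > 0" using x(2) zero_le_dist[of x] by (metis le_less_trans)
    ultimately show ?thesis by (simp add: b_def)
  qed
  ultimately have "b \<subseteq> \<phi> ` O1" by blast
  moreover have "x \<in> b" using x by (simp add: b_def dist_commute)
  ultimately show ?thesis using O1B \<phi>B by blast
qed

text \<open>Points of \<open>K\<close> mapped into \<open>K'\<close> form a compact set with
  x-coordinates off the unit sphere, so at a distance \<open>d\<close> from it that no disk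
  influences. Uniform continuity of the chart change and the common slope bound turn
  \<open>d\<close> into a distance in the x-coordinates of \<open>N\<close>.\<close>

lemma subdisk_uniform:
  assumes G: "is_frame G" and N: "is_hset G N" and K: "is_hset G K" and K': "is_hset G K'"
    and cov: "f_covers G f K K'" and f: "continuous_on UNIV f"
  obtains \<rho> where "\<rho> > 0"
    "\<And>D w x. horizontal_disk G N D \<Longrightarrow> horizontal_disk G K (D \<inter> carr K) \<Longrightarrow> w \<in> D \<inter> carr K \<Longrightarrow>
      f w \<in> carr K' \<Longrightarrow> x \<in> xspace G \<Longrightarrow> dist x (proj_x G (chart N w)) < \<rho> \<Longrightarrow> x \<in> Bx G"
proof -
  let ?\<pi> = "\<lambda>v. proj_x G (chart K v)"
  define W where "W = carr K \<inter> f -` carr K'"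
  define E where "E = carr K \<inter> {v. bnx G (chart K v) = 1}"
  have cont\<pi>: "continuous_on S ?\<pi>" for S
    by (intro continuous_on_compose2[OF proj_continuous(1)[of UNIV]] is_hsetD(2)[OF K]) auto
  have "closed (f -` carr K')"
    using f is_hsetD(5)[OF K'] by (simp add: closed_vimage compact_imp_closed)
  then have "compact W" unfolding W_def by (intro compact_Int_closed is_hsetD(5)[OF K])
  moreover have "closed {v. bnx G (chart K v) = 1}"
    by (intro closed_Collect_eq continuous_on_compose2[OF bn_continuous(1)[OF G, of UNIV]]
        is_hsetD(2)[OF K] continuous_on_const) auto
  then have "compact E" unfolding E_def by (intro compact_Int_closed is_hsetD(5)[OF K])
  ultimately have c: "compact (?\<pi> ` W)" "closed (?\<pi> ` E)"
    by (auto intro!: compact_continuous_image compact_imp_closed cont\<pi>)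
  have W1: "bnx G (chart K v) < 1" if "v \<in> W" for v
    using that covering_exit(1)[OF G K K' cov, of v] by (simp add: W_def)
  have "?\<pi> ` W \<inter> ?\<pi> ` E = {}"
  proof -
    have "?\<pi> u \<noteq> ?\<pi> v" if "u \<in> W" "v \<in> E" for u v
      using W1[OF that(1)] that(2) by (auto simp: E_def bnx_def)
    then show ?thesis by blast
  qed
  then obtain d where d: "d > 0" "\<forall>a\<in>?\<pi> ` W. \<forall>b\<in>?\<pi> ` E. d \<le> dist a b"
    using separate_compact_closed[OF c] by blast
  obtain B where B: "B > 0"
    "\<And>N D w1 w2. horizontal_disk G N D \<Longrightarrow> w1 \<in> chart N ` D \<Longrightarrow> w2 \<in> chart N ` D \<Longrightarrow>
       dist w1 w2 \<le> B * dist (proj_x G w1) (proj_x G w2)"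
    using horizontal_disk_cone_dist[OF G] by metis
  have "uniformly_continuous_on (unit_box G) (\<lambda>a. ?\<pi> (inv (chart N) a))"
    by (intro compact_uniformly_continuous unit_box_compact G continuous_on_compose2[OF cont\<pi>[of UNIV]]
        is_hsetD(3)[OF N]) auto
  then obtain e where e: "e > 0" "\<forall>a\<in>unit_box G. \<forall>b\<in>unit_box G. dist b a < e \<longrightarrow>
      dist (?\<pi> (inv (chart N) b)) (?\<pi> (inv (chart N) a)) < d"
    using d(1) unfolding uniformly_continuous_on_def by blast
  have "x \<in> Bx G" if D: "horizontal_disk G N D" "horizontal_disk G K (D \<inter> carr K)" and w: "w \<in> D \<inter> carr K"
    "f w \<in> carr K'" and x: "x \<in> xspace G" "dist x (proj_x G (chart N w)) < e / B" for D w x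
  proof (rule subdisk_projection_ball[OF G N K D w(1) _ _ x])
    have wW: "w \<in> W" using w by (simp add: W_def)
    then show "bnx G (chart K w) < 1" by (rule W1)
    fix v assume v: "v \<in> D \<inter> carr K" "bnx G (chart K v) = 1"
    show "e / B \<le> dist (proj_x G (chart N w)) (proj_x G (chart N v))"
    proof (rule ccontr)
      assume "\<not> ?thesis"
      then have "B * dist (proj_x G (chart N w)) (proj_x G (chart N v)) < e"
        using B(1) by (simp add: field_simps)
      moreover have "dist (chart N w) (chart N v) \<le> B * dist (proj_x G (chart N w)) (proj_x G (chart N v))"
        using v w by (intro B(2)[OF D(1)]) auto
      moreover have "chart N w \<in> unit_box G" "chart N v \<in> unit_box G"
        using horizontal_disk_subset[OF G N D(1)] v w is_hsetD(6)[OF N] by auto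
      ultimately have "dist (?\<pi> (inv (chart N) (chart N w))) (?\<pi> (inv (chart N) (chart N v))) < d"
        using e(2) by (meson le_less_trans)
      then have "dist (?\<pi> w) (?\<pi> v) < d" using is_hsetD(7)[OF N] by simp
      moreover have "v \<in> E" using v by (simp add: E_def)
      ultimately show False using d(2) wW by (meson imageI not_le)
    qed
  qed
  then show ?thesis using e(1) B(1) that[of "e / B"] by simp
qed

text \<open>The covering that starts at \<open>b\<close> excludes the exit set of \<open>b\<close>,
  the one that arrives at \<open>b\<close> excludes its entry set.\<close>

lemma compact_intermediate_points:
  assumes G: "is_frame G" and f: "diffeomorphism f" and hs: "is_hset G a" "is_hset G b" "is_hset G c"
    and cov: "f_covers G f a b" "f_covers G f b c"
  shows "compact {w \<in> carr b. inv f w \<in> carr a \<and> f w \<in> carr c}"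
    "{w \<in> carr b. inv f w \<in> carr a \<and> f w \<in> carr c} \<subseteq> interior (carr b)"
proof -
  have cont: "continuous_on UNIV f" "continuous_on UNIV (inv f)" and b: "bij f"
    using f by (auto simp: diffeomorphism_def C1_map_continuous)
  have "compact (carr b \<inter> (inv f -` carr a \<inter> f -` carr c))"
    by (intro compact_Int_closed closed_Int closed_vimage cont compact_imp_closed hs[THEN is_hsetD(5)])
  moreover have "carr b \<inter> (inv f -` carr a \<inter> f -` carr c) = {w \<in> carr b. inv f w \<in> carr a \<and> f w \<in> carr c}" by auto
  ultimately show "compact {w \<in> carr b. inv f w \<in> carr a \<and> f w \<in> carr c}" by simp
  show "{w \<in> carr b. inv f w \<in> carr a \<and> f w \<in> carr c} \<subseteq> interior (carr b)"
  proof (clarify, intro hset_interiorI[OF G hs(2)])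
    fix w assume w: "w \<in> carr b" "inv f w \<in> carr a" "f w \<in> carr c"
    show "bnx G (chart b w) < 1" by (rule covering_exit(1)[OF G hs(2,3) cov(2) w(1,3)])
    have fw: "f (inv f w) = w" using b by (simp add: bij_is_surj surj_f_inv_f)
    then show "bny G (chart b w) < 1"
      using covering_exit(2)[OF G hs(1,2) cov(1) w(2)] w(1) by simp
  qed
qed

text \<open>At a junction \<open>a\<close> covers \<open>N\<close> and not \<open>b\<close>, so the
  entry side is settled in \<open>N\<close>. The covering of \<open>c\<close> by \<open>b\<close>
  settles the exit side in \<open>b\<close>, and \<open>subdisk_uniform\<close> carries it over to
  \<open>N\<close>.\<close>

lemma compact_entry_points:
  assumes G: "is_frame G" and f: "diffeomorphism f"
    and hs: "is_hset G a" "is_hset G N" "is_hset G b" "is_hset G c"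
    and cov: "f_covers G f a N" "f_covers G f b c"
  shows "\<exists>A. compact A \<and> A \<subseteq> interior (carr N) \<and>
    (\<forall>D. horizontal_disk G N D \<longrightarrow> horizontal_disk G b (D \<inter> carr b) \<longrightarrow>
      (\<forall>w\<in>D \<inter> carr b. inv f w \<in> carr a \<longrightarrow> f w \<in> carr c \<longrightarrow> w \<in> A))"
proof -
  have cont: "continuous_on UNIV f" "continuous_on UNIV (inv f)" and b: "bij f"
    using f by (auto simp: diffeomorphism_def C1_map_continuous)
  obtain \<rho> where \<rho>: "\<rho> > 0"
    "\<And>D w x. horizontal_disk G N D \<Longrightarrow> horizontal_disk G b (D \<inter> carr b) \<Longrightarrow> w \<in> D \<inter> carr b \<Longrightarrow>
      f w \<in> carr c \<Longrightarrow> x \<in> xspace G \<Longrightarrow> dist x (proj_x G (chart N w)) < \<rho> \<Longrightarrow> x \<in> Bx G"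
    using subdisk_uniform[OF G hs(2,3,4) cov(2) cont(1)] by metis
  let ?\<pi> = "\<lambda>w. proj_x G (chart N w)"
  \<comment> \<open>\<open>A\<close> must not mention a disk. Distance at least
    \<open>\<rho>\<close> from everything outside \<open>Bx G\<close> is a closed condition shared
    by all disks.\<close>
  define A where "A = carr N \<inter> (inv f -` carr a \<inter> (\<Inter>x\<in>xspace G - Bx G. {w. \<rho> \<le> dist x (?\<pi> w)}))"
  have "continuous_on UNIV ?\<pi>"
    by (intro continuous_on_compose2[OF proj_continuous(1)[of UNIV]] is_hsetD(2)[OF hs(2)]) auto
  then have "compact A" unfolding A_def
    by (intro compact_Int_closed closed_Int closed_vimage closed_INT ballI closed_Collect_le continuous_intros
        cont compact_imp_closed hs[THEN is_hsetD(5)])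
  moreover have "A \<subseteq> interior (carr N)"
  proof (intro subsetI hset_interiorI[OF G hs(2)])
    fix w assume w: "w \<in> A"
    then have wN: "w \<in> carr N" "inv f w \<in> carr a" by (auto simp: A_def)
    have "f (inv f w) = w" using b by (simp add: bij_is_surj surj_f_inv_f)
    then show "bny G (chart N w) < 1"
      using covering_exit(2)[OF G hs(1,2) cov(1) wN(2)] wN(1) by simp
    show "bnx G (chart N w) < 1"
    proof (rule ccontr)
      let ?p = "?\<pi> w"
      \<comment> \<open>Scaling \<open>?p\<close> by \<open>1 + s\<close> would leave the unit ball
        while moving it by at most \<open>\<rho> / 2\<close>; the \<open>+ 1\<close> keeps the
        denominator positive.\<close>
      define n where "n = norm ?p + 1"
      define s where "s = \<rho> / (2 * n)"
      have n: "n > 0" using norm_ge_zero[of ?p] unfolding n_def by linarith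
      have s: "s > 0" using \<rho>(1) n by (simp add: s_def)
      assume "\<not> ?thesis"
      then have p: "bnx G ?p \<ge> 1" by simp
      have "bnx G ((1 + s) *\<^sub>R ?p) = (1 + s) * bnx G ?p"
        using s by (simp only: seminormD(2)[OF frame_seminorms(1)[OF G]])
      also have "\<dots> \<ge> (1 + s) * 1" using p s by (intro mult_left_mono) auto
      finally have "(1 + s) *\<^sub>R ?p \<in> xspace G - Bx G"
        using s by (auto simp: Bx_iff subspace_scale xspace_subspace)
      then have "\<rho> \<le> dist ((1 + s) *\<^sub>R ?p) ?p" using w by (auto simp: A_def)
      also have "\<dots> = s * norm ?p" using s by (simp add: dist_norm algebra_simps)
      also have "\<dots> \<le> s * n" using s by (intro mult_left_mono) (auto simp: n_def)
      also have "\<dots> = \<rho> / 2" using n by (simp add: s_def)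
      finally show False using \<rho>(1) by simp
    qed
  qed
  moreover have "w \<in> A" if D: "horizontal_disk G N D" "horizontal_disk G b (D \<inter> carr b)" and w: "w \<in> D \<inter> carr b"
    "inv f w \<in> carr a" "f w \<in> carr c" for D w
  proof -
    have "\<rho> \<le> dist x (?\<pi> w)" if "x \<in> xspace G - Bx G" for x
      using \<rho>(2)[OF D w(1,3), of x] that by force
    moreover have "w \<in> carr N" using horizontal_disk_subset[OF G hs(2) D(1)] w(1) by blast
    ultimately show ?thesis using w(2) by (simp add: A_def)
  qed
  ultimately show ?thesis by blast
qed

lemma finite_union_compact:
  assumes "finite F" "\<And>i. i \<in> F \<Longrightarrow> \<exists>A. compact A \<and> A \<subseteq> V \<and> S i \<subseteq> A"
  shows "\<exists>A. compact A \<and> A \<subseteq> V \<and> (\<forall>i\<in>F. S i \<subseteq> A)"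
proof -
  obtain A where A: "\<forall>i\<in>F. compact (A i) \<and> A i \<subseteq> V \<and> S i \<subseteq> A i" using assms(2) by metis
  then show ?thesis using assms(1) by (intro exI[of _ "\<Union>i\<in>F. A i"]) (auto intro: compact_UN)
qed

text \<open>
  The two clauses concern the inner points of a chain and the points where a disk in N is cut down
  to the first set of the next chain.
\<close>

definition chain_region ::
  "'n::finite frame \<Rightarrow> (real^'n \<Rightarrow> real^'n) \<Rightarrow> 'n hset set \<Rightarrow> (real^'n) set \<Rightarrow> (real^'n) set \<Rightarrow> bool" where
  "chain_region G f \<H> U A \<longleftrightarrow> compact A \<and> A \<subseteq> interior U \<and>
    (\<forall>a\<in>\<H>. \<forall>b\<in>\<H>. \<forall>c\<in>\<H>. f_covers G f a b \<longrightarrow> f_covers G f b c \<longrightarrow> carr b \<subseteq> U \<longrightarrow>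
      (\<forall>w\<in>carr b. inv f w \<in> carr a \<longrightarrow> f w \<in> carr c \<longrightarrow> w \<in> A)) \<and>
    (\<forall>a\<in>\<H>. \<forall>N\<in>\<H>. \<forall>b\<in>\<H>. \<forall>c\<in>\<H>. f_covers G f a N \<longrightarrow> f_covers G f b c \<longrightarrow> carr N \<subseteq> U \<longrightarrow>
      (\<forall>D. horizontal_disk G N D \<longrightarrow> horizontal_disk G b (D \<inter> carr b) \<longrightarrow>
        (\<forall>w\<in>D \<inter> carr b. inv f w \<in> carr a \<longrightarrow> f w \<in> carr c \<longrightarrow> w \<in> A)))"

lemma chain_region_exists:
  assumes G: "is_frame G" and f: "diffeomorphism f" and fin: "finite \<H>" and hs: "\<And>N. N \<in> \<H> \<Longrightarrow> is_hset G N"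
  shows "\<exists>A. chain_region G f \<H> U A"
proof -
  \<comment> \<open>The side conditions are part of the sets, so tuples violating them contribute
    the empty set.\<close>
  define S1 where "S1 = (\<lambda>(a, b, c). {w \<in> carr b. f_covers G f a b \<and> f_covers G f b c \<and> carr b \<subseteq> U \<and>
    inv f w \<in> carr a \<and> f w \<in> carr c})"
  define S2 where "S2 = (\<lambda>(a, N, b, c). {w. f_covers G f a N \<and> f_covers G f b c \<and> carr N \<subseteq> U \<and>
    (\<exists>D. horizontal_disk G N D \<and> horizontal_disk G b (D \<inter> carr b) \<and> w \<in> D \<inter> carr b) \<and>
    inv f w \<in> carr a \<and> f w \<in> carr c})"
  have "\<exists>A. compact A \<and> A \<subseteq> interior U \<and> S1 i \<subseteq> A" if i: "i \<in> \<H> \<times> \<H> \<times> \<H>" for i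
  proof -
    obtain a b c where abc: "i = (a, b, c)" "a \<in> \<H>" "b \<in> \<H>" "c \<in> \<H>" using i by auto
    show ?thesis
    proof (cases "f_covers G f a b \<and> f_covers G f b c \<and> carr b \<subseteq> U")
      case True
      then have "interior (carr b) \<subseteq> interior U" by (intro interior_mono) simp
      then show ?thesis
        using compact_intermediate_points[OF G f hs[OF abc(2)] hs[OF abc(3)] hs[OF abc(4)]] True
        by (intro exI[of _ "{w \<in> carr b. inv f w \<in> carr a \<and> f w \<in> carr c}"]) (auto simp: S1_def abc(1))
    next
      case False
      then show ?thesis by (intro exI[of _ "{}"]) (auto simp: S1_def abc(1))
    qed
  qed
  moreover have "finite (\<H> \<times> \<H> \<times> \<H>)" using fin by simp
  ultimately obtain A1 where A1: "compact A1" "A1 \<subseteq> interior U" "\<forall>i\<in>\<H> \<times> \<H> \<times> \<H>. S1 i \<subseteq> A1"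
    using finite_union_compact[of "\<H> \<times> \<H> \<times> \<H>" "interior U" S1] by blast
  have "\<exists>A. compact A \<and> A \<subseteq> interior U \<and> S2 i \<subseteq> A" if i: "i \<in> \<H> \<times> \<H> \<times> \<H> \<times> \<H>" for i
  proof -
    obtain a N b c where abc: "i = (a, N, b, c)" "a \<in> \<H>" "N \<in> \<H>" "b \<in> \<H>" "c \<in> \<H>" using i by auto
    show ?thesis
    proof (cases "f_covers G f a N \<and> f_covers G f b c \<and> carr N \<subseteq> U")
      case True
      then have "interior (carr N) \<subseteq> interior U" by (intro interior_mono) simp
      moreover obtain A where "compact A" "A \<subseteq> interior (carr N)"
        "\<forall>D. horizontal_disk G N D \<longrightarrow> horizontal_disk G b (D \<inter> carr b) \<longrightarrow>
          (\<forall>w\<in>D \<inter> carr b. inv f w \<in> carr a \<longrightarrow> f w \<in> carr c \<longrightarrow> w \<in> A)"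
        using compact_entry_points[OF G f hs[OF abc(2)] hs[OF abc(3)] hs[OF abc(4)] hs[OF abc(5)]] True by blast
      ultimately show ?thesis by (intro exI[of _ A]) (auto simp: S2_def abc(1))
    next
      case False
      then show ?thesis by (intro exI[of _ "{}"]) (auto simp: S2_def abc(1))
    qed
  qed
  moreover have "finite (\<H> \<times> \<H> \<times> \<H> \<times> \<H>)" using fin by simp
  ultimately obtain A2 where A2: "compact A2" "A2 \<subseteq> interior U" "\<forall>i\<in>\<H> \<times> \<H> \<times> \<H> \<times> \<H>. S2 i \<subseteq> A2"
    using finite_union_compact[of "\<H> \<times> \<H> \<times> \<H> \<times> \<H>" "interior U" S2] by blast
  have "chain_region G f \<H> U (A1 \<union> A2)"
    unfolding chain_region_def
  proof (intro conjI ballI allI impI)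
    show "compact (A1 \<union> A2)" using A1 A2 by auto
    show "A1 \<union> A2 \<subseteq> interior U" using A1 A2 by auto
    fix a b c w assume "a \<in> \<H>" "b \<in> \<H>" "c \<in> \<H>" "f_covers G f a b" "f_covers G f b c" "carr b \<subseteq> U"
      "w \<in> carr b" "inv f w \<in> carr a" "f w \<in> carr c"
    then have "w \<in> S1 (a, b, c)" "(a, b, c) \<in> \<H> \<times> \<H> \<times> \<H>" by (auto simp: S1_def)
    then show "w \<in> A1 \<union> A2" using A1(3) by blast
  next
    fix a N b c D w assume "a \<in> \<H>" "N \<in> \<H>" "b \<in> \<H>" "c \<in> \<H>" "f_covers G f a N" "f_covers G f b c" "carr N \<subseteq> U"
      "horizontal_disk G N D" "horizontal_disk G b (D \<inter> carr b)" "w \<in> D \<inter> carr b" "inv f w \<in> carr a" "f w \<in> carr c"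
    then have "w \<in> S2 (a, N, b, c)" "(a, N, b, c) \<in> \<H> \<times> \<H> \<times> \<H> \<times> \<H>" unfolding S2_def by blast+
    then show "w \<in> A1 \<union> A2" using A2(3) by blast
  qed
  then show ?thesis by blast
qed

section \<open>Concatenation of chains\<close>

text \<open>Iterates \<open>covering_image_disk\<close>. The itinerary is read backwards from the
  final disk, because every image is cut down and only the surviving points have visited all
  sets.\<close>

lemma chain_disk:
  assumes G: "is_frame G" and f: "bij f" and hs: "\<And>m. m \<le> s \<Longrightarrow> is_hset G (N m)"
    and cov: "\<And>m. m < s \<Longrightarrow> f_covers G f (N m) (N (Suc m)) \<and> cone_conditions G f (N m) (N (Suc m))"
    and D: "horizontal_disk G (N 0) D"
  shows "\<exists>D'. horizontal_disk G (N s) D' \<and>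
    (\<forall>w\<in>D'. (inv f ^^ s) w \<in> D \<and> (\<forall>i\<le>s. (inv f ^^ i) w \<in> carr (N (s - i))))"
  using hs cov
proof (induction s)
  case 0
  then show ?case using D horizontal_disk_subset[OF G _ D] by (intro exI[of _ D]) auto
next
  case (Suc s)
  have "\<exists>D'. horizontal_disk G (N s) D' \<and>
    (\<forall>w\<in>D'. (inv f ^^ s) w \<in> D \<and> (\<forall>i\<le>s. (inv f ^^ i) w \<in> carr (N (s - i))))"
    by (rule Suc.IH) (use Suc.prems in auto)
  then obtain D' where D': "horizontal_disk G (N s) D'"
    "\<forall>w\<in>D'. (inv f ^^ s) w \<in> D \<and> (\<forall>i\<le>s. (inv f ^^ i) w \<in> carr (N (s - i)))"
    by blast
  have "horizontal_disk G (N (Suc s)) (f ` D' \<inter> carr (N (Suc s)))"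
    using Suc.prems by (intro covering_image_disk[OF G _ _ _ _ D'(1)]) auto
  moreover have "(inv f ^^ Suc s) w \<in> D \<and> (\<forall>i\<le>Suc s. (inv f ^^ i) w \<in> carr (N (Suc s - i)))"
    if w: "w \<in> f ` D' \<inter> carr (N (Suc s))" for w
  proof -
    from w obtain v where v: "v \<in> D'" "w = f v" by blast
    then have iv: "inv f w = v" using f by (simp add: bij_is_inj)
    have "(inv f ^^ Suc i) w = (inv f ^^ i) v" for i by (simp add: funpow_Suc_right iv del: funpow.simps)
    then have "(inv f ^^ i) w \<in> carr (N (Suc s - i))" if "i \<le> Suc s" for i
      using D'(2) v(1) w that by (cases i) auto
    then show ?thesis using D'(2) v(1) \<open>\<And>i. (inv f ^^ Suc i) w = (inv f ^^ i) v\<close> by metis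
  qed
  ultimately show ?case by blast
qed

lemma connected_by_disk:
  assumes G: "is_frame G" and f: "bij f" and K: "\<forall>j\<in>J. is_hset G (K j)" and M': "\<forall>i\<in>I. is_hset G (M' i)"
    and con: "connected_by G f K J M L M' I"
  shows "\<exists>R. \<forall>l\<in>L. \<forall>D. horizontal_disk G (M l) D \<longrightarrow> (\<exists>s N D'. 1 \<le> s \<and> s \<le> R \<and> (\<forall>m<s. N m \<in> K ` J) \<and>
    N s \<in> M' ` I \<and> horizontal_disk G (N 0) (D \<inter> carr (N 0)) \<and> (\<forall>m<s. f_covers G f (N m) (N (Suc m))) \<and>
    horizontal_disk G (N s) D' \<and>
    (\<forall>w\<in>D'. (inv f ^^ s) w \<in> D \<inter> carr (N 0) \<and> (\<forall>i\<le>s. (inv f ^^ i) w \<in> carr (N (s - i)))))"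
proof -
  obtain R where R: "\<forall>l\<in>L. \<forall>D. horizontal_disk G (M l) D \<longrightarrow>
        (\<exists>r\<le>R. \<exists>j. \<exists>i\<in>I. (\<forall>m\<le>r. j m \<in> J) \<and>
           horizontal_disk G (K (j 0)) (D \<inter> carr (K (j 0))) \<and>
           (\<forall>m<r. f_covers G f (K (j m)) (K (j (Suc m))) \<and> cone_conditions G f (K (j m)) (K (j (Suc m)))) \<and>
           f_covers G f (K (j r)) (M' i) \<and> cone_conditions G f (K (j r)) (M' i))"
    using con unfolding connected_by_def by (elim exE)
  show ?thesis
  proof (rule exI[of _ "Suc R"], intro ballI allI impI)
    fix l D assume "l \<in> L" "horizontal_disk G (M l) D"
    then obtain r j i where r: "r \<le> R" "i \<in> I" "\<forall>m\<le>r. j m \<in> J"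
      "horizontal_disk G (K (j 0)) (D \<inter> carr (K (j 0)))"
      "\<forall>m<r. f_covers G f (K (j m)) (K (j (Suc m))) \<and> cone_conditions G f (K (j m)) (K (j (Suc m)))"
      "f_covers G f (K (j r)) (M' i)" "cone_conditions G f (K (j r)) (M' i)"
      using R by blast
    \<comment> \<open>The target set is appended as last member. A chain with top index
      \<open>r\<close> thus takes \<open>Suc r\<close> steps, which explains the bound
      \<open>Suc R\<close> and \<open>1 \<le> s\<close>.\<close>
    define N where "N m = (if m \<le> r then K (j m) else M' i)" for m
    have N: "m \<le> r \<Longrightarrow> N m = K (j m)" "N (Suc r) = M' i" for m by (auto simp: N_def)
    have hs: "is_hset G (N m)" for m using r(2,3) K M' by (auto simp: N_def)
    have cov: "f_covers G f (N m) (N (Suc m)) \<and> cone_conditions G f (N m) (N (Suc m))" if "m < Suc r" for m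
      using r(5-7) that by (cases "m = r") (auto simp: N)
    have D0: "horizontal_disk G (N 0) (D \<inter> carr (N 0))" using r(4) by (simp add: N)
    obtain D' where "horizontal_disk G (N (Suc r)) D'"
      "\<forall>w\<in>D'. (inv f ^^ Suc r) w \<in> D \<inter> carr (N 0) \<and> (\<forall>i\<le>Suc r. (inv f ^^ i) w \<in> carr (N (Suc r - i)))"
      using chain_disk[OF G f hs cov D0] by blast
    then show "\<exists>s N D'. 1 \<le> s \<and> s \<le> Suc R \<and> (\<forall>m<s. N m \<in> K ` J) \<and>
        N s \<in> M' ` I \<and> horizontal_disk G (N 0) (D \<inter> carr (N 0)) \<and> (\<forall>m<s. f_covers G f (N m) (N (Suc m))) \<and>
        horizontal_disk G (N s) D' \<and>
        (\<forall>w\<in>D'. (inv f ^^ s) w \<in> D \<inter> carr (N 0) \<and> (\<forall>i\<le>s. (inv f ^^ i) w \<in> carr (N (s - i))))"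
      using D0 cov r(1,2,3) N by (intro exI[of _ "Suc r"] exI[of _ N] exI[of _ D'] conjI) auto
  qed
qed

text \<open>A disk together with a predecessor \<open>a\<close> of its points.
  \<open>chain_region\<close> asks for such a predecessor at a junction; an arbitrary horizontal
  disk may touch the entry set.\<close>

definition entered_disk ::
  "'n::finite frame \<Rightarrow> (real^'n \<Rightarrow> real^'n) \<Rightarrow> 'n hset set \<Rightarrow> 'n hset set \<Rightarrow> (real^'n) set \<Rightarrow> bool" where
  "entered_disk G f \<H> \<M> D \<longleftrightarrow>
    (\<exists>N\<in>\<M>. \<exists>a\<in>\<H>. horizontal_disk G N D \<and> f_covers G f a N \<and> D \<subseteq> f ` carr a)"

text \<open>For a connecting chain only the length bound and the predecessor of the target are kept;
  its inner sets may leave both \<open>U\<close> and \<open>U'\<close>.\<close>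

lemma connected_by_entered:
  assumes G: "is_frame G" and f: "bij f" and K: "\<forall>j\<in>J. is_hset G (K j)" and M': "\<forall>i\<in>I. is_hset G (M' i)"
    and con: "connected_by G f K J M L M' I" and JH: "K ` J \<subseteq> \<H>"
  shows "\<exists>R. \<forall>l\<in>L. \<forall>D. horizontal_disk G (M l) D \<longrightarrow> (\<exists>s\<le>R. \<exists>D'. entered_disk G f \<H> (M' ` I) D' \<and>
    (\<forall>w\<in>D'. (inv f ^^ s) w \<in> D))"
proof -
  obtain R where R: "\<forall>l\<in>L. \<forall>D. horizontal_disk G (M l) D \<longrightarrow> (\<exists>s N D'. 1 \<le> s \<and> s \<le> R \<and> (\<forall>m<s. N m \<in> K ` J) \<and>
    N s \<in> M' ` I \<and> horizontal_disk G (N 0) (D \<inter> carr (N 0)) \<and> (\<forall>m<s. f_covers G f (N m) (N (Suc m))) \<and>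
    horizontal_disk G (N s) D' \<and>
    (\<forall>w\<in>D'. (inv f ^^ s) w \<in> D \<inter> carr (N 0) \<and> (\<forall>i\<le>s. (inv f ^^ i) w \<in> carr (N (s - i)))))"
    using connected_by_disk[OF G f K M' con] by blast
  show ?thesis
  proof (rule exI[of _ R], intro ballI allI impI)
    fix l D assume "l \<in> L" "horizontal_disk G (M l) D"
    then obtain s N D' where s: "1 \<le> s" "s \<le> R" and N: "\<forall>m<s. N m \<in> K ` J" "N s \<in> M' ` I"
      and cov: "\<forall>m<s. f_covers G f (N m) (N (Suc m))" and D': "horizontal_disk G (N s) D'"
      and w: "\<forall>w\<in>D'. (inv f ^^ s) w \<in> D \<inter> carr (N 0) \<and> (\<forall>i\<le>s. (inv f ^^ i) w \<in> carr (N (s - i)))"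
      using R by blast
    have "f_covers G f (N (s - 1)) (N s)" using cov[rule_format, of "s - 1"] s by simp
    moreover have "N (s - 1) \<in> \<H>" using N(1)[rule_format, of "s - 1"] JH s by auto
    moreover have "D' \<subseteq> f ` carr (N (s - 1))"
    proof
      fix v assume "v \<in> D'"
      then have "inv f v \<in> carr (N (s - 1))" using w s by fastforce
      then have "f (inv f v) \<in> f ` carr (N (s - 1))" by (rule imageI)
      then show "v \<in> f ` carr (N (s - 1))" using f by (simp add: bij_is_surj surj_f_inv_f)
    qed
    ultimately have "entered_disk G f \<H> (M' ` I) D'" using D' N(2) unfolding entered_disk_def by blast
    then show "\<exists>s\<le>R. \<exists>D'. entered_disk G f \<H> (M' ` I) D' \<and> (\<forall>w\<in>D'. (inv f ^^ s) w \<in> D)"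
      using s w by blast
  qed
qed

lemma chain_region_step:
  assumes G: "is_frame G" and f: "bij f" and K: "\<forall>j\<in>J. is_hset G (K j)"
    and M: "\<forall>l\<in>L. is_hset G (M l) \<and> carr (M l) \<subseteq> U"
    and con: "self_connected_in U G f K J M L"
    and A: "chain_region G f \<H> U A" and H: "K ` J \<subseteq> \<H>" "M ` L \<subseteq> \<H>"
    and D: "entered_disk G f \<H> (M ` L) D"
  shows "\<exists>s\<ge>1. \<exists>D'. entered_disk G f \<H> (M ` L) D' \<and>
    (\<forall>w\<in>D'. (inv f ^^ s) w \<in> D \<and> (\<forall>i. 1 \<le> i \<and> i \<le> s \<longrightarrow> (inv f ^^ i) w \<in> A))"
proof -
  let ?J = "{j \<in> J. carr (K j) \<subseteq> U}"
  have inv1: "inv f (f v) = v" "f (inv f v) = v" for v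
    using f by (simp_all add: bij_is_inj bij_is_surj surj_f_inv_f)
  obtain N0 a where N0: "N0 \<in> M ` L" "a \<in> \<H>" "horizontal_disk G N0 D" "f_covers G f a N0" "D \<subseteq> f ` carr a"
    using D unfolding entered_disk_def by blast
  have "\<exists>R. \<forall>l\<in>L. \<forall>D. horizontal_disk G (M l) D \<longrightarrow> (\<exists>s N D'. 1 \<le> s \<and> s \<le> R \<and> (\<forall>m<s. N m \<in> K ` ?J) \<and>
    N s \<in> M ` L \<and> horizontal_disk G (N 0) (D \<inter> carr (N 0)) \<and> (\<forall>m<s. f_covers G f (N m) (N (Suc m))) \<and>
    horizontal_disk G (N s) D' \<and>
    (\<forall>w\<in>D'. (inv f ^^ s) w \<in> D \<inter> carr (N 0) \<and> (\<forall>i\<le>s. (inv f ^^ i) w \<in> carr (N (s - i)))))"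
    by (rule connected_by_disk[OF G f _ _ con[unfolded self_connected_in_def]]) (use K M in auto)
  then obtain s N D' where s: "1 \<le> s" and N: "\<forall>m<s. N m \<in> K ` ?J" "N s \<in> M ` L"
      and D0: "horizontal_disk G (N 0) (D \<inter> carr (N 0))"
      and cov: "\<forall>m<s. f_covers G f (N m) (N (Suc m))" and D': "horizontal_disk G (N s) D'"
      and w: "\<forall>w\<in>D'. (inv f ^^ s) w \<in> D \<inter> carr (N 0) \<and> (\<forall>i\<le>s. (inv f ^^ i) w \<in> carr (N (s - i)))"
    using N0(1,3) by blast
  have NH: "N m \<in> \<H>" if "m \<le> s" for m
  proof (cases "m = s")
    case False
    then have "N m \<in> K ` ?J" using N(1) that by simp
    then show ?thesis using H(1) by blast
  qed (use N(2) H(2) in auto)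
  have NU: "carr (N m) \<subseteq> U" if "m < s" for m using N(1)[rule_format, OF that] by auto
  have N0U: "carr N0 \<subseteq> U" "N0 \<in> \<H>" using N0(1) M H by auto
  have shift: "inv f ((inv f ^^ i) w) = (inv f ^^ Suc i) w" "f ((inv f ^^ Suc i) w) = (inv f ^^ i) w" for i w
    using inv1 by auto
  \<comment> \<open>Going back \<open>s\<close> steps reaches the junction, treated by the second
    clause of \<open>chain_region\<close> with the predecessor \<open>a\<close>; smaller positive
    \<open>i\<close> are inner points. \<open>i = 0\<close> is left out because no covering from
    \<open>N s\<close> is known yet: the next chain treats this point as its own junction.\<close>
  have reg: "(inv f ^^ i) v \<in> A" if v: "v \<in> D'" and i: "1 \<le> i" "i \<le> s" for v i
  proof (cases "i = s")
    case True
    have vs: "(inv f ^^ s) v \<in> D \<inter> carr (N 0)" using w v by blast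
    then obtain u where "u \<in> carr a" "(inv f ^^ s) v = f u" using N0(5) by blast
    then have "inv f ((inv f ^^ s) v) \<in> carr a" using inv1 by simp
    moreover have "f ((inv f ^^ s) v) \<in> carr (N (Suc 0))"
    proof -
      obtain t where t: "s = Suc t" using s by (cases s) auto
      have visits: "\<forall>i\<le>s. (inv f ^^ i) v \<in> carr (N (s - i))" using w v by blast
      have "(inv f ^^ t) v \<in> carr (N (s - t))" by (rule visits[rule_format]) (use t in simp)
      then show ?thesis using t shift(2)[of t v] by simp
    qed
    moreover have "f_covers G f (N 0) (N (Suc 0))" "N 0 \<in> \<H>" "N (Suc 0) \<in> \<H>" using cov NH s by auto
    ultimately show ?thesis
      using A N0 N0U D0 vs True unfolding chain_region_def by blast
  next
    case False
    then have lt: "i < s" using i by simp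
    obtain m where m: "s - i = Suc m" using lt by (metis Suc_diff_Suc)
    obtain t where t: "i = Suc t" using i by (cases i) auto
    have "(inv f ^^ i) v \<in> carr (N (Suc m))" "inv f ((inv f ^^ i) v) \<in> carr (N m)"
      "f ((inv f ^^ i) v) \<in> carr (N (Suc (Suc m)))"
    proof -
      have visits: "\<forall>i\<le>s. (inv f ^^ i) v \<in> carr (N (s - i))" using w v by blast
      have *: "(inv f ^^ i) v \<in> carr (N (s - i))" "(inv f ^^ Suc i) v \<in> carr (N (s - Suc i))"
        "(inv f ^^ t) v \<in> carr (N (s - t))" by (rule visits[rule_format]; use lt t in simp)+
      have "s - Suc i = m" "s - t = Suc (Suc m)" using m t lt by auto
      then show "(inv f ^^ i) v \<in> carr (N (Suc m))" "inv f ((inv f ^^ i) v) \<in> carr (N m)"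
        "f ((inv f ^^ i) v) \<in> carr (N (Suc (Suc m)))"
        using * m t shift(2)[of t v] by simp_all
    qed
    moreover have "f_covers G f (N m) (N (Suc m))" "f_covers G f (N (Suc m)) (N (Suc (Suc m)))"
      "N m \<in> \<H>" "N (Suc m) \<in> \<H>" "N (Suc (Suc m)) \<in> \<H>" "carr (N (Suc m)) \<subseteq> U"
      using m t lt cov NH NU by auto
    ultimately show ?thesis using A unfolding chain_region_def by blast
  qed
  have "D' \<subseteq> f ` carr (N (s - 1))"
  proof
    fix v assume "v \<in> D'"
    then have "inv f v \<in> carr (N (s - 1))" using w s by fastforce
    then show "v \<in> f ` carr (N (s - 1))" using inv1(2) by (metis imageI)
  qed
  moreover have "f_covers G f (N (s - 1)) (N s)" "N (s - 1) \<in> \<H>"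
    using cov[rule_format, of "s - 1"] NH[of "s - 1"] s by auto
  ultimately have "entered_disk G f \<H> (M ` L) D'" using D' N(2) unfolding entered_disk_def by blast
  then show ?thesis using reg w s by blast
qed

lemma chain_region_iterate:
  assumes "is_frame G" "bij f" "\<forall>j\<in>J. is_hset G (K j)" "\<forall>l\<in>L. is_hset G (M l) \<and> carr (M l) \<subseteq> U"
    "self_connected_in U G f K J M L" "chain_region G f \<H> U A" "K ` J \<subseteq> \<H>" "M ` L \<subseteq> \<H>"
    and D: "entered_disk G f \<H> (M ` L) D"
  shows "\<exists>s\<ge>n. \<exists>D'. entered_disk G f \<H> (M ` L) D' \<and>
    (\<forall>w\<in>D'. (inv f ^^ s) w \<in> D \<and> (\<forall>i. 1 \<le> i \<and> i \<le> s \<longrightarrow> (inv f ^^ i) w \<in> A))"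
proof (induction n)
  case 0
  show ?case using D by (intro exI[of _ 0]) auto
next
  case (Suc n)
  then obtain s D1 where s: "s \<ge> n" "entered_disk G f \<H> (M ` L) D1"
    "\<forall>w\<in>D1. (inv f ^^ s) w \<in> D \<and> (\<forall>i. 1 \<le> i \<and> i \<le> s \<longrightarrow> (inv f ^^ i) w \<in> A)" by blast
  obtain t D2 where t: "t \<ge> 1" "entered_disk G f \<H> (M ` L) D2"
    "\<forall>w\<in>D2. (inv f ^^ t) w \<in> D1 \<and> (\<forall>i. 1 \<le> i \<and> i \<le> t \<longrightarrow> (inv f ^^ i) w \<in> A)"
    using chain_region_step[OF assms(1-8) s(2)] by blast
  have "(inv f ^^ (s + t)) w \<in> D \<and> (\<forall>i. 1 \<le> i \<and> i \<le> s + t \<longrightarrow> (inv f ^^ i) w \<in> A)" if w: "w \<in> D2" for w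
  proof (intro conjI allI impI)
    have v: "(inv f ^^ t) w \<in> D1" using t w by blast
    then show "(inv f ^^ (s + t)) w \<in> D" using s(3) by (simp add: funpow_add)
    fix i assume i: "1 \<le> i \<and> i \<le> s + t"
    show "(inv f ^^ i) w \<in> A"
    proof (cases "i \<le> t")
      case False
      then have "1 \<le> i - t" "i - t \<le> s" using i by auto
      then have "(inv f ^^ (i - t)) ((inv f ^^ t) w) \<in> A" using s(3) v by blast
      moreover have "(inv f ^^ (i - t)) ((inv f ^^ t) w) = (inv f ^^ (i - t + t)) w" by (simp only: funpow_add comp_apply)
      ultimately show ?thesis using False by simp
    qed (use t(3) w i in blast)
  qed
  then show ?case using t(1,2) s(1) by (intro exI[of _ "s + t"] conjI exI[of _ D2]) auto
qed

section \<open>Limit over longer and longer chains\<close>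

text \<open>The gap \<open>t\<close> may depend on \<open>n\<close> but is at most \<open>R\<close>.
  As \<open>Z t n\<close> shrinks with \<open>n\<close>, some fixed \<open>t\<close> has all its
  sets nonempty, and nested compact sets have a common point.\<close>

lemma connecting_orbit:
  fixes f :: "real^'n \<Rightarrow> real^'n"
  assumes f: "diffeomorphism f" and A: "compact A" "compact A'"
    and seg: "\<And>n::nat. \<exists>t\<le>R. \<exists>z. (\<forall>i. 1 \<le> i \<and> i \<le> n \<longrightarrow> iter f (- int i) z \<in> A) \<and> (\<forall>i<n. iter f (int (t + i)) z \<in> A')"
  shows "\<exists>z t. (\<forall>i\<ge>1. iter f (- int i) z \<in> A) \<and> (\<forall>i. iter f (int (t + i)) z \<in> A')"
proof -
  have b: "bij f" using f by (simp add: diffeomorphism_def)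
  define Z where "Z t n = (\<Inter>i\<in>{1..n}. iter f (- int i) -` A) \<inter> (\<Inter>i\<in>{..<n}. iter f (int (t + i)) -` A')" for t n
  have Zmem: "z \<in> Z t n \<longleftrightarrow> (\<forall>i. 1 \<le> i \<and> i \<le> n \<longrightarrow> iter f (- int i) z \<in> A) \<and> (\<forall>i<n. iter f (int (t + i)) z \<in> A')" for z t n
    by (auto simp: Z_def)
  have mono: "Z t n \<subseteq> Z t m" if "m \<le> n" for t m n using that by (auto simp: Zmem)
  have "\<exists>t. \<forall>n. Z t n \<noteq> {}"
  proof (rule ccontr)
    assume "\<not> ?thesis"
    then have "\<forall>t. \<exists>n. Z t n = {}" by blast
    then obtain n where n: "\<And>t. Z t (n t) = {}" by metis
    obtain t z where "t \<le> R" "z \<in> Z t (Max (n ` {..R}))" using seg[of "Max (n ` {..R})"] Zmem by blast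
    moreover have "n t \<le> Max (n ` {..R})" using \<open>t \<le> R\<close> by (intro Max_ge) auto
    ultimately show False using mono[of "n t" _ t] n by blast
  qed
  then obtain t where t: "\<And>n. Z t n \<noteq> {}" by blast
  \<comment> \<open>With \<open>Suc n\<close> the condition at time -1 is always present; it
    confines the set to the compact image of \<open>A\<close> under \<open>f\<close>.\<close>
  have "compact (Z t (Suc n))" for n
  proof -
    have "closed (Z t (Suc n))" unfolding Z_def
      by (intro closed_Int closed_INT ballI closed_vimage compact_imp_closed A iter_continuous f)
    moreover have "Z t (Suc n) \<subseteq> f ` A"
    proof
      fix z assume "z \<in> Z t (Suc n)"
      then have "\<forall>i. 1 \<le> i \<and> i \<le> Suc n \<longrightarrow> iter f (- int i) z \<in> A" using Zmem by blast
      then have "iter f (- int 1) z \<in> A" by (elim allE[of _ 1]) simp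
      moreover have "f (iter f (- int 1) z) = z" using iter_minus_cancel(2)[OF b, of 1 z] by simp
      ultimately show "z \<in> f ` A" by (metis imageI)
    qed
    moreover have "compact (f ` A)"
      using f A by (intro compact_continuous_image C1_map_continuous) (auto simp: diffeomorphism_def)
    ultimately show ?thesis by (metis compact_Int_closed inf.absorb_iff2)
  qed
  then have "\<Inter> (range (\<lambda>n. Z t (Suc n))) \<noteq> {}"
    using t mono by (intro compact_nest) auto
  then obtain z where z: "\<And>n. z \<in> Z t (Suc n)" by auto
  show ?thesis
  proof (intro exI[of _ z] exI[of _ t] conjI allI impI)
    show "iter f (- int i) z \<in> A" if "1 \<le> i" for i using z[of i] that by (simp add: Zmem)
    show "iter f (int (t + i)) z \<in> A'" for i using z[of i] by (simp add: Zmem)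
  qed
qed

lemma connection_between:
  fixes f :: "real^'n \<Rightarrow> real^'n"
  assumes G: "is_frame G" and f: "diffeomorphism f"
    and hyp: "hyperbolic f (Inv f U)" "hyperbolic f (Inv f U')"
    and L: "finite L" "L \<noteq> {}" "\<forall>l\<in>L. is_hset G (M l) \<and> carr (M l) \<subseteq> U"
    and I: "finite I" "\<forall>i\<in>I. is_hset G (M' i) \<and> carr (M' i) \<subseteq> U'"
    and J: "finite J" "\<forall>j\<in>J. is_hset G (K j)"
    and con: "connected_by G f K J M L M' I"
    and self: "self_connected_in U G f K J M L" "self_connected_in U' G f K J M' I"
  shows "Ws f U' (Inv f U') \<inter> Wu f U (Inv f U) \<noteq> {}"
proof -
  have b: "bij f" using f by (simp add: diffeomorphism_def)
  let ?H = "K ` J \<union> M ` L \<union> M' ` I"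
  have H: "finite ?H" "\<And>N. N \<in> ?H \<Longrightarrow> is_hset G N" using L I J by auto
  obtain A where A: "chain_region G f ?H U A" using chain_region_exists[OF G f H] by blast
  obtain A' where A': "chain_region G f ?H U' A'" using chain_region_exists[OF G f H] by blast
  have cA: "compact A" "A \<subseteq> interior U" "compact A'" "A' \<subseteq> interior U'"
    using A A' by (auto simp: chain_region_def)
  obtain l where l: "l \<in> L" using L by blast
  obtain D0 where D0: "horizontal_disk G (M l) D0" using horizontal_disk_exists[OF G] L(3) l by blast
  let ?J = "{j \<in> J. carr (K j) \<subseteq> U}"
  \<comment> \<open>One preliminary chain turns the arbitrary disk \<open>D0\<close> into one whose
    points have a predecessor.\<close>
  have "\<exists>R. \<forall>l\<in>L. \<forall>D. horizontal_disk G (M l) D \<longrightarrow> (\<exists>s\<le>R. \<exists>D'. entered_disk G f ?H (M ` L) D' \<and>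
    (\<forall>w\<in>D'. (inv f ^^ s) w \<in> D))"
    by (rule connected_by_entered[OF G b _ _ self(1)[unfolded self_connected_in_def]]) (use J L in auto)
  then obtain D1 where D1: "entered_disk G f ?H (M ` L) D1" using D0 l by blast
  have "\<exists>R. \<forall>l\<in>L. \<forall>D. horizontal_disk G (M l) D \<longrightarrow> (\<exists>s\<le>R. \<exists>D'. entered_disk G f ?H (M' ` I) D' \<and>
    (\<forall>w\<in>D'. (inv f ^^ s) w \<in> D))"
    by (rule connected_by_entered[OF G b _ _ con]) (use J I in auto)
  then obtain R where R: "\<forall>l\<in>L. \<forall>D. horizontal_disk G (M l) D \<longrightarrow> (\<exists>s\<le>R. \<exists>D'. entered_disk G f ?H (M' ` I) D' \<and>
    (\<forall>w\<in>D'. (inv f ^^ s) w \<in> D))" by blast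
  have "\<exists>t\<le>R. \<exists>z. (\<forall>i. 1 \<le> i \<and> i \<le> n \<longrightarrow> iter f (- int i) z \<in> A) \<and> (\<forall>i<n. iter f (int (t + i)) z \<in> A')" for n
  proof -
    have "\<exists>s\<ge>n. \<exists>D'. entered_disk G f ?H (M ` L) D' \<and>
      (\<forall>w\<in>D'. (inv f ^^ s) w \<in> D1 \<and> (\<forall>i. 1 \<le> i \<and> i \<le> s \<longrightarrow> (inv f ^^ i) w \<in> A))"
      by (rule chain_region_iterate[OF G b J(2) L(3) self(1) A _ _ D1]) auto
    then obtain s D2 where s: "s \<ge> n" "entered_disk G f ?H (M ` L) D2"
      "\<forall>w\<in>D2. \<forall>i. 1 \<le> i \<and> i \<le> s \<longrightarrow> (inv f ^^ i) w \<in> A" by blast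
    then obtain t D3 where t: "t \<le> R" "entered_disk G f ?H (M' ` I) D3" "\<forall>w\<in>D3. (inv f ^^ t) w \<in> D2"
      using R unfolding entered_disk_def[of G f ?H "M ` L"] by blast
    have "\<exists>s\<ge>n. \<exists>D'. entered_disk G f ?H (M' ` I) D' \<and>
      (\<forall>w\<in>D'. (inv f ^^ s) w \<in> D3 \<and> (\<forall>i. 1 \<le> i \<and> i \<le> s \<longrightarrow> (inv f ^^ i) w \<in> A'))"
      by (rule chain_region_iterate[OF G b J(2) I(2) self(2) A' _ _ t(2)]) auto
    then obtain u D4 where u: "u \<ge> n" "entered_disk G f ?H (M' ` I) D4"
      "\<forall>w\<in>D4. (inv f ^^ u) w \<in> D3 \<and> (\<forall>i. 1 \<le> i \<and> i \<le> u \<longrightarrow> (inv f ^^ i) w \<in> A')" by blast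
    then obtain w where w: "w \<in> D4" using horizontal_disk_nonempty[OF G] unfolding entered_disk_def by blast
    \<comment> \<open>The point of the orbit of \<open>w\<close> in \<open>D2\<close>, between the
      chains in \<open>U\<close> and the connecting chain. The latter ends \<open>t\<close> steps
      later in \<open>D3\<close>, where the chains in \<open>U'\<close> begin.\<close>
    define z where "z = (inv f ^^ t) ((inv f ^^ u) w)"
    have z: "z = iter f (- int t - int u) w"
      by (simp add: z_def flip: iter_uminus_of_nat iter_add[OF b])
    have "z \<in> D2" using w u t by (auto simp: z_def)
    then have "\<forall>i. 1 \<le> i \<and> i \<le> n \<longrightarrow> iter f (- int i) z \<in> A"
      using s(1,3) by (auto simp: iter_uminus_of_nat)
    moreover have "iter f (int (t + i)) z \<in> A'" if i: "i < n" for i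
    proof -
      have "iter f (int (t + i)) z = iter f (int (t + i) + (- int t - int u)) w"
        unfolding z by (rule iter_add[OF b, symmetric])
      also have "int (t + i) + (- int t - int u) = - int (u - i)" using i u(1) by simp
      finally have "iter f (int (t + i)) z = (inv f ^^ (u - i)) w" by (simp only: iter_uminus_of_nat)
      moreover have "1 \<le> u - i" "u - i \<le> u" using i u(1) by auto
      ultimately show ?thesis using u(3) w by simp
    qed
    ultimately show ?thesis using t(1) by blast
  qed
  from connecting_orbit[OF f cA(1,3) this] obtain z t where
    z: "\<forall>i\<ge>1. iter f (- int i) z \<in> A" "\<forall>i. iter f (int (t + i)) z \<in> A'" by blast
  \<comment> \<open>\<open>A\<close> is guaranteed at strictly negative times only, so the local
    unstable set is reached at time -1 and \<open>z\<close> is one forward iterate of it.\<close>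
  have "iter f (- int i) (iter f (- 1) z) \<in> A" for i
  proof -
    have "iter f (- int i) (iter f (- 1) z) = iter f (- int (Suc i)) z"
      by (simp add: algebra_simps flip: iter_add[OF b])
    then show ?thesis using z(1) by (simp del: of_nat_Suc)
  qed
  then have "iter f (- 1) z \<in> Wu_loc f U (Inv f U)" by (rule Wu_loc_memI[OF f hyp(1) cA(1,2)])
  then have "z \<in> iter f 1 ` Wu_loc f U (Inv f U)"
    using iter_minus_cancel(2)[OF b, of 1 z] by (metis imageI)
  then have zu: "z \<in> Wu f U (Inv f U)" unfolding Wu_def by (intro UN_I[of 1]) auto
  have "iter f (int i) (iter f (int t) z) \<in> A'" for i
    using z(2)[rule_format, of i] by (simp add: add.commute flip: iter_add[OF b])
  then have "iter f (int t) z \<in> Ws_loc f U' (Inv f U')" by (rule Ws_loc_memI[OF f hyp(2) cA(3,4)])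
  then have "z \<in> iter f (- int t) ` Ws_loc f U' (Inv f U')"
    using iter_minus_cancel(1)[OF b, of "int t" z] by (metis imageI)
  then have "z \<in> Ws f U' (Inv f U')" unfolding Ws_def by (intro UN_I[of "- int t"]) auto
  with zu show ?thesis by blast
qed

theorem theorem4:
  fixes f :: "real^'n \<Rightarrow> real^'n"
    and U U' :: "(real^'n) set"
    and G :: "'n frame"
    and M :: "'l \<Rightarrow> 'n hset" and L :: "'l set"
    and M' :: "'i \<Rightarrow> 'n hset" and I :: "'i set"
    and K :: "'j \<Rightarrow> 'n hset" and J :: "'j set"
  assumes "CARD('n) \<ge> 3" and "diffeomorphism f"
    and "hyperbolic f (Inv f U)" and "hyperbolic f (Inv f U')"
    and "is_frame G"
    and "finite L" and "L \<noteq> {}" and "\<forall>l\<in>L. is_hset G (M l) \<and> carr (M l) \<subseteq> U"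
    and "finite I" and "I \<noteq> {}" and "\<forall>i\<in>I. is_hset G (M' i) \<and> carr (M' i) \<subseteq> U'"
    and "finite J" and "\<forall>j\<in>J. is_hset G (K j)"
    and B3: "interconnected G f K J U M L U' M' I"
    and "indices_differ f (Inv f U) (Inv f U')"
  shows "heterodimensional_cycle f U (Inv f U) U' (Inv f U')"
proof -
  have con: "connected_by G f K J M L M' I" "connected_by G f K J M' I M L"
    "self_connected_in U G f K J M L" "self_connected_in U' G f K J M' I"
    using B3 by (simp_all add: interconnected_def)
  have "Ws f U' (Inv f U') \<inter> Wu f U (Inv f U) \<noteq> {}"
    by (rule connection_between[of G f U U' L M I M' J K]) (use assms con in auto)
  moreover have "Ws f U (Inv f U) \<inter> Wu f U' (Inv f U') \<noteq> {}"
    by (rule connection_between[of G f U' U I M' L M J K]) (use assms con in auto)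
  ultimately show ?thesis using assms by (simp add: heterodimensional_cycle_def)
qed

end
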